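(* Let $\phi:G\to H$ be a homomorphism between two Riemannian Lie groups, with differential $\xi:\mathfrak g\to\mathfrak h$ at the identity. In each of the following cases the harmonicity of $\phi$ and its biharmonicity are equivalent: 1. $H$ is 2-step nilpotent and $\mathfrak g$ is unimodular. 2. $\phi$ is a Riemannian submersion and $\mathfrak g$ is unimodular. 3. $\phi$ is a Riemannian submersion, $(\ker\xi)^\perp$ is a subalgebra of $\mathfrak g$ and $\mathfrak g$ is unimodular. 4. $\phi$ is a Riemannian submersion, $\ker\xi$ is unimodular, $\dim H=2$ and $H$ is non abelian.
   Context: All Lie groups are real and connected. A Riemannian Lie group is a Lie group with a left invariant Riemannian metric; its Lie algebra carries the induced inner product. A Lie algebra is unimodular if $\mathrm{tr}(\mathrm{ad}_u)=0$ for all its elements $u$. For a smooth map $\phi:(M,g)\to(N,h)$ of Riemannian manifolds and a local orthonormal frame $(E_i)$ of $TM$, the tension field is $\tau(\phi)=\sum_i(\nabla_{E_i}d\phi)(E_i)$, and the bitension field is $\tau_2(\phi)=-\sum_i\big((\nabla^\phi)^2_{E_i,E_i}\tau(\phi)+R^N(\tau(\phi),d\phi(E_i))d\phi(E_i)\big)$, where $\nabla^\phi$ is the pull-back of the Levi-Civita connection of $N$, $(\nabla^\phi)^2_{X,Y}=\nabla^\phi_X\nabla^\phi_Y-\nabla^\phi_{\nabla^M_XY}$ and $R^N(X,Y)=\nabla_X\nabla_Y-\nabla_Y\nabla_X-\nabla_{[X,Y]}$. The map $\phi$ is harmonic if $\tau(\phi)=0$ and biharmonic if $\tau_2(\phi)=0$.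 *)

theory Defs
  imports "HOL-Analysis.Analysis" "HOL-Algebra.Group" "HOL-Library.Function_Algebras"
begin

text \<open>Functions carry the pointwise vector space structure, so that \<open>span\<close>, \<open>independent\<close> and
  \<open>representation\<close> apply to tangent vectors, which are functionals on functions below.\<close>

instantiation "fun" :: (type, real_vector) real_vector
begin

definition scaleR_fun :: "real \<Rightarrow> ('a \<Rightarrow> 'b) \<Rightarrow> 'a \<Rightarrow> 'b" where
  "scaleR_fun a f = (\<lambda>x. a *\<^sub>R f x)"

instance
  by standard (auto simp: scaleR_fun_def fun_eq_iff algebra_simps)

end


section \<open>Smooth manifolds\<close>

text \<open>The derivative is taken within \<open>S\<close>. For open \<open>S\<close> this is the ordinary derivative; on
  \<open>S = {0}\<close> it makes every function smooth, as needed for zero-dimensional manifolds.\<close>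

primrec Ck_on :: "nat \<Rightarrow> 'a::euclidean_space set \<Rightarrow> ('a \<Rightarrow> 'b::real_normed_vector) \<Rightarrow> bool" where
  "Ck_on 0 S f \<longleftrightarrow> continuous_on S f"
| "Ck_on (Suc k) S f \<longleftrightarrow>
     (\<forall>x\<in>S. f differentiable (at x within S)) \<and>
     (\<forall>v. Ck_on k S (\<lambda>x. frechet_derivative f (at x within S) v))"

definition smooth_on :: "'a::euclidean_space set \<Rightarrow> ('a \<Rightarrow> 'b::real_normed_vector) \<Rightarrow> bool" where
  "smooth_on S f \<longleftrightarrow> (\<forall>k. Ck_on k S f)"

type_synonym ('m, 'e) atlas = "('m set \<times> ('m \<Rightarrow> 'e)) set"

text \<open>A manifold is a whole type \<open>'m\<close> with an atlas of charts \<open>(U, c)\<close>. Since every Euclidean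
  space type has positive dimension, a zero-dimensional manifold is encoded by charts
  whose image is \<open>{0}\<close>; all other manifolds have dimension \<open>DIM('e)\<close>.\<close>

definition smooth_manifold ::
    "('m::{t2_space,second_countable_topology}, 'e::euclidean_space) atlas \<Rightarrow> bool" where
  "smooth_manifold A \<longleftrightarrow>
     (\<Union>(U, c)\<in>A. U) = UNIV \<and>
     (\<forall>(U, c)\<in>A. open U \<and> homeomorphism U (c ` U) c (inv_into U c)) \<and>
     ((\<forall>(U, c)\<in>A. open (c ` U)) \<or> (\<forall>(U, c)\<in>A. c ` U = {0})) \<and>
     (\<forall>(U, c)\<in>A. \<forall>(V, d)\<in>A. smooth_on (c ` (U \<inter> V)) (d \<circ> inv_into U c))"

definition manifold_dim :: "('m, 'e::euclidean_space) atlas \<Rightarrow> nat" where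
  "manifold_dim A = (if \<forall>(U, c)\<in>A. open (c ` U) then DIM('e) else 0)"

definition prod_atlas :: "('m, 'e) atlas \<Rightarrow> ('n, 'f) atlas \<Rightarrow> ('m \<times> 'n, 'e \<times> 'f) atlas" where
  "prod_atlas A B = {(U \<times> V, map_prod c d) | U c V d. (U, c) \<in> A \<and> (V, d) \<in> B}"

definition smooth_map ::
    "('m::topological_space, 'e::euclidean_space) atlas \<Rightarrow>
     ('n::topological_space, 'f::euclidean_space) atlas \<Rightarrow> ('m \<Rightarrow> 'n) \<Rightarrow> bool" where
  "smooth_map A B \<phi> \<longleftrightarrow> continuous_on UNIV \<phi> \<and>
     (\<forall>(U, c)\<in>A. \<forall>(V, d)\<in>B. smooth_on (c ` (U \<inter> \<phi> -` V)) (d \<circ> \<phi> \<circ> inv_into U c))"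

definition smooth_functions :: "('m, 'e::euclidean_space) atlas \<Rightarrow> ('m \<Rightarrow> real) set" where
  "smooth_functions A = {f. \<forall>(U, c)\<in>A. smooth_on (c ` U) (f \<circ> inv_into U c)}"


section \<open>Tangent vectors and vector fields\<close>

text \<open>Tangent vectors at \<open>p\<close> are derivations at \<open>p\<close> of the algebra of smooth functions,
  set to \<open>0\<close> on non-smooth functions so that equality of tangent vectors is equality in HOL.\<close>

type_synonym 'm tvec = "('m \<Rightarrow> real) \<Rightarrow> real"

definition tangent_space :: "('m, 'e::euclidean_space) atlas \<Rightarrow> 'm \<Rightarrow> 'm tvec set" where
  "tangent_space A p = {v.
     (\<forall>f\<in>smooth_functions A. \<forall>h\<in>smooth_functions A.
        v (f + h) = v f + v h \<and> v (f * h) = v f * h p + f p * v h) \<and>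
     (\<forall>a. \<forall>f\<in>smooth_functions A. v (a *\<^sub>R f) = a * v f) \<and>
     (\<forall>f. f \<notin> smooth_functions A \<longrightarrow> v f = 0)}"

text \<open>\<open>pushforward B \<phi>\<close> is the differential of \<open>\<phi>\<close> at any point of its domain,
  where \<open>B\<close> is the atlas of the codomain.\<close>

definition pushforward ::
    "('n, 'f::euclidean_space) atlas \<Rightarrow> ('m \<Rightarrow> 'n) \<Rightarrow> 'm tvec \<Rightarrow> 'n tvec" where
  "pushforward B \<phi> v = (\<lambda>f. if f \<in> smooth_functions B then v (f \<circ> \<phi>) else 0)"

text \<open>Smooth sections of the pull-back bundle of the tangent bundle of the codomain of \<open>\<phi>\<close>.\<close>

definition fields_along ::
    "('m, 'e::euclidean_space) atlas \<Rightarrow> ('n, 'f::euclidean_space) atlas \<Rightarrow> ('m \<Rightarrow> 'n) \<Rightarrow>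
     ('m \<Rightarrow> 'n tvec) set" where
  "fields_along A B \<phi> = {V. (\<forall>p. V p \<in> tangent_space B (\<phi> p)) \<and>
     (\<forall>f\<in>smooth_functions B. (\<lambda>p. V p f) \<in> smooth_functions A)}"

definition vector_fields :: "('m, 'e::euclidean_space) atlas \<Rightarrow> ('m \<Rightarrow> 'm tvec) set" where
  "vector_fields A = fields_along A A id"

definition fscale :: "('m \<Rightarrow> real) \<Rightarrow> ('m \<Rightarrow> 'n tvec) \<Rightarrow> 'm \<Rightarrow> 'n tvec" where
  "fscale f V = (\<lambda>p. f p *\<^sub>R V p)"

definition bracket :: "('m \<Rightarrow> 'm tvec) \<Rightarrow> ('m \<Rightarrow> 'm tvec) \<Rightarrow> 'm \<Rightarrow> 'm tvec" where
  "bracket X Y = (\<lambda>p f. X p (\<lambda>q. Y q f) - Y p (\<lambda>q. X q f))"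

definition extension :: "('m, 'e::euclidean_space) atlas \<Rightarrow> 'm \<Rightarrow> 'm tvec \<Rightarrow> 'm \<Rightarrow> 'm tvec" where
  "extension A p v = (SOME X. X \<in> vector_fields A \<and> X p = v)"


section \<open>Riemannian metrics and connections\<close>

type_synonym 'm metric = "'m \<Rightarrow> 'm tvec \<Rightarrow> 'm tvec \<Rightarrow> real"

definition riemannian_metric :: "('m, 'e::euclidean_space) atlas \<Rightarrow> 'm metric \<Rightarrow> bool" where
  "riemannian_metric A g \<longleftrightarrow>
     (\<forall>p. \<forall>u\<in>tangent_space A p. \<forall>v\<in>tangent_space A p. \<forall>w\<in>tangent_space A p. \<forall>a b.
        g p (a *\<^sub>R u + b *\<^sub>R v) w = a * g p u w + b * g p v w \<and> g p u v = g p v u) \<and>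
     (\<forall>p. \<forall>u\<in>tangent_space A p. u \<noteq> 0 \<longrightarrow> g p u u > 0) \<and>
     (\<forall>X\<in>vector_fields A. \<forall>Y\<in>vector_fields A. (\<lambda>p. g p (X p) (Y p)) \<in> smooth_functions A)"

definition connection_along ::
    "('m, 'e::euclidean_space) atlas \<Rightarrow> ('n, 'f::euclidean_space) atlas \<Rightarrow> ('m \<Rightarrow> 'n) \<Rightarrow>
     (('m \<Rightarrow> 'm tvec) \<Rightarrow> ('m \<Rightarrow> 'n tvec) \<Rightarrow> 'm \<Rightarrow> 'n tvec) \<Rightarrow> bool" where
  "connection_along A B \<phi> D \<longleftrightarrow>
     (\<forall>X\<in>vector_fields A. \<forall>V\<in>fields_along A B \<phi>.
        D X V \<in> fields_along A B \<phi> \<and>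
        (\<forall>Y\<in>vector_fields A. D (X + Y) V = D X V + D Y V) \<and>
        (\<forall>W\<in>fields_along A B \<phi>. D X (V + W) = D X V + D X W) \<and>
        (\<forall>f\<in>smooth_functions A.
           D (fscale f X) V = fscale f (D X V) \<and>
           D X (fscale f V) = fscale (\<lambda>p. X p f) V + fscale f (D X V)))"

definition is_levi_civita ::
    "('m, 'e::euclidean_space) atlas \<Rightarrow> 'm metric \<Rightarrow>
     (('m \<Rightarrow> 'm tvec) \<Rightarrow> ('m \<Rightarrow> 'm tvec) \<Rightarrow> 'm \<Rightarrow> 'm tvec) \<Rightarrow> bool" where
  "is_levi_civita A g nabla \<longleftrightarrow>
     connection_along A A id nabla \<and>
     (\<forall>X\<in>vector_fields A. \<forall>Y\<in>vector_fields A. nabla X Y - nabla Y X = bracket X Y) \<and>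
     (\<forall>X\<in>vector_fields A. \<forall>Y\<in>vector_fields A. \<forall>Z\<in>vector_fields A. \<forall>p.
        X p (\<lambda>q. g q (Y q) (Z q)) = g p (nabla X Y p) (Z p) + g p (Y p) (nabla X Z p))"

text \<open>The choice operators below only fix values outside the spaces of smooth fields:
  the Levi-Civita connection and the pull-back connection are unique on those spaces.\<close>

definition levi_civita ::
    "('m, 'e::euclidean_space) atlas \<Rightarrow> 'm metric \<Rightarrow>
     ('m \<Rightarrow> 'm tvec) \<Rightarrow> ('m \<Rightarrow> 'm tvec) \<Rightarrow> 'm \<Rightarrow> 'm tvec" where
  "levi_civita A g = (SOME nabla. is_levi_civita A g nabla)"

definition pullback_connection ::
    "('m, 'e::euclidean_space) atlas \<Rightarrow> ('n, 'f::euclidean_space) atlas \<Rightarrow> 'n metric \<Rightarrow> ('m \<Rightarrow> 'n) \<Rightarrow>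
     ('m \<Rightarrow> 'm tvec) \<Rightarrow> ('m \<Rightarrow> 'n tvec) \<Rightarrow> 'm \<Rightarrow> 'n tvec" where
  "pullback_connection A B h \<phi> = (SOME D. connection_along A B \<phi> D \<and>
     (\<forall>X\<in>vector_fields A. \<forall>Y\<in>vector_fields B. \<forall>p.
        D X (Y \<circ> \<phi>) p =
        levi_civita B h (extension B (\<phi> p) (pushforward B \<phi> (X p))) Y (\<phi> p)))"

text \<open>The curvature \<open>R(u, v) w\<close> of tangent vectors at \<open>p\<close>; by tensoriality it does not depend on
  the chosen extensions to vector fields.\<close>

definition curvature ::
    "('m, 'e::euclidean_space) atlas \<Rightarrow> 'm metric \<Rightarrow> 'm \<Rightarrow> 'm tvec \<Rightarrow> 'm tvec \<Rightarrow> 'm tvec \<Rightarrow> 'm tvec" where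
  "curvature A g p u v w =
     (let nabla = levi_civita A g;
          X = extension A p u; Y = extension A p v; Z = extension A p w
      in (nabla X (nabla Y Z) - nabla Y (nabla X Z) - nabla (bracket X Y) Z) p)"


section \<open>Harmonic and biharmonic maps\<close>

text \<open>A local orthonormal frame around \<open>p\<close>, given by globally defined vector fields that are
  orthonormal on some neighbourhood of \<open>p\<close>. After shrinking the neighbourhood, every
  local frame is of this form, and the expressions below at \<open>p\<close> only depend on germs.\<close>

definition orthonormal_frame_at ::
    "('m::topological_space, 'e::euclidean_space) atlas \<Rightarrow> 'm metric \<Rightarrow> 'm \<Rightarrow>
     (nat \<Rightarrow> 'm \<Rightarrow> 'm tvec) \<Rightarrow> bool" where
  "orthonormal_frame_at A g p E \<longleftrightarrow>
     (\<forall>i<manifold_dim A. E i \<in> vector_fields A) \<and>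
     (\<exists>U. open U \<and> p \<in> U \<and> (\<forall>q\<in>U. \<forall>i<manifold_dim A. \<forall>j<manifold_dim A.
        g q (E i q) (E j q) = (if i = j then 1 else 0)))"

text \<open>\<open>(\<nabla>\<^sub>X d\<phi>)(Y)\<close>\<close>

definition second_fundamental_form ::
    "('m, 'e::euclidean_space) atlas \<Rightarrow> 'm metric \<Rightarrow> ('n, 'f::euclidean_space) atlas \<Rightarrow> 'n metric \<Rightarrow>
     ('m \<Rightarrow> 'n) \<Rightarrow> ('m \<Rightarrow> 'm tvec) \<Rightarrow> ('m \<Rightarrow> 'm tvec) \<Rightarrow> 'm \<Rightarrow> 'n tvec" where
  "second_fundamental_form A g B h \<phi> X Y =
     pullback_connection A B h \<phi> X (\<lambda>p. pushforward B \<phi> (Y p)) -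
     (\<lambda>p. pushforward B \<phi> (levi_civita A g X Y p))"

definition tension_field ::
    "('m::topological_space, 'e::euclidean_space) atlas \<Rightarrow> 'm metric \<Rightarrow>
     ('n, 'f::euclidean_space) atlas \<Rightarrow> 'n metric \<Rightarrow> ('m \<Rightarrow> 'n) \<Rightarrow> 'm \<Rightarrow> 'n tvec" where
  "tension_field A g B h \<phi> = (\<lambda>p.
     let E = (SOME E. orthonormal_frame_at A g p E)
     in \<Sum>i<manifold_dim A. second_fundamental_form A g B h \<phi> (E i) (E i) p)"

text \<open>\<open>(\<nabla>\<^sup>\<phi>)\<^sup>2\<^bsub>X,Y\<^esub> V\<close>\<close>

definition second_covariant_derivative ::
    "('m, 'e::euclidean_space) atlas \<Rightarrow> 'm metric \<Rightarrow> ('n, 'f::euclidean_space) atlas \<Rightarrow> 'n metric \<Rightarrow>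
     ('m \<Rightarrow> 'n) \<Rightarrow> ('m \<Rightarrow> 'm tvec) \<Rightarrow> ('m \<Rightarrow> 'm tvec) \<Rightarrow> ('m \<Rightarrow> 'n tvec) \<Rightarrow> 'm \<Rightarrow> 'n tvec" where
  "second_covariant_derivative A g B h \<phi> X Y V =
     (let D = pullback_connection A B h \<phi>
      in D X (D Y V) - D (levi_civita A g X Y) V)"

definition bitension_field ::
    "('m::topological_space, 'e::euclidean_space) atlas \<Rightarrow> 'm metric \<Rightarrow>
     ('n, 'f::euclidean_space) atlas \<Rightarrow> 'n metric \<Rightarrow> ('m \<Rightarrow> 'n) \<Rightarrow> 'm \<Rightarrow> 'n tvec" where
  "bitension_field A g B h \<phi> = (\<lambda>p.
     let E = (SOME E. orthonormal_frame_at A g p E);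
         \<tau> = tension_field A g B h \<phi>
     in - (\<Sum>i<manifold_dim A.
             second_covariant_derivative A g B h \<phi> (E i) (E i) \<tau> p +
             curvature B h (\<phi> p) (\<tau> p) (pushforward B \<phi> (E i p)) (pushforward B \<phi> (E i p))))"

definition harmonic ::
    "('m::topological_space, 'e::euclidean_space) atlas \<Rightarrow> 'm metric \<Rightarrow>
     ('n, 'f::euclidean_space) atlas \<Rightarrow> 'n metric \<Rightarrow> ('m \<Rightarrow> 'n) \<Rightarrow> bool" where
  "harmonic A g B h \<phi> \<longleftrightarrow> (\<forall>p. tension_field A g B h \<phi> p = 0)"

definition biharmonic ::
    "('m::topological_space, 'e::euclidean_space) atlas \<Rightarrow> 'm metric \<Rightarrow>
     ('n, 'f::euclidean_space) atlas \<Rightarrow> 'n metric \<Rightarrow> ('m \<Rightarrow> 'n) \<Rightarrow> bool" where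
  "biharmonic A g B h \<phi> \<longleftrightarrow> (\<forall>p. bitension_field A g B h \<phi> p = 0)"

definition kernel_at ::
    "('m, 'e::euclidean_space) atlas \<Rightarrow> ('n, 'f::euclidean_space) atlas \<Rightarrow> ('m \<Rightarrow> 'n) \<Rightarrow> 'm \<Rightarrow>
     'm tvec set" where
  "kernel_at A B \<phi> p = {u \<in> tangent_space A p. pushforward B \<phi> u = 0}"

definition orthogonal_at ::
    "('m, 'e::euclidean_space) atlas \<Rightarrow> 'm metric \<Rightarrow> 'm \<Rightarrow> 'm tvec set \<Rightarrow> 'm tvec set" where
  "orthogonal_at A g p S = {v \<in> tangent_space A p. \<forall>u\<in>S. g p u v = 0}"

definition riemannian_submersion ::
    "('m::topological_space, 'e::euclidean_space) atlas \<Rightarrow> 'm metric \<Rightarrow>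
     ('n::topological_space, 'f::euclidean_space) atlas \<Rightarrow> 'n metric \<Rightarrow> ('m \<Rightarrow> 'n) \<Rightarrow> bool" where
  "riemannian_submersion A g B h \<phi> \<longleftrightarrow>
     smooth_map A B \<phi> \<and>
     (\<forall>p. pushforward B \<phi> ` tangent_space A p = tangent_space B (\<phi> p)) \<and>
     (\<forall>p. \<forall>u\<in>orthogonal_at A g p (kernel_at A B \<phi> p).
          \<forall>v\<in>orthogonal_at A g p (kernel_at A B \<phi> p).
        h (\<phi> p) (pushforward B \<phi> u) (pushforward B \<phi> v) = g p u v)"


section \<open>Riemannian Lie groups\<close>

definition lie_group ::
    "'m::{t2_space,second_countable_topology} monoid \<Rightarrow> ('m, 'e::euclidean_space) atlas \<Rightarrow> bool" where
  "lie_group G A \<longleftrightarrow>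
     group G \<and> carrier G = UNIV \<and> smooth_manifold A \<and>
     smooth_map (prod_atlas A A) A (\<lambda>(x, y). x \<otimes>\<^bsub>G\<^esub> y) \<and>
     smooth_map A A (\<lambda>x. inv\<^bsub>G\<^esub> x)"

definition riemannian_lie_group ::
    "'m::{t2_space,second_countable_topology} monoid \<Rightarrow> ('m, 'e::euclidean_space) atlas \<Rightarrow>
     'm metric \<Rightarrow> bool" where
  "riemannian_lie_group G A g \<longleftrightarrow>
     lie_group G A \<and> riemannian_metric A g \<and>
     (\<forall>a x. \<forall>u\<in>tangent_space A x. \<forall>v\<in>tangent_space A x.
        g (a \<otimes>\<^bsub>G\<^esub> x) (pushforward A (\<lambda>y. a \<otimes>\<^bsub>G\<^esub> y) u) (pushforward A (\<lambda>y. a \<otimes>\<^bsub>G\<^esub> y) v) = g x u v)"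

text \<open>The Lie algebra is the tangent space at the identity, with the bracket of left invariant
  vector fields.\<close>

definition lie_algebra :: "'m monoid \<Rightarrow> ('m, 'e::euclidean_space) atlas \<Rightarrow> 'm tvec set" where
  "lie_algebra G A = tangent_space A \<one>\<^bsub>G\<^esub>"

definition left_invariant_field ::
    "'m monoid \<Rightarrow> ('m, 'e::euclidean_space) atlas \<Rightarrow> 'm tvec \<Rightarrow> 'm \<Rightarrow> 'm tvec" where
  "left_invariant_field G A u = (\<lambda>p. pushforward A (\<lambda>q. p \<otimes>\<^bsub>G\<^esub> q) u)"

definition lie_bracket ::
    "'m monoid \<Rightarrow> ('m, 'e::euclidean_space) atlas \<Rightarrow> 'm tvec \<Rightarrow> 'm tvec \<Rightarrow> 'm tvec" where
  "lie_bracket G A u v =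
     bracket (left_invariant_field G A u) (left_invariant_field G A v) \<one>\<^bsub>G\<^esub>"

text \<open>The trace of a linear endomorphism \<open>T\<close> of a finite-dimensional subspace \<open>V\<close>, as the sum of
  its diagonal coefficients in some basis.\<close>

definition trace_on :: "'a::real_vector set \<Rightarrow> ('a \<Rightarrow> 'a) \<Rightarrow> real" where
  "trace_on V T = (let B = (SOME B. independent B \<and> span B = V)
     in \<Sum>b\<in>B. representation B (T b) b)"

definition unimodular :: "'m monoid \<Rightarrow> ('m, 'e::euclidean_space) atlas \<Rightarrow> 'm tvec set \<Rightarrow> bool" where
  "unimodular G A \<kk> \<longleftrightarrow> (\<forall>u\<in>\<kk>. trace_on \<kk> (lie_bracket G A u) = 0)"

definition lie_subalgebra :: "'m monoid \<Rightarrow> ('m, 'e::euclidean_space) atlas \<Rightarrow> 'm tvec set \<Rightarrow> bool" where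
  "lie_subalgebra G A \<kk> \<longleftrightarrow>
     \<kk> \<subseteq> lie_algebra G A \<and> subspace \<kk> \<and> (\<forall>u\<in>\<kk>. \<forall>v\<in>\<kk>. lie_bracket G A u v \<in> \<kk>)"

text \<open>Nilpotency of class at most two: commutators are central.\<close>

definition two_step_nilpotent :: "'m monoid \<Rightarrow> bool" where
  "two_step_nilpotent G \<longleftrightarrow>
     (\<forall>a\<in>carrier G. \<forall>b\<in>carrier G. \<forall>c\<in>carrier G.
        let k = a \<otimes>\<^bsub>G\<^esub> b \<otimes>\<^bsub>G\<^esub> inv\<^bsub>G\<^esub> a \<otimes>\<^bsub>G\<^esub> inv\<^bsub>G\<^esub> b
        in k \<otimes>\<^bsub>G\<^esub> c = c \<otimes>\<^bsub>G\<^esub> k)"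

end

theory Submission
  imports Defs
begin

text \<open>Left translation identifies each tangent space of a Lie group with the Lie algebra, which is
  identified isometrically with the Euclidean model space of the charts. Vector fields along a
  homomorphism \<open>\<phi>\<close> become vector-valued smooth functions; in these terms the Levi-Civita and the
  pull-back connection are a directional derivative plus a constant bilinear product, and both
  tension fields are left invariant, with values \<open>\<tau>\<close> and \<open>- \<tau>\<^sub>2\<close> at the identity. Koszul's formula
  gives, with \<open>\<xi>\<close> the differential of \<open>\<phi>\<close>, an orthonormal basis \<open>b\<close> of \<open>\<gg>\<close> and \<open>U = \<Sum>\<^sub>b \<nabla>\<^sub>b b\<close>,
  \<open>- \<langle>\<tau>\<^sub>2, \<tau>\<rangle> = \<langle>[\<xi> U, \<tau>], \<tau>\<rangle> + \<Sum>\<^sub>b (\<bar>[\<tau>, \<xi> b]\<bar>\<^sup>2 + \<langle>[\<tau>, [\<tau>, \<xi> b]], \<xi> b\<rangle>).\<close>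
  If \<open>\<gg>\<close> is unimodular then \<open>U = 0\<close> and \<open>\<langle>\<tau>, y\<rangle> = \<Sum>\<^sub>b \<langle>[y, \<xi> b], \<xi> b\<rangle>\<close>. For a 2-step nilpotent target the
  last terms vanish, so \<open>\<tau>\<^sub>2 = 0\<close> makes \<open>\<tau>\<close> commute with all \<open>\<xi> b\<close>, whence \<open>\<tau> = 0\<close>. For a submersion
  the sum is half of the squared norm of \<open>ad\<^sub>\<tau> + ad\<^sub>\<tau>\<^sup>*\<close>, so \<open>ad\<^sub>\<tau>\<close> is skew and traceless, and again
  \<open>\<tau> = 0\<close>. If only the kernel is unimodular, \<open>\<tau>\<close> represents a character of \<open>\<hh>\<close>, hence is orthogonal to
  \<open>[\<hh>, \<hh>]\<close>; in dimension two a nonzero \<open>\<tau>\<close> with \<open>ad\<^sub>\<tau>\<close> skew would make \<open>\<hh>\<close> abelian.\<close>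

section \<open>Calculus of smooth functions on open sets\<close>

text \<open>The definitions select connections, extensions of tangent vectors, orthonormal frames
  and trace bases by choice, so every selected object must be shown to give the value computed in
  the left invariant frame. For connections this works because the Leibniz rule determines them by
  their values on a frame, for frames and bases because a trace does not depend on the basis.
  Tangent vectors are derivations of global functions, which is why cut-off functions and Hadamard's
  lemma come in. Nilpotency and commutativity of the target are properties of the group. Nilpotency
  passes to the bracket by differentiating conjugation twice. Conversely, a vanishing bracket makes
  the group commutative because a function with zero derivative is constant on a connected manifold;
  this takes the place of the exponential map. In the last case the character exists because the
  kernel of \<open>\<xi>\<close> is an ideal: the trace of the adjoint action on it vanishes on
  brackets, and unimodularity of the kernel lets this trace descend to the target.\<close>

lemma has_derivative_within_cong:
  assumes "x \<in> S" "\<And>y. y \<in> S \<Longrightarrow> f y = g y"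
  shows "(f has_derivative D) (at x within S) \<longleftrightarrow> (g has_derivative D) (at x within S)"
  using assms has_derivative_transform[of x S g f D] has_derivative_transform[of x S f g D] by auto

lemma Ck_on_cong:
  assumes "\<And>x. x \<in> S \<Longrightarrow> f x = g x"
  shows "Ck_on k S f \<longleftrightarrow> Ck_on k S g"
  using assms
proof (induction k arbitrary: f g)
  case 0
  then show ?case using continuous_on_cong[of S S f g] by simp
next
  case (Suc k)
  have hd: "(f has_derivative D) (at x within S) \<longleftrightarrow> (g has_derivative D) (at x within S)"
    if "x \<in> S" for x D
    using has_derivative_within_cong[OF that Suc.prems] .
  have "f differentiable (at x within S) \<longleftrightarrow> g differentiable (at x within S)" if "x \<in> S" for x
    using hd[OF that] by (simp add: differentiable_def)
  moreover have "frechet_derivative f (at x within S) = frechet_derivative g (at x within S)"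
    if "x \<in> S" for x
    using hd[OF that] by (simp add: frechet_derivative_def)
  then have "Ck_on k S (\<lambda>x. frechet_derivative f (at x within S) v) \<longleftrightarrow>
      Ck_on k S (\<lambda>x. frechet_derivative g (at x within S) v)" for v
    by (intro Suc.IH) simp
  ultimately show ?case by auto
qed

text \<open>The filter \<open>at x within S\<close> is trivial here, so the zero map is a derivative
  of any function.\<close>

lemma Ck_on_subset_singleton: "S \<subseteq> {a} \<Longrightarrow> Ck_on k S f"
proof (induction k arbitrary: f)
  case 0
  then show ?case by (auto dest!: subset_singletonD)
next
  case (Suc k f)
  have "f differentiable (at x within S)" if "x \<in> S" for x
  proof -
    have "S = {x}" using that Suc.prems by auto
    then show ?thesis
      using bounded_linear_zero unfolding differentiable_def
      by (metis has_derivative_within_singleton_iff)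
  qed
  then show ?case using Suc by auto
qed

text \<open>On an open set the derivative within the set is the ordinary one and is unique, so an
  explicitly computed \<open>F\<close> may replace \<open>frechet_derivative\<close>. Together with
  \<open>Ck_on_SucD\<close> this drives the inductions on \<open>k\<close> below.\<close>

lemma Ck_on_SucI:
  assumes "open S" "\<And>x. x \<in> S \<Longrightarrow> (f has_derivative F x) (at x)"
    and "\<And>v. Ck_on k S (\<lambda>x. F x v)"
  shows "Ck_on (Suc k) S f"
proof -
  have fd: "frechet_derivative f (at x within S) = F x" if "x \<in> S" for x
    using frechet_derivative_at[OF assms(2)[OF that]] at_within_open[OF that assms(1)] by simp
  have "Ck_on k S (\<lambda>x. frechet_derivative f (at x within S) v)" for v
    using assms(3)[of v]
    by (subst Ck_on_cong[of S _ "\<lambda>x. F x v" k]) (simp_all add: fd)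
  moreover have "f differentiable (at x within S)" if "x \<in> S" for x
    using assms(2)[OF that] at_within_open[OF that assms(1)] by (auto simp: differentiable_def)
  ultimately show ?thesis by simp
qed

lemma Ck_on_SucD:
  assumes "open S" "Ck_on (Suc k) S f"
  shows "x \<in> S \<Longrightarrow> (f has_derivative frechet_derivative f (at x)) (at x)"
    and "Ck_on k S (\<lambda>x. frechet_derivative f (at x) v)"
proof -
  show "x \<in> S \<Longrightarrow> (f has_derivative frechet_derivative f (at x)) (at x)"
    using assms(2) at_within_open[OF _ assms(1), of x]
    by (auto simp: frechet_derivative_works[symmetric])
  have "Ck_on k S (\<lambda>x. frechet_derivative f (at x within S) v)" using assms by auto
  then show "Ck_on k S (\<lambda>x. frechet_derivative f (at x) v)"
    by (subst Ck_on_cong[of S _ "\<lambda>x. frechet_derivative f (at x within S) v" k])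
      (simp_all add: at_within_open[OF _ assms(1)])
qed

text \<open>Continuity is not part of the successor clause of \<open>Ck_on\<close>. It comes from
  differentiability at the base of the induction; the step passes to the directional
  derivatives.\<close>

lemma Ck_on_Suc_imp:
  assumes "open S" "Ck_on (Suc k) S f"
  shows "Ck_on k S f"
  using assms(2)
proof (induction k arbitrary: f)
  case 0
  show ?case
    using has_derivative_continuous[OF Ck_on_SucD(1)[OF assms(1) 0]]
    by (simp add: continuous_on_eq_continuous_at[OF assms(1)])
next
  case (Suc k)
  show ?case
    using Ck_on_SucD[OF assms(1) Suc.prems] Suc.IH by (intro Ck_on_SucI[OF assms(1)]) auto
qed

lemma Ck_on_subset:
  assumes "open S" "open T" "T \<subseteq> S" "Ck_on k S f"
  shows "Ck_on k T f"
  using assms(4)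
proof (induction k arbitrary: f)
  case 0
  then show ?case using assms continuous_on_subset by auto
next
  case (Suc k)
  show ?case
    using Ck_on_SucD[OF assms(1) Suc.prems] Suc.IH assms(3)
    by (intro Ck_on_SucI[OF assms(2)]) auto
qed

lemma Ck_on_local:
  assumes "open S" "\<And>x. x \<in> S \<Longrightarrow> \<exists>T. open T \<and> x \<in> T \<and> Ck_on k T f"
  shows "Ck_on k S f"
  using assms(2)
proof (induction k arbitrary: f)
  case 0
  have "isCont f x" if "x \<in> S" for x
    using 0[OF that] continuous_on_eq_continuous_at by auto
  then show ?case using continuous_on_eq_continuous_at[OF assms(1)] by auto
next
  case (Suc k)
  have "(f has_derivative frechet_derivative f (at x)) (at x)" if "x \<in> S" for x
    using Suc.prems[OF that] Ck_on_SucD(1) by blast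
  moreover have "Ck_on k S (\<lambda>x. frechet_derivative f (at x) v)" for v
  proof (rule Suc.IH)
    fix x assume "x \<in> S"
    then obtain T where "open T" "x \<in> T" "Ck_on (Suc k) T f" using Suc.prems by blast
    then show "\<exists>T. open T \<and> x \<in> T \<and> Ck_on k T (\<lambda>x. frechet_derivative f (at x) v)"
      using Ck_on_SucD(2) by blast
  qed
  ultimately show ?case by (intro Ck_on_SucI[OF assms(1)]) auto
qed

lemma Ck_on_const: "open S \<Longrightarrow> Ck_on k S (\<lambda>_. c)"
proof (induction k arbitrary: c)
  case (Suc k)
  then show ?case by (intro Ck_on_SucI[where F = "\<lambda>_ _. 0"]) auto
qed simp

lemma Ck_on_bounded_linear:
  assumes "open S" "bounded_linear L" "Ck_on k S f"
  shows "Ck_on k S (\<lambda>x. L (f x))"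
  using assms(3)
proof (induction k arbitrary: f)
  case 0
  then show ?case by (auto intro: bounded_linear.continuous_on[OF assms(2)])
next
  case (Suc k)
  note D = Ck_on_SucD[OF assms(1) Suc.prems]
  show ?case
    using D Suc.IH
    by (intro Ck_on_SucI[OF assms(1), where F = "\<lambda>x v. L (frechet_derivative f (at x) v)"])
      (auto intro: bounded_linear.has_derivative[OF assms(2)])
qed

lemma Ck_on_ident: "open S \<Longrightarrow> Ck_on k S (\<lambda>x. x)"
proof (cases k)
  case (Suc m)
  assume "open S"
  then show ?thesis unfolding Suc
    by (intro Ck_on_SucI[where F = "\<lambda>_ v. v"] Ck_on_const) (auto intro: derivative_eq_intros)
qed simp

lemma Ck_on_add:
  assumes "open S" "Ck_on k S f" "Ck_on k S g"
  shows "Ck_on k S (\<lambda>x. f x + g x)"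
  using assms(2,3)
proof (induction k arbitrary: f g)
  case 0
  then show ?case by (auto intro: continuous_intros)
next
  case (Suc k)
  note D = Ck_on_SucD[OF assms(1) Suc.prems(1)] Ck_on_SucD[OF assms(1) Suc.prems(2)]
  show ?case
    using D Suc.IH
    by (intro Ck_on_SucI[OF assms(1), where
          F = "\<lambda>x v. frechet_derivative f (at x) v + frechet_derivative g (at x) v"])
      (auto intro: has_derivative_add)
qed

lemma Ck_on_sum:
  assumes "open S" "\<And>i. i \<in> I \<Longrightarrow> Ck_on k S (f i)"
  shows "Ck_on k S (\<lambda>x. \<Sum>i\<in>I. f i x)"
  using assms(2)
  by (induction I rule: infinite_finite_induct) (auto intro: Ck_on_add Ck_on_const assms(1))

lemma Ck_on_scaleR:
  assumes "open S" "Ck_on k S f" "Ck_on k S g"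
  shows "Ck_on k S (\<lambda>x. f x *\<^sub>R g x)"
  using assms(2,3)
proof (induction k arbitrary: f g)
  case 0
  then show ?case by (auto intro: continuous_intros)
next
  case (Suc k)
  note D = Ck_on_SucD[OF assms(1) Suc.prems(1)] Ck_on_SucD[OF assms(1) Suc.prems(2)]
  show ?case
    using D Suc.IH Ck_on_Suc_imp[OF assms(1) Suc.prems(1)] Ck_on_Suc_imp[OF assms(1) Suc.prems(2)]
    by (intro Ck_on_SucI[OF assms(1), where
          F = "\<lambda>x v. f x *\<^sub>R frechet_derivative g (at x) v + frechet_derivative f (at x) v *\<^sub>R g x"]
          Ck_on_add assms(1))
      (auto intro: has_derivative_scaleR)
qed

lemma Ck_on_mult:
  fixes f g :: "'a::euclidean_space \<Rightarrow> real"
  shows "open S \<Longrightarrow> Ck_on k S f \<Longrightarrow> Ck_on k S g \<Longrightarrow> Ck_on k S (\<lambda>x. f x * g x)"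
  using Ck_on_scaleR[of S k f g] by simp

lemma Ck_on_inverse:
  fixes f :: "'a::euclidean_space \<Rightarrow> real"
  assumes "open S" "Ck_on k S f" "\<And>x. x \<in> S \<Longrightarrow> f x \<noteq> 0"
  shows "Ck_on k S (\<lambda>x. inverse (f x))"
  using assms(2,3)
proof (induction k arbitrary: f)
  case 0
  then show ?case by (simp add: continuous_on_inverse)
next
  case (Suc k)
  note D = Ck_on_SucD[OF assms(1) Suc.prems(1)]
  \<comment> \<open>The derivative of the reciprocal contains the reciprocal again, so the induction
    hypothesis is needed for \<open>f\<close> itself, weakened by one order.\<close>
  have inv: "Ck_on k S (\<lambda>x. inverse (f x))"
    using Suc.IH[OF Ck_on_Suc_imp[OF assms(1) Suc.prems(1)]] Suc.prems(2) by simp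
  show ?case
  proof (rule Ck_on_SucI[OF assms(1), where
        F = "\<lambda>x v. (-1) * ((inverse (f x) * frechet_derivative f (at x) v) * inverse (f x))"])
    fix x assume x: "x \<in> S"
    have "((\<lambda>x. inverse (f x)) has_derivative
        (\<lambda>v. - (inverse (f x) * frechet_derivative f (at x) v * inverse (f x)))) (at x)"
      using Deriv.has_derivative_inverse[OF Suc.prems(2)[OF x] D(1)[OF x]] .
    then show "((\<lambda>x. inverse (f x)) has_derivative
        (\<lambda>v. (-1) * ((inverse (f x) * frechet_derivative f (at x) v) * inverse (f x)))) (at x)"
      by simp
  next
    show "Ck_on k S (\<lambda>x. (-1) * ((inverse (f x) * frechet_derivative f (at x) v) * inverse (f x)))" for v
      using Ck_on_mult[OF assms(1) Ck_on_const[OF assms(1), of k "-1"]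
          Ck_on_mult[OF assms(1) Ck_on_mult[OF assms(1) inv D(2)[of v]] inv]] .
  qed
qed

lemma linear_euclidean_expand:
  assumes "linear L"
  shows "L (v::'a::euclidean_space) = (\<Sum>b\<in>Basis. (v \<bullet> b) *\<^sub>R L b)"
proof -
  have "L v = L (\<Sum>b\<in>Basis. (v \<bullet> b) *\<^sub>R b)" by (simp add: euclidean_representation)
  also have "\<dots> = (\<Sum>b\<in>Basis. (v \<bullet> b) *\<^sub>R L b)"
    by (simp add: linear_sum[OF assms] linear_scale[OF assms])
  finally show ?thesis .
qed

lemma Ck_on_compose:
  fixes f :: "'a::euclidean_space \<Rightarrow> 'b::euclidean_space" and h :: "'b \<Rightarrow> 'c::real_normed_vector"
  assumes "open S" "open T" "f ` S \<subseteq> T" "Ck_on k S f" "Ck_on k T h"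
  shows "Ck_on k S (\<lambda>x. h (f x))"
  using assms(4,5)
proof (induction k arbitrary: h)
  case 0
  then show ?case using assms(3) continuous_on_compose2[of T h S f] by auto
next
  case (Suc k)
  note D = Ck_on_SucD[OF assms(1) Suc.prems(1)] Ck_on_SucD[OF assms(2) Suc.prems(2)]
  \<comment> \<open>Expanding the chain rule over the basis turns a composition of linear maps into
    products of scalar functions with partial derivatives of \<open>h\<close> composed with
    \<open>f\<close>; the induction hypothesis applies to the latter.\<close>
  let ?F = "\<lambda>x v. \<Sum>b\<in>Basis. (frechet_derivative f (at x) v \<bullet> b) *\<^sub>R frechet_derivative h (at (f x)) b"
  show ?case
  proof (rule Ck_on_SucI[OF assms(1)])
    fix x assume x: "x \<in> S"
    have "((\<lambda>x. h (f x)) has_derivative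
        (\<lambda>v. frechet_derivative h (at (f x)) (frechet_derivative f (at x) v))) (at x)"
      using x assms(3) by (intro has_derivative_compose[OF D(1)[OF x]] D(3)) auto
    moreover have "(\<lambda>v. frechet_derivative h (at (f x)) (frechet_derivative f (at x) v)) = ?F x"
      using D(3)[of "f x"] assms(3) x
      by (intro ext linear_euclidean_expand[of "frechet_derivative h (at (f x))"] has_derivative_linear) auto
    ultimately show "((\<lambda>x. h (f x)) has_derivative ?F x) (at x)"
      by (rule has_derivative_eq_rhs)
  next
    fix v
    have "Ck_on k S (\<lambda>x. frechet_derivative f (at x) v \<bullet> b)" for b
      by (rule Ck_on_bounded_linear[OF assms(1) bounded_linear_inner_left D(2)])
    moreover have "Ck_on k S (\<lambda>x. frechet_derivative h (at (f x)) b)" for b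
      by (rule Suc.IH[OF Ck_on_Suc_imp[OF assms(1) Suc.prems(1)] D(4)])
    ultimately show "Ck_on k S (\<lambda>x. ?F x v)"
      using Ck_on_scaleR[OF assms(1)] by (intro Ck_on_sum[OF assms(1)]) blast
  qed
qed

lemma Ck_on_Pair:
  assumes "open S" "Ck_on k S f" "Ck_on k S g"
  shows "Ck_on k S (\<lambda>x. (f x, g x))"
proof -
  have "Ck_on k S (\<lambda>x. (f x, 0) + (0, g x))"
    using assms
    by (intro Ck_on_add Ck_on_bounded_linear[of S "\<lambda>y. (y, 0)"] Ck_on_bounded_linear[of S "\<lambda>y. (0, y)"])
      (auto intro: bounded_linear_intros)
  then show ?thesis by simp
qed

lemma smooth_on_D:
  assumes "open S" "smooth_on S f"
  shows "x \<in> S \<Longrightarrow> (f has_derivative frechet_derivative f (at x)) (at x)"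
    and "smooth_on S (\<lambda>x. frechet_derivative f (at x) v)"
    and "continuous_on S f"
proof -
  show "x \<in> S \<Longrightarrow> (f has_derivative frechet_derivative f (at x)) (at x)"
    using Ck_on_SucD(1)[OF assms(1)] assms(2) unfolding smooth_on_def by blast
  show "smooth_on S (\<lambda>x. frechet_derivative f (at x) v)"
    using Ck_on_SucD(2)[OF assms(1)] assms(2) unfolding smooth_on_def by blast
  have "Ck_on 0 S f" using assms(2) unfolding smooth_on_def by blast
  then show "continuous_on S f" by simp
qed

lemma smooth_on_cong:
  assumes "\<And>x. x \<in> S \<Longrightarrow> f x = g x"
  shows "smooth_on S f \<longleftrightarrow> smooth_on S g"
  unfolding smooth_on_def using Ck_on_cong[of S f g, OF assms] by (rule all_cong1)

lemma smooth_on_subset_singleton: "S \<subseteq> {a} \<Longrightarrow> smooth_on S f"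
  unfolding smooth_on_def using Ck_on_subset_singleton by blast

lemma smooth_on_subset: "open S \<Longrightarrow> open T \<Longrightarrow> T \<subseteq> S \<Longrightarrow> smooth_on S f \<Longrightarrow> smooth_on T f"
  by (simp add: smooth_on_def Ck_on_subset[of S T])

lemma smooth_on_local:
  assumes "open S" "\<And>x. x \<in> S \<Longrightarrow> \<exists>T. open T \<and> x \<in> T \<and> smooth_on T f"
  shows "smooth_on S f"
  unfolding smooth_on_def
proof
  show "Ck_on k S f" for k
    using assms by (intro Ck_on_local) (auto simp: smooth_on_def)
qed

lemma smooth_on_const: "open S \<Longrightarrow> smooth_on S (\<lambda>_. c)"
  unfolding smooth_on_def by (rule allI, rule Ck_on_const; simp)

lemma smooth_on_ident: "open S \<Longrightarrow> smooth_on S (\<lambda>x. x)"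
  unfolding smooth_on_def by (rule allI, rule Ck_on_ident; simp)

lemma smooth_on_bounded_linear: "open S \<Longrightarrow> bounded_linear L \<Longrightarrow> smooth_on S f \<Longrightarrow> smooth_on S (\<lambda>x. L (f x))"
  unfolding smooth_on_def by (rule allI, rule Ck_on_bounded_linear[of S L _ f]; simp)

lemma smooth_on_add: "open S \<Longrightarrow> smooth_on S f \<Longrightarrow> smooth_on S g \<Longrightarrow> smooth_on S (\<lambda>x. f x + g x)"
  unfolding smooth_on_def by (rule allI, rule Ck_on_add; simp)

lemma smooth_on_sum: "open S \<Longrightarrow> (\<And>i. i \<in> I \<Longrightarrow> smooth_on S (F i)) \<Longrightarrow> smooth_on S (\<lambda>x. \<Sum>i\<in>I. F i x)"
  unfolding smooth_on_def by (rule allI, rule Ck_on_sum; simp)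

lemma smooth_on_mult: "open S \<Longrightarrow> smooth_on S f \<Longrightarrow> smooth_on S g \<Longrightarrow> smooth_on S (\<lambda>x. f x * g x :: real)"
  unfolding smooth_on_def by (rule allI, rule Ck_on_mult; simp)

lemma smooth_on_inverse: "open S \<Longrightarrow> smooth_on S f \<Longrightarrow> (\<And>x. x \<in> S \<Longrightarrow> f x \<noteq> 0) \<Longrightarrow>
    smooth_on S (\<lambda>x. inverse (f x) :: real)"
  unfolding smooth_on_def by (rule allI, rule Ck_on_inverse; simp)

lemma smooth_on_Pair: "open S \<Longrightarrow> smooth_on S f \<Longrightarrow> smooth_on S g \<Longrightarrow> smooth_on S (\<lambda>x. (f x, g x))"
  unfolding smooth_on_def by (rule allI, rule Ck_on_Pair; simp)

lemma smooth_on_compose: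
  fixes f :: "'a::euclidean_space \<Rightarrow> 'b::euclidean_space"
  shows "open S \<Longrightarrow> open T \<Longrightarrow> f ` S \<subseteq> T \<Longrightarrow> smooth_on S f \<Longrightarrow> smooth_on T h \<Longrightarrow>
    smooth_on S (\<lambda>x. h (f x))"
  unfolding smooth_on_def using Ck_on_compose[of S T f _ h] by simp

section \<open>Flat functions and bump functions\<close>

definition flat_exp :: "nat \<Rightarrow> real \<Rightarrow> real" where
  "flat_exp n x = (if x > 0 then inverse x ^ n * exp (- inverse x) else 0)"

lemma flat_exp_tendsto_0: "(flat_exp n \<longlongrightarrow> 0) (at 0)"
proof (rule filterlim_split_at)
  have "eventually (\<lambda>x. flat_exp n x = 0) (at_left 0)"
    by (auto simp: eventually_at_filter flat_exp_def)
  then show "(flat_exp n \<longlongrightarrow> 0) (at_left 0)"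
    by (rule tendsto_eventually)
next
  have "((\<lambda>x. inverse x ^ n / exp (inverse x)) \<longlongrightarrow> (0::real)) (at_right 0)"
    by (rule filterlim_compose[OF tendsto_power_div_exp_0 filterlim_inverse_at_top_right])
  moreover have "eventually (\<lambda>x. inverse x ^ n / exp (inverse x) = flat_exp n x) (at_right 0)"
    by (auto simp: eventually_at_filter flat_exp_def exp_minus divide_inverse)
  ultimately show "(flat_exp n \<longlongrightarrow> 0) (at_right 0)"
    by (rule Lim_transform_eventually)
qed

text \<open>The derivative of a member of the family is a combination of two other members, so an
  induction over the order of smoothness can run for all \<open>n\<close> at once. The member
  \<open>n = 0\<close> is the classical flat function.\<close>

lemma DERIV_flat_exp:
  "(flat_exp n has_real_derivative flat_exp (n + 2) x - n * flat_exp (n + 1) x) (at x)"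
proof -
  consider "x > 0" | "x < 0" | "x = 0" by linarith
  then show ?thesis
  proof cases
    case 1
    have "((\<lambda>x. inverse x ^ n * exp (- inverse x)) has_real_derivative
        flat_exp (n + 2) x - n * flat_exp (n + 1) x) (at x)"
    proof -
      have i: "(inverse has_real_derivative - (inverse x * inverse x)) (at x)"
        using DERIV_inverse[of x] 1 by simp
      have e: "((\<lambda>x. exp (- inverse x)) has_real_derivative exp (- inverse x) * (inverse x * inverse x)) (at x)"
        using DERIV_chain2[OF DERIV_exp DERIV_minus[OF i]] by simp
      show ?thesis
        using DERIV_mult[OF DERIV_power[OF i, of n] e] 1
        by (cases n) (simp_all add: flat_exp_def algebra_simps)
    qed
    then show ?thesis
      by (rule has_field_derivative_transform_within_open[where S = "{0<..}"])
        (use 1 in \<open>auto simp: flat_exp_def\<close>)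
  next
    case 2
    have "((\<lambda>x. 0) has_real_derivative flat_exp (n + 2) x - n * flat_exp (n + 1) x) (at x)"
      using 2 by (auto simp: flat_exp_def)
    then show ?thesis
      by (rule has_field_derivative_transform_within_open[where S = "{..<0}"])
        (use 2 in \<open>auto simp: flat_exp_def\<close>)
  next
    case 3
    \<comment> \<open>At 0 the difference quotient is itself the next member of the family, which
      tends to 0.\<close>
    have "(flat_exp n y - flat_exp n 0) / y = flat_exp (n + 1) y" for y
      by (auto simp: flat_exp_def field_simps)
    then have "((\<lambda>y. (flat_exp n (0 + y) - flat_exp n 0) / y) \<longlongrightarrow> 0) (at 0)"
      using flat_exp_tendsto_0[of "n + 1"] by simp
    then show ?thesis
      unfolding 3 DERIV_def by (simp add: flat_exp_def)
  qed
qed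

lemma smooth_on_flat_exp: "smooth_on UNIV (flat_exp n)"
  unfolding smooth_on_def
proof
  fix k show "Ck_on k UNIV (flat_exp n)"
  proof (induction k arbitrary: n)
    case 0
    then show ?case
      using DERIV_isCont[OF DERIV_flat_exp] by (simp add: continuous_on_eq_continuous_at)
  next
    case (Suc k)
    show ?case
    proof (rule Ck_on_SucI[where F = "\<lambda>x v. (flat_exp (n + 2) x + (- real n) * flat_exp (n + 1) x) * v"])
      show "(flat_exp n has_derivative (*) (flat_exp (n + 2) x + - real n * flat_exp (n + 1) x)) (at x)" for x
        using DERIV_flat_exp[of n x] by (simp add: has_field_derivative_def)
      show "Ck_on k UNIV (\<lambda>x. (flat_exp (n + 2) x + - real n * flat_exp (n + 1) x) * v)" for v
        by (intro Ck_on_mult[OF open_UNIV Ck_on_add[OF open_UNIV Suc.IH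
                Ck_on_mult[OF open_UNIV Ck_on_const Suc.IH]] Ck_on_const]) auto
    qed simp
  qed
qed

lemma smooth_on_norm_sq: "smooth_on UNIV (\<lambda>x::'a::euclidean_space. (x - a) \<bullet> (x - a))"
proof -
  have "smooth_on UNIV (\<lambda>x. x \<bullet> b + - (a \<bullet> b))" for b :: 'a
    by (intro smooth_on_add smooth_on_const smooth_on_bounded_linear[OF open_UNIV bounded_linear_inner_left]
        smooth_on_ident open_UNIV)
  then have "smooth_on UNIV (\<lambda>x. \<Sum>b\<in>Basis. (x \<bullet> b + - (a \<bullet> b)) * (x \<bullet> b + - (a \<bullet> b)))"
    by (intro smooth_on_sum smooth_on_mult open_UNIV)
  moreover have "(x - a) \<bullet> (x - a) = (\<Sum>b\<in>Basis. (x \<bullet> b + - (a \<bullet> b)) * (x \<bullet> b + - (a \<bullet> b)))" for x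
    unfolding euclidean_inner[of "x - a" "x - a"] by (simp add: inner_diff_left)
  ultimately show ?thesis by simp
qed

lemma smooth_bump:
  fixes a :: "'a::euclidean_space"
  assumes "open S" "a \<in> S"
  obtains \<psi> :: "'a \<Rightarrow> real" and K W where
    "smooth_on UNIV \<psi>" "compact K" "K \<subseteq> S" "open W" "a \<in> W" "W \<subseteq> K"
    "\<And>x. x \<notin> K \<Longrightarrow> \<psi> x = 0" "\<And>x. x \<in> W \<Longrightarrow> \<psi> x = 1"
proof -
  obtain r where r: "r > 0" "cball a r \<subseteq> S"
    using assms open_contains_cball by blast
  \<comment> \<open>\<open>u\<close> is positive exactly inside the ball of radius \<open>r\<close>,
    \<open>w\<close> exactly where the distance exceeds \<open>r/2\<close>. Hence
    \<open>u + w\<close> never vanishes, and the quotient of \<open>u\<close> by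
    \<open>u + w\<close> is 0 where \<open>u\<close> is 0 and 1 where \<open>w\<close> is 0.\<close>
  define u where "u x = flat_exp 0 (r\<^sup>2 + (-1) * ((x - a) \<bullet> (x - a)))" for x
  define w where "w x = flat_exp 0 ((x - a) \<bullet> (x - a) + - (r/2)\<^sup>2)" for x
  have n: "(x - a) \<bullet> (x - a) = (dist a x)\<^sup>2" for x
    by (metis power2_norm_eq_inner dist_norm norm_minus_commute)
  have su: "smooth_on UNIV u" unfolding u_def
    by (intro smooth_on_compose[OF _ _ _ _ smooth_on_flat_exp] smooth_on_add smooth_on_mult
        smooth_on_const smooth_on_norm_sq open_UNIV) auto
  have sw: "smooth_on UNIV w" unfolding w_def
    by (intro smooth_on_compose[OF _ _ _ _ smooth_on_flat_exp] smooth_on_add smooth_on_mult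
        smooth_on_const smooth_on_norm_sq open_UNIV) auto
  have u0: "u x \<ge> 0" and w0: "w x \<ge> 0" for x by (auto simp: u_def w_def flat_exp_def)
  have up: "u x > 0 \<longleftrightarrow> dist a x < r" for x
    using r power2_less_imp_less[of "dist a x" r] by (auto simp: u_def n flat_exp_def intro: power_strict_mono)
  have wp: "w x > 0 \<longleftrightarrow> dist a x > r/2" for x
  proof -
    have "(r/2)\<^sup>2 < (dist a x)\<^sup>2 \<longleftrightarrow> r/2 < dist a x"
      using r power2_less_imp_less[of "r/2" "dist a x"] power_strict_mono[of "r/2" "dist a x" 2] by auto
    then show ?thesis by (simp add: w_def n flat_exp_def)
  qed
  have ne: "u x + w x \<noteq> 0" for x
    using up[of x] wp[of x] u0[of x] w0[of x] r by (cases "dist a x < r") linarith+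
  show thesis
  proof
    show "smooth_on UNIV (\<lambda>x. u x * inverse (u x + w x))"
      using su sw ne by (intro smooth_on_mult smooth_on_inverse smooth_on_add open_UNIV) auto
    show "compact (cball a r)" "cball a r \<subseteq> S" using r by auto
    show "open (ball a (r/2))" "a \<in> ball a (r/2)" "ball a (r/2) \<subseteq> cball a r" using r by auto
    show "u x * inverse (u x + w x) = 0" if "x \<notin> cball a r" for x
      using that up[of x] u0[of x] by auto
    show "u x * inverse (u x + w x) = 1" if "x \<in> ball a (r/2)" for x
      using that wp[of x] w0[of x] ne[of x] by auto
  qed
qed

section \<open>Differentiation under the integral, Hadamard's lemma, symmetry of second
  derivatives\<close>

lemma has_derivative_ray_integral:
  fixes \<Phi> :: "'a::euclidean_space \<Rightarrow> real"
  assumes S: "open S" "convex S" "a \<in> S" and \<Phi>: "smooth_on S \<Phi>" and x: "x \<in> S"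
  shows "((\<lambda>x. integral {0..1} (\<lambda>t. t ^ m * \<Phi> (a + t *\<^sub>R (x - a)))) has_derivative
    (\<lambda>v. integral {0..1} (\<lambda>t. t ^ Suc m * frechet_derivative \<Phi> (at (a + t *\<^sub>R (x - a))) v))) (at x)"
proof -
  let ?D = "\<lambda>y. frechet_derivative \<Phi> (at y)"
  \<comment> \<open>\<open>leibniz_rule\<close> wants the derivative as a bounded linear function
    depending continuously on both variables. The inner map \<open>a + t *\<^sub>R (x - a)\<close>
    contributes one more factor \<open>t\<close>.\<close>
  define fx where "fx x t = t ^ Suc m *\<^sub>R Blinfun (?D (a + t *\<^sub>R (x - a)))" for x t
  note D = smooth_on_D[OF S(1) \<Phi>]
  have in_S: "a + t *\<^sub>R (y - a) \<in> S" if "y \<in> S" "t \<in> {0..1}" for y t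
    using convexD_alt[OF S(2,3) that(1), of t] that(2) by (simp add: algebra_simps)
  have bl: "bounded_linear (?D y)" if "y \<in> S" for y
    using D(1)[OF that] has_derivative_bounded_linear by blast
  have fx: "blinfun_apply (fx y t) v = t ^ Suc m * ?D (a + t *\<^sub>R (y - a)) v"
    if "y \<in> S" "t \<in> {0..1}" for y t v
    using bounded_linear_Blinfun_apply[OF bl[OF in_S[OF that]]] by (simp add: fx_def blinfun.scaleR_left)
  have cont_seg: "continuous_on (S \<times> {0..1}) (\<lambda>z. f (a + snd z *\<^sub>R (fst z - a)))"
    if "continuous_on S f" for f :: "'a \<Rightarrow> real"
    by (rule continuous_on_compose2[OF that]) (auto intro!: continuous_intros in_S)
  have cont_t: "continuous_on {0..1} (\<lambda>t. f (a + t *\<^sub>R (y - a)))"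
    if "continuous_on S f" "y \<in> S" for f :: "'a \<Rightarrow> real" and y
    by (rule continuous_on_compose2[OF that(1)]) (auto intro!: continuous_intros in_S that)
  have cfx: "continuous_on (S \<times> {0..1}) (\<lambda>(y, t). fx y t)"
  proof (rule continuous_on_blinfun_componentwise)
    fix i :: 'a assume "i \<in> Basis"
    have "continuous_on (S \<times> {0..1}) (\<lambda>z. snd z ^ Suc m * ?D (a + snd z *\<^sub>R (fst z - a)) i)"
      by (intro continuous_intros cont_seg smooth_on_D(3)[OF S(1) D(2)])
    then show "continuous_on (S \<times> {0..1}) (\<lambda>z. blinfun_apply (case z of (y, t) \<Rightarrow> fx y t) i)"
      by (rule continuous_on_eq) (auto simp: fx)
  qed
  have "((\<lambda>x. integral (cbox 0 1) (\<lambda>t. t ^ m * \<Phi> (a + t *\<^sub>R (x - a)))) has_derivative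
      blinfun_apply (integral (cbox 0 1) (fx x))) (at x within S)"
  proof (rule leibniz_rule)
    fix y and t :: real assume y: "y \<in> S" and t: "t \<in> cbox 0 1"
    then have yt: "a + t *\<^sub>R (y - a) \<in> S" using in_S by auto
    have "((\<lambda>y. t ^ m * \<Phi> (a + t *\<^sub>R (y - a))) has_derivative
        (\<lambda>v. t ^ m * ?D (a + t *\<^sub>R (y - a)) (t *\<^sub>R v))) (at y)"
      by (rule has_derivative_mult_right,
          rule has_derivative_compose[of "\<lambda>y. a + t *\<^sub>R (y - a)", OF _ D(1)[OF yt]])
        (use has_derivative_add[OF has_derivative_const has_derivative_scaleR_right[OF
              has_derivative_diff[OF has_derivative_ident has_derivative_const]], of a t a "at y"] in simp)
    moreover have "(\<lambda>v. t ^ m * ?D (a + t *\<^sub>R (y - a)) (t *\<^sub>R v)) = blinfun_apply (fx y t)"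
      using y t linear_scale[OF bounded_linear.linear[OF bl[OF yt]]] by (intro ext) (simp add: fx)
    ultimately show "((\<lambda>y. t ^ m * \<Phi> (a + t *\<^sub>R (y - a))) has_derivative blinfun_apply (fx y t)) (at y within S)"
      by (simp add: has_derivative_at_withinI)
  next
    fix y assume "y \<in> S"
    then show "(\<lambda>t. t ^ m * \<Phi> (a + t *\<^sub>R (y - a))) integrable_on cbox 0 1"
      using D(3) by (intro integrable_continuous) (auto intro!: continuous_intros cont_t)
  qed (use S x cfx in auto)
  moreover have "blinfun_apply (integral (cbox 0 1) (fx x)) = (\<lambda>v. integral {0..1} (\<lambda>t. t ^ Suc m * ?D (a + t *\<^sub>R (x - a)) v))"
  proof
    fix v
    show "blinfun_apply (integral (cbox 0 1) (fx x)) v =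
      integral {0..1} (\<lambda>t. t ^ Suc m * ?D (a + t *\<^sub>R (x - a)) v)"
  proof -
    have "fx x integrable_on cbox 0 1"
      using continuous_on_compose2[OF cfx, of "cbox 0 1" "\<lambda>t. (x, t)"] x continuous_on_Pair[of "{0..1}" "\<lambda>_. x" "\<lambda>t. t"]
      by (intro integrable_continuous) auto
    then have "integral (cbox 0 1) ((\<lambda>B. blinfun_apply B v) \<circ> fx x) = blinfun_apply (integral (cbox 0 1) (fx x)) v"
      by (intro integral_linear bounded_linear_intros) auto
    then have "blinfun_apply (integral (cbox 0 1) (fx x)) v = integral {0..1} (\<lambda>t. blinfun_apply (fx x t) v)"
      by (simp add: o_def)
    also have "\<dots> = integral {0..1} (\<lambda>t. t ^ Suc m * ?D (a + t *\<^sub>R (x - a)) v)"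
      by (intro integral_cong) (use fx[OF x] in auto)
    finally show ?thesis .
  qed
  qed
  ultimately show ?thesis
    using at_within_open[OF x S(1)] by (simp only: cbox_interval)
qed

text \<open>Differentiation turns the weight \<open>t ^ m\<close> into \<open>t ^ Suc m\<close> and
  \<Phi> into a directional derivative of \<Phi>. Carrying an arbitrary weight closes the family of
  integrals under differentiation.\<close>

lemma smooth_on_ray_integral:
  fixes \<Phi> :: "'a::euclidean_space \<Rightarrow> real"
  assumes S: "open S" "convex S" "a \<in> S" and "smooth_on S \<Phi>"
  shows "smooth_on S (\<lambda>x. integral {0..1} (\<lambda>t. t ^ m * \<Phi> (a + t *\<^sub>R (x - a))))"
  unfolding smooth_on_def
proof
  fix k
  show "Ck_on k S (\<lambda>x. integral {0..1} (\<lambda>t. t ^ m * \<Phi> (a + t *\<^sub>R (x - a))))"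
    using assms(4)
  proof (induction k arbitrary: m \<Phi>)
    case 0
    show ?case
      using has_derivative_continuous[OF has_derivative_ray_integral[OF S 0, of _ m]]
      by (simp add: continuous_on_eq_continuous_at[OF S(1)])
  next
    case (Suc k)
    show ?case
    proof (rule Ck_on_SucI[OF S(1) has_derivative_ray_integral[OF S Suc.prems]])
      show "Ck_on k S (\<lambda>x. integral {0..1}
          (\<lambda>t. t ^ Suc m * frechet_derivative \<Phi> (at (a + t *\<^sub>R (x - a))) v))" for v
        using Suc.IH[OF smooth_on_D(2)[OF S(1) Suc.prems, of v], of "Suc m"] .
    qed
  qed
qed

text \<open>The fundamental theorem of calculus along the segments from \<open>a\<close>;
  \<open>g b\<close> is the mean of a partial derivative over the segment. The smoothness of
  \<open>g b\<close> is what turns derivations into directional derivatives in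
  \<open>tangent_in_chart\<close>.\<close>

lemma Hadamard:
  fixes F :: "'a::euclidean_space \<Rightarrow> real"
  assumes S: "open S" "convex S" "a \<in> S" and F: "smooth_on S F"
  obtains g where "\<And>b. smooth_on S (g b)"
    "\<And>x. x \<in> S \<Longrightarrow> F x = F a + (\<Sum>b\<in>Basis. ((x - a) \<bullet> b) * g b x)"
    "\<And>b. g b a = frechet_derivative F (at a) b"
proof
  let ?g = "\<lambda>b x. integral {0..1} (\<lambda>t. t ^ 0 * frechet_derivative F (at (a + t *\<^sub>R (x - a))) b)"
  note D = smooth_on_D[OF S(1) F]
  show "smooth_on S (?g b)" for b
    by (rule smooth_on_ray_integral[OF S D(2)])
  show "?g b a = frechet_derivative F (at a) b" for b by simp
  fix x assume x: "x \<in> S"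
  have in_S: "a + t *\<^sub>R (x - a) \<in> S" if "t \<in> {0..1}" for t
    using convexD_alt[OF S(2,3) x, of t] that by (simp add: algebra_simps)
  have int: "(\<lambda>t. frechet_derivative F (at (a + t *\<^sub>R (x - a))) b) integrable_on {0..1}" for b
  proof -
    have "continuous_on {0..1} (\<lambda>t. frechet_derivative F (at (a + t *\<^sub>R (x - a))) b)"
      by (rule continuous_on_compose2[OF smooth_on_D(3)[OF S(1) D(2)]])
        (auto intro!: continuous_intros in_S)
    then show ?thesis by (rule integrable_continuous_real)
  qed
  have "((\<lambda>t. F (a + t *\<^sub>R (x - a))) has_vector_derivative
      frechet_derivative F (at (a + t *\<^sub>R (x - a))) (x - a)) (at t within {0..1})" if "t \<in> {0..1}" for t
  proof -
    have "((\<lambda>t. F (a + t *\<^sub>R (x - a))) has_derivative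
        (\<lambda>s. frechet_derivative F (at (a + t *\<^sub>R (x - a))) (s *\<^sub>R (x - a)))) (at t)"
      by (rule has_derivative_compose[of "\<lambda>t. a + t *\<^sub>R (x - a)", OF _ D(1)[OF in_S[OF that]]])
        (use has_derivative_add[OF has_derivative_const has_derivative_scaleR_left[OF
              has_derivative_ident], of a "x - a" "at t"] in simp)
    then show ?thesis
      using linear_scale[OF has_derivative_linear[OF D(1)[OF in_S[OF that]]]]
      by (simp add: has_vector_derivative_def has_derivative_at_withinI)
  qed
  then have "((\<lambda>t. frechet_derivative F (at (a + t *\<^sub>R (x - a))) (x - a)) has_integral
      F (a + 1 *\<^sub>R (x - a)) - F (a + 0 *\<^sub>R (x - a))) {0..1}"
    by (intro fundamental_theorem_of_calculus) auto
  then have "F x - F a = integral {0..1} (\<lambda>t. frechet_derivative F (at (a + t *\<^sub>R (x - a))) (x - a))"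
    by (auto dest!: integral_unique)
  also have "\<dots> = integral {0..1} (\<lambda>t. \<Sum>b\<in>Basis. ((x - a) \<bullet> b) *\<^sub>R frechet_derivative F (at (a + t *\<^sub>R (x - a))) b)"
    by (intro integral_cong linear_euclidean_expand has_derivative_linear[OF D(1)] in_S)
  also have "\<dots> = (\<Sum>b\<in>Basis. ((x - a) \<bullet> b) * integral {0..1} (\<lambda>t. frechet_derivative F (at (a + t *\<^sub>R (x - a))) b))"
    using int by (subst integral_sum) (auto intro!: integrable_on_mult_right)
  finally show "F x = F a + (\<Sum>b\<in>Basis. ((x - a) \<bullet> b) * ?g b x)" by simp
qed

text \<open>Differentiating Hadamard's expansion twice at \<open>a\<close> leaves only first
  derivatives of the coefficients \<open>g b\<close>, in an expression that is visibly symmetric in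
  \<open>u\<close> and \<open>v\<close>.\<close>

lemma second_derivative_symmetric:
  fixes F :: "'a::euclidean_space \<Rightarrow> real"
  assumes S: "open S" "a \<in> S" and F: "smooth_on S F"
  shows "frechet_derivative (\<lambda>x. frechet_derivative F (at x) u) (at a) v =
    frechet_derivative (\<lambda>x. frechet_derivative F (at x) v) (at a) u"
proof -
  obtain r where r: "r > 0" "ball a r \<subseteq> S" using S open_contains_ball by blast
  let ?B = "ball a r"
  have B: "open ?B" "convex ?B" "a \<in> ?B" "smooth_on ?B F"
    using r smooth_on_subset[OF S(1) _ r(2) F] by auto
  obtain g where g: "\<And>b. smooth_on ?B (g b)"
      "\<And>x. x \<in> ?B \<Longrightarrow> F x = F a + (\<Sum>b\<in>Basis. ((x - a) \<bullet> b) * g b x)"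
    using Hadamard[OF B] by metis
  let ?Dg = "\<lambda>b x. frechet_derivative (g b) (at x)"
  note Dg = smooth_on_D[OF B(1) g(1)]
  have D1: "frechet_derivative F (at x) u =
      (\<Sum>b\<in>Basis. ((x - a) \<bullet> b) * ?Dg b x u + (u \<bullet> b) * g b x)" if x: "x \<in> ?B" for x u
  proof -
    have "((\<lambda>x. F a + (\<Sum>b\<in>Basis. ((x - a) \<bullet> b) * g b x)) has_derivative
       (\<lambda>u. \<Sum>b\<in>Basis. ((x - a) \<bullet> b) * ?Dg b x u + (u \<bullet> b) * g b x)) (at x)"
      by (rule has_derivative_eq_rhs, (rule has_derivative_add has_derivative_const has_derivative_sum
          has_derivative_mult has_derivative_inner_left has_derivative_diff has_derivative_ident Dg(1)[OF x])+)
        simp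
    then have hd: "(F has_derivative (\<lambda>u. \<Sum>b\<in>Basis. ((x - a) \<bullet> b) * ?Dg b x u + (u \<bullet> b) * g b x)) (at x)"
      by (rule has_derivative_transform_within_open[OF _ B(1) x]) (use g(2) in auto)
    show ?thesis using fun_cong[OF frechet_derivative_at[OF hd], of u] by simp
  qed
  have "frechet_derivative (\<lambda>x. frechet_derivative F (at x) u) (at a) v =
      (\<Sum>b\<in>Basis. (v \<bullet> b) * ?Dg b a u + (u \<bullet> b) * ?Dg b a v)" for u v
  proof -
    have "((\<lambda>x. \<Sum>b\<in>Basis. ((x - a) \<bullet> b) * ?Dg b x u + (u \<bullet> b) * g b x) has_derivative
        (\<lambda>v. \<Sum>b\<in>Basis. (v \<bullet> b) * ?Dg b a u + (u \<bullet> b) * ?Dg b a v)) (at a)"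
      by (rule has_derivative_eq_rhs, (rule has_derivative_add has_derivative_const has_derivative_sum
          has_derivative_mult has_derivative_inner_left has_derivative_diff has_derivative_ident
          Dg(1)[OF B(3)] smooth_on_D(1)[OF B(1) Dg(2) B(3)])+) simp
    then have hd: "((\<lambda>x. frechet_derivative F (at x) u) has_derivative
        (\<lambda>v. \<Sum>b\<in>Basis. (v \<bullet> b) * ?Dg b a u + (u \<bullet> b) * ?Dg b a v)) (at a)"
      by (rule has_derivative_transform_within_open[OF _ B(1) B(3)]) (simp add: D1)
    show ?thesis using fun_cong[OF frechet_derivative_at[OF hd], of v] by simp
  qed
  then show ?thesis by (simp add: add.commute)
qed

section \<open>Manifolds of positive dimension\<close>

text \<open>Only the topological half of a manifold with open chart images. Compatibility of charts
  is kept apart, so that product atlases qualify by a purely topological argument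
  (\<open>charted_prod\<close>).\<close>

definition charted :: "('m::topological_space, 'e::euclidean_space) atlas \<Rightarrow> bool" where
  "charted A \<longleftrightarrow> (\<Union>(U, c)\<in>A. U) = UNIV \<and>
     (\<forall>(U, c)\<in>A. open U \<and> open (c ` U) \<and> homeomorphism U (c ` U) c (inv_into U c))"

definition open_manifold ::
    "('m::{t2_space,second_countable_topology}, 'e::euclidean_space) atlas \<Rightarrow> bool" where
  "open_manifold A \<longleftrightarrow> smooth_manifold A \<and> (\<forall>(U, c)\<in>A. open (c ` U))"

lemma open_manifold_charted: "open_manifold A \<Longrightarrow> charted A"
  unfolding open_manifold_def smooth_manifold_def charted_def by blast

lemma charted_at:
  assumes "charted A"
  obtains U c where "(U, c) \<in> A" "p \<in> U"
  using assms unfolding charted_def by blast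

context
  fixes A :: "('m::topological_space, 'e::euclidean_space) atlas" and U c
  assumes A: "charted A" and Uc: "(U, c) \<in> A"
begin

lemma chart_open: "open U" "open (c ` U)"
  and chart_homeo: "homeomorphism U (c ` U) c (inv_into U c)"
  using A Uc unfolding charted_def by auto

lemma chart_inv: "p \<in> U \<Longrightarrow> inv_into U c (c p) = p"
  and chart_inv': "x \<in> c ` U \<Longrightarrow> c (inv_into U c x) = x"
  and chart_inv_in: "x \<in> c ` U \<Longrightarrow> inv_into U c x \<in> U"
  using chart_homeo by (auto simp: homeomorphism_def)

lemma chart_cont: "continuous_on U c"
  and chart_inv_cont: "continuous_on (c ` U) (inv_into U c)"
  using chart_homeo by (auto simp: homeomorphism_def)

lemma chart_image_open: "open W \<Longrightarrow> open (c ` (U \<inter> W))"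
  using homeomorphism_imp_open_map[OF chart_homeo, of "U \<inter> W"] chart_open
  by (auto simp: openin_open_eq)

lemma chart_vimage_open: "open X \<Longrightarrow> open (U \<inter> c -` X)"
  using continuous_open_preimage[OF chart_cont chart_open(1)] .

end

lemma smooth_functions_iff:
  "f \<in> smooth_functions A \<longleftrightarrow> (\<forall>(U, c)\<in>A. smooth_on (c ` U) (\<lambda>x. f (inv_into U c x)))"
  unfolding smooth_functions_def by (auto simp: o_def)

lemma smooth_functions_chart:
  "f \<in> smooth_functions A \<Longrightarrow> (U, c) \<in> A \<Longrightarrow> smooth_on (c ` U) (\<lambda>x. f (inv_into U c x))"
  unfolding smooth_functions_iff by auto

lemma smooth_functionsI:
  assumes A: "charted A"
    and loc: "\<And>U c p. (U, c) \<in> A \<Longrightarrow> p \<in> U \<Longrightarrow>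
      \<exists>W. open W \<and> p \<in> W \<and> smooth_on (c ` (U \<inter> W)) (\<lambda>x. f (inv_into U c x))"
  shows "f \<in> smooth_functions A"
  unfolding smooth_functions_iff
proof clarify
  fix U c assume Uc: "(U, c) \<in> A"
  show "smooth_on (c ` U) (\<lambda>x. f (inv_into U c x))"
  proof (rule smooth_on_local[OF chart_open(2)[OF A Uc]])
    fix x assume "x \<in> c ` U"
    then obtain p where p: "p \<in> U" "x = c p" by auto
    obtain W where W: "open W" "p \<in> W" "smooth_on (c ` (U \<inter> W)) (\<lambda>x. f (inv_into U c x))"
      using loc[OF Uc p(1)] by blast
    show "\<exists>T. open T \<and> x \<in> T \<and> smooth_on T (\<lambda>x. f (inv_into U c x))"
      using W p chart_image_open[OF A Uc W(1)] by blast
  qed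
qed

context
  fixes A :: "('m::topological_space, 'e::euclidean_space) atlas"
  assumes A: "charted A"
begin

lemma smooth_functions_const: "(\<lambda>_. a) \<in> smooth_functions A"
  unfolding smooth_functions_iff using smooth_on_const[OF chart_open(2)[OF A]] by auto

lemma smooth_functions_add:
  "f \<in> smooth_functions A \<Longrightarrow> h \<in> smooth_functions A \<Longrightarrow> (\<lambda>p. f p + h p) \<in> smooth_functions A"
  unfolding smooth_functions_iff using smooth_on_add[OF chart_open(2)[OF A]] by fast

lemma smooth_functions_mult:
  "f \<in> smooth_functions A \<Longrightarrow> h \<in> smooth_functions A \<Longrightarrow> (\<lambda>p. f p * h p) \<in> smooth_functions A"
  unfolding smooth_functions_iff using smooth_on_mult[OF chart_open(2)[OF A]] by fast

lemma smooth_functions_diff: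
  "f \<in> smooth_functions A \<Longrightarrow> h \<in> smooth_functions A \<Longrightarrow> (\<lambda>p. f p - h p) \<in> smooth_functions A"
  using smooth_functions_add[of f "\<lambda>p. (-1) * h p"] smooth_functions_mult[of "\<lambda>_. -1" h]
    smooth_functions_const by simp

lemma smooth_functions_sum:
  "(\<And>i. i \<in> I \<Longrightarrow> f i \<in> smooth_functions A) \<Longrightarrow> (\<lambda>p. \<Sum>i\<in>I. f i p) \<in> smooth_functions A"
  by (induction I rule: infinite_finite_induct) (auto intro: smooth_functions_add smooth_functions_const)

end

section \<open>Smooth maps and product manifolds\<close>

lemma smooth_map_cont: "smooth_map A B \<phi> \<Longrightarrow> open W \<Longrightarrow> open (\<phi> -` W)"
  unfolding smooth_map_def by (auto intro: open_vimage)

lemma smooth_map_chart: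
  "smooth_map A B \<phi> \<Longrightarrow> (U, c) \<in> A \<Longrightarrow> (V, d) \<in> B \<Longrightarrow>
    smooth_on (c ` (U \<inter> \<phi> -` V)) (\<lambda>x. d (\<phi> (inv_into U c x)))"
  unfolding smooth_map_def by (auto simp: o_def)

text \<open>Inserting the chart \<open>d\<close> and its inverse between \<open>h\<close> and \<phi>
  reduces this to a composition of smooth maps of Euclidean spaces. The set \<open>W\<close> admits
  an \<open>h\<close> that is smooth on part of \<open>V\<close> only, such as a second map read in
  a chart of its codomain.\<close>

lemma smooth_on_chart_compose:
  assumes A: "charted A" and B: "charted B" and \<phi>: "smooth_map A B \<phi>"
    and Uc: "(U, c) \<in> A" and Vd: "(V, d) \<in> B" and W: "open W"
    and h: "smooth_on (d ` (V \<inter> W)) (\<lambda>y. h (inv_into V d y))"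
  shows "smooth_on (c ` (U \<inter> \<phi> -` (V \<inter> W))) (\<lambda>x. h (\<phi> (inv_into U c x)))"
proof -
  let ?T = "c ` (U \<inter> \<phi> -` (V \<inter> W))"
  have oV: "open (V \<inter> W)" using chart_open(1)[OF B Vd] W by blast
  have T: "open ?T" using chart_image_open[OF A Uc smooth_map_cont[OF \<phi> oV]] .
  have "smooth_on ?T (\<lambda>x. h (inv_into V d (d (\<phi> (inv_into U c x)))))"
  proof (rule smooth_on_compose[OF T chart_image_open[OF B Vd W] _ _ h])
    show "smooth_on ?T (\<lambda>x. d (\<phi> (inv_into U c x)))"
      by (rule smooth_on_subset[OF chart_image_open[OF A Uc smooth_map_cont[OF \<phi> chart_open(1)[OF B Vd]]]
            T _ smooth_map_chart[OF \<phi> Uc Vd]]) auto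
    show "(\<lambda>x. d (\<phi> (inv_into U c x))) ` ?T \<subseteq> d ` (V \<inter> W)"
      using chart_inv[OF A Uc] by auto
  qed
  moreover have "inv_into V d (d (\<phi> (inv_into U c x))) = \<phi> (inv_into U c x)" if "x \<in> ?T" for x
    using that chart_inv[OF A Uc] chart_inv[OF B Vd] by auto
  ultimately show ?thesis
    using smooth_on_cong[of ?T "\<lambda>x. h (inv_into V d (d (\<phi> (inv_into U c x))))" "\<lambda>x. h (\<phi> (inv_into U c x))"]
    by simp
qed

lemma smooth_functions_compose:
  assumes A: "charted A" and B: "charted B" and \<phi>: "smooth_map A B \<phi>" and f: "f \<in> smooth_functions B"
  shows "(\<lambda>p. f (\<phi> p)) \<in> smooth_functions A"
proof (rule smooth_functionsI[OF A])
  fix U c p assume Uc: "(U, c) \<in> A" and p: "p \<in> U"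
  obtain V d where Vd: "(V, d) \<in> B" "\<phi> p \<in> V" using charted_at[OF B] by blast
  have "smooth_on (c ` (U \<inter> \<phi> -` (V \<inter> UNIV))) (\<lambda>x. f (\<phi> (inv_into U c x)))"
    using smooth_functions_chart[OF f Vd(1)]
    by (intro smooth_on_chart_compose[OF A B \<phi> Uc Vd(1)]) auto
  then show "\<exists>W. open W \<and> p \<in> W \<and> smooth_on (c ` (U \<inter> W)) (\<lambda>x. f (\<phi> (inv_into U c x)))"
    using smooth_map_cont[OF \<phi> chart_open(1)[OF B Vd(1)]] Vd(2)
    by (intro exI[of _ "\<phi> -` V"]) auto
qed

lemma smooth_mapI:
  assumes A: "charted A" and B: "charted B" and cont: "continuous_on UNIV \<phi>"
    and loc: "\<And>U c V d p. (U, c) \<in> A \<Longrightarrow> (V, d) \<in> B \<Longrightarrow> p \<in> U \<Longrightarrow> \<phi> p \<in> V \<Longrightarrow>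
      \<exists>W. open W \<and> p \<in> W \<and> smooth_on (c ` (U \<inter> W)) (\<lambda>x. d (\<phi> (inv_into U c x)))"
  shows "smooth_map A B \<phi>"
  unfolding smooth_map_def o_def
proof (intro conjI cont ballI, clarify)
  fix U c V d assume Uc: "(U, c) \<in> A" and Vd: "(V, d) \<in> B"
  have "open (\<phi> -` V)" using cont chart_open(1)[OF B Vd] by (auto intro: open_vimage)
  then have oT: "open (c ` (U \<inter> \<phi> -` V))" by (rule chart_image_open[OF A Uc])
  show "smooth_on (c ` (U \<inter> \<phi> -` V)) (\<lambda>x. d (\<phi> (inv_into U c x)))"
  proof (rule smooth_on_local[OF oT])
    fix x assume "x \<in> c ` (U \<inter> \<phi> -` V)"
    then obtain p where p: "p \<in> U" "\<phi> p \<in> V" "x = c p" by auto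
    obtain W where W: "open W" "p \<in> W" "smooth_on (c ` (U \<inter> W)) (\<lambda>x. d (\<phi> (inv_into U c x)))"
      using loc[OF Uc Vd p(1,2)] by blast
    show "\<exists>T. open T \<and> x \<in> T \<and> smooth_on T (\<lambda>x. d (\<phi> (inv_into U c x)))"
      using W p chart_image_open[OF A Uc W(1)] by blast
  qed
qed

lemma smooth_map_compose:
  assumes A: "charted A" and B: "charted B" and C: "charted C"
    and \<phi>: "smooth_map A B \<phi>" and \<psi>: "smooth_map B C \<psi>"
  shows "smooth_map A C (\<lambda>p. \<psi> (\<phi> p))"
proof (rule smooth_mapI[OF A C])
  show "continuous_on UNIV (\<lambda>p. \<psi> (\<phi> p))"
    using \<phi> \<psi> continuous_on_compose2[of UNIV \<psi> UNIV \<phi>] by (auto simp: smooth_map_def)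
  fix U c V d p assume Uc: "(U, c) \<in> A" and Vd: "(V, d) \<in> C" and p: "p \<in> U" "\<psi> (\<phi> p) \<in> V"
  obtain V' d' where Vd': "(V', d') \<in> B" "\<phi> p \<in> V'" using charted_at[OF B] by blast
  have o: "open (\<psi> -` V)" using smooth_map_cont[OF \<psi> chart_open(1)[OF C Vd]] .
  have "smooth_on (c ` (U \<inter> \<phi> -` (V' \<inter> \<psi> -` V))) (\<lambda>x. d (\<psi> (\<phi> (inv_into U c x))))"
    by (rule smooth_on_chart_compose[OF A B \<phi> Uc Vd'(1) o smooth_map_chart[OF \<psi> Vd'(1) Vd]])
  then show "\<exists>W. open W \<and> p \<in> W \<and> smooth_on (c ` (U \<inter> W)) (\<lambda>x. d (\<psi> (\<phi> (inv_into U c x))))"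
    using smooth_map_cont[OF \<phi> open_Int[OF chart_open(1)[OF B Vd'(1)] o]] Vd'(2) p
    by (intro exI[of _ "\<phi> -` (V' \<inter> \<psi> -` V)"]) auto
qed

lemma smooth_map_const:
  assumes A: "charted A" and B: "charted B"
  shows "smooth_map A B (\<lambda>_. q)"
proof (rule smooth_mapI[OF A B])
  fix U c V d p assume "(U, c) \<in> A" "p \<in> U"
  then show "\<exists>W. open W \<and> p \<in> W \<and> smooth_on (c ` (U \<inter> W)) (\<lambda>x. d q)"
    using smooth_on_const[OF chart_open(2)[OF A]] by (intro exI[of _ UNIV]) simp
qed simp

text \<open>Smoothness of the identity is the compatibility of the charts; the later arguments use
  compatibility in this form.\<close>

lemma smooth_map_id:
  assumes A: "open_manifold A"
  shows "smooth_map A A (\<lambda>p. p)"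
  using A unfolding open_manifold_def smooth_manifold_def smooth_map_def by (fastforce simp: o_def)

text \<open>\<open>inv_into\<close> is a choice operator, so it takes injectivity of the product
  chart to split its inverse into components.\<close>

lemma prod_chart_inv:
  assumes "charted A" "charted B" "(U, c) \<in> A" "(V, d) \<in> B" "x \<in> c ` U" "y \<in> d ` V"
  shows "inv_into (U \<times> V) (map_prod c d) (x, y) = (inv_into U c x, inv_into V d y)"
proof -
  have "inj_on (map_prod c d) (U \<times> V)"
    using chart_inv[OF assms(1,3)] chart_inv[OF assms(2,4)] by (auto simp: inj_on_def) metis+
  then have "inv_into (U \<times> V) (map_prod c d) (map_prod c d (inv_into U c x, inv_into V d y)) =
      (inv_into U c x, inv_into V d y)"
    using chart_inv_in[OF assms(1,3,5)] chart_inv_in[OF assms(2,4,6)] by (intro inv_into_f_f) auto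
  then show ?thesis
    using chart_inv'[OF assms(1,3,5)] chart_inv'[OF assms(2,4,6)] by simp
qed

lemma charted_prod:
  assumes A: "charted A" and B: "charted B"
  shows "charted (prod_atlas A B)"
  unfolding charted_def
proof (intro conjI ballI)
  show "(\<Union>(U, c)\<in>prod_atlas A B. U) = UNIV"
  proof -
    have "\<exists>X\<in>prod_atlas A B. z \<in> fst X" for z
    proof -
      obtain U c V d where "(U, c) \<in> A" "fst z \<in> U" "(V, d) \<in> B" "snd z \<in> V"
        using charted_at[OF A] charted_at[OF B] by metis
      then show ?thesis
        by (intro bexI[of _ "(U \<times> V, map_prod c d)"]) (auto simp: prod_atlas_def mem_Times_iff)
    qed
    then show ?thesis by (fastforce simp: split_beta)
  qed
  fix X assume "X \<in> prod_atlas A B"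
  then obtain U c V d where X: "X = (U \<times> V, map_prod c d)" and Uc: "(U, c) \<in> A" and Vd: "(V, d) \<in> B"
    by (auto simp: prod_atlas_def)
  have im: "map_prod c d ` (U \<times> V) = c ` U \<times> d ` V" by auto
  have "continuous_on (c ` U \<times> d ` V) (\<lambda>z. (inv_into U c (fst z), inv_into V d (snd z)))"
    by (intro continuous_intros continuous_on_compose2[OF chart_inv_cont[OF A Uc]]
        continuous_on_compose2[OF chart_inv_cont[OF B Vd]]) auto
  moreover have "continuous_on (U \<times> V) (\<lambda>z. (c (fst z), d (snd z)))"
    by (intro continuous_intros continuous_on_compose2[OF chart_cont[OF A Uc]]
        continuous_on_compose2[OF chart_cont[OF B Vd]]) auto
  ultimately have "homeomorphism (U \<times> V) (c ` U \<times> d ` V) (map_prod c d)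
      (\<lambda>z. (inv_into U c (fst z), inv_into V d (snd z)))"
  proof (intro homeomorphismI)
    show "continuous_on (U \<times> V) (map_prod c d)"
      if "continuous_on (U \<times> V) (\<lambda>z. (c (fst z), d (snd z)))"
      using that by (simp add: map_prod_def split_beta)
  qed (auto simp: chart_inv[OF A Uc] chart_inv[OF B Vd] chart_inv'[OF A Uc] chart_inv'[OF B Vd]
      intro: chart_inv_in[OF A Uc] chart_inv_in[OF B Vd])
  then have "homeomorphism (U \<times> V) (c ` U \<times> d ` V) (map_prod c d) (inv_into (U \<times> V) (map_prod c d))"
    by (rule homeomorphism_cong) (auto simp: prod_chart_inv[OF A B Uc Vd])
  then show "case X of (U, c) \<Rightarrow> open U \<and> open (c ` U) \<and> homeomorphism U (c ` U) c (inv_into U c)"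
    using chart_open[OF A Uc] chart_open[OF B Vd] by (simp add: X im open_Times)
qed

lemma smooth_map_Pair:
  assumes A: "charted A" and B: "charted B" and C: "charted C"
    and \<phi>: "smooth_map A B \<phi>" and \<psi>: "smooth_map A C \<psi>"
  shows "smooth_map A (prod_atlas B C) (\<lambda>p. (\<phi> p, \<psi> p))"
proof (rule smooth_mapI[OF A charted_prod[OF B C]])
  show "continuous_on UNIV (\<lambda>p. (\<phi> p, \<psi> p))"
    using \<phi> \<psi> by (intro continuous_on_Pair) (simp_all add: smooth_map_def)
  fix U c X e p assume Uc: "(U, c) \<in> A" and X: "(X, e) \<in> prod_atlas B C" and p: "p \<in> U" "(\<phi> p, \<psi> p) \<in> X"
  then obtain V d V' d' where Vd: "(V, d) \<in> B" "(V', d') \<in> C" and X: "X = V \<times> V'" "e = map_prod d d'"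
    by (auto simp: prod_atlas_def)
  let ?W = "\<phi> -` V \<inter> \<psi> -` V'"
  have o: "open (\<phi> -` V)" "open (\<psi> -` V')" "open ?W"
    using smooth_map_cont[OF \<phi> chart_open(1)[OF B Vd(1)]] smooth_map_cont[OF \<psi> chart_open(1)[OF C Vd(2)]]
    by auto
  note oi = chart_image_open[OF A Uc o(1)] chart_image_open[OF A Uc o(2)] chart_image_open[OF A Uc o(3)]
  have "smooth_on (c ` (U \<inter> ?W)) (\<lambda>x. (d (\<phi> (inv_into U c x)), d' (\<psi> (inv_into U c x))))"
    by (intro smooth_on_Pair oi smooth_on_subset[OF oi(1,3) _ smooth_map_chart[OF \<phi> Uc Vd(1)]]
        smooth_on_subset[OF oi(2,3) _ smooth_map_chart[OF \<psi> Uc Vd(2)]]) auto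
  then show "\<exists>W. open W \<and> p \<in> W \<and> smooth_on (c ` (U \<inter> W)) (\<lambda>x. e (\<phi> (inv_into U c x), \<psi> (inv_into U c x)))"
    using o(3) p by (intro exI[of _ ?W]) (auto simp: X)
qed

lemma smooth_map_fst:
  assumes A: "open_manifold A" and B: "open_manifold B"
  shows "smooth_map (prod_atlas A B) A fst"
proof -
  note cA = open_manifold_charted[OF A] and cB = open_manifold_charted[OF B]
  show ?thesis
  proof (rule smooth_mapI[OF charted_prod[OF cA cB] cA])
    fix X e V d p assume "(X, e) \<in> prod_atlas A B" and Vd: "(V, d) \<in> A" and p: "p \<in> X" "fst p \<in> V"
    then obtain U c U' c' where Uc: "(U, c) \<in> A" "(U', c') \<in> B" and X: "X = U \<times> U'" "e = map_prod c c'"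
      by (auto simp: prod_atlas_def)
    have im: "e ` (X \<inter> V \<times> UNIV) = c ` (U \<inter> V) \<times> c' ` U'" unfolding X by auto
    have oV: "open V" using chart_open(1)[OF cA Vd] .
    have o: "open (c ` (U \<inter> V) \<times> c' ` U')"
      using chart_image_open[OF cA Uc(1) oV] chart_open(2)[OF cB Uc(2)] by (rule open_Times)
    have "smooth_on (c ` (U \<inter> V)) (\<lambda>x. d (inv_into U c x))"
      using smooth_map_chart[OF smooth_map_id[OF A] Uc(1) Vd] by simp
    then have "smooth_on (c ` (U \<inter> V) \<times> c' ` U') (\<lambda>z. d (inv_into U c (fst z)))"
      by (rule smooth_on_compose[OF o chart_image_open[OF cA Uc(1) oV], rotated 2])
        (auto intro: smooth_on_bounded_linear[OF o bounded_linear_fst] smooth_on_ident[OF o])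
    moreover have "fst (inv_into X e z) = inv_into U c (fst z)" if "z \<in> c ` (U \<inter> V) \<times> c' ` U'" for z
      using that prod_chart_inv[OF cA cB Uc, of "fst z" "snd z"] by (auto simp: X)
    ultimately have "smooth_on (e ` (X \<inter> V \<times> UNIV)) (\<lambda>z. d (fst (inv_into X e z)))"
      unfolding im using smooth_on_cong[of "c ` (U \<inter> V) \<times> c' ` U'" "\<lambda>z. d (fst (inv_into X e z))" "\<lambda>z. d (inv_into U c (fst z))"]
      by simp
    then show "\<exists>W. open W \<and> p \<in> W \<and> smooth_on (e ` (X \<inter> W)) (\<lambda>z. d (fst (inv_into X e z)))"
      using oV p by (intro exI[of _ "V \<times> UNIV"]) (auto simp: open_Times mem_Times_iff)
  qed (auto intro: continuous_intros)
qed

lemma smooth_map_snd: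
  assumes A: "open_manifold A" and B: "open_manifold B"
  shows "smooth_map (prod_atlas A B) B snd"
proof -
  note cA = open_manifold_charted[OF A] and cB = open_manifold_charted[OF B]
  show ?thesis
  proof (rule smooth_mapI[OF charted_prod[OF cA cB] cB])
    fix X e V d p assume "(X, e) \<in> prod_atlas A B" and Vd: "(V, d) \<in> B" and p: "p \<in> X" "snd p \<in> V"
    then obtain U c U' c' where Uc: "(U, c) \<in> A" "(U', c') \<in> B" and X: "X = U \<times> U'" "e = map_prod c c'"
      by (auto simp: prod_atlas_def)
    have im: "e ` (X \<inter> UNIV \<times> V) = c ` U \<times> c' ` (U' \<inter> V)" unfolding X by auto
    have oV: "open V" using chart_open(1)[OF cB Vd] .
    have o: "open (c ` U \<times> c' ` (U' \<inter> V))"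
      using chart_open(2)[OF cA Uc(1)] chart_image_open[OF cB Uc(2) oV] by (rule open_Times)
    have "smooth_on (c' ` (U' \<inter> V)) (\<lambda>x. d (inv_into U' c' x))"
      using smooth_map_chart[OF smooth_map_id[OF B] Uc(2) Vd] by simp
    then have "smooth_on (c ` U \<times> c' ` (U' \<inter> V)) (\<lambda>z. d (inv_into U' c' (snd z)))"
      by (rule smooth_on_compose[OF o chart_image_open[OF cB Uc(2) oV], rotated 2])
        (auto intro: smooth_on_bounded_linear[OF o bounded_linear_snd] smooth_on_ident[OF o])
    moreover have "snd (inv_into X e z) = inv_into U' c' (snd z)" if "z \<in> c ` U \<times> c' ` (U' \<inter> V)" for z
      using that prod_chart_inv[OF cA cB Uc, of "fst z" "snd z"] by (auto simp: X)
    ultimately have "smooth_on (e ` (X \<inter> UNIV \<times> V)) (\<lambda>z. d (snd (inv_into X e z)))"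
      unfolding im using smooth_on_cong[of "c ` U \<times> c' ` (U' \<inter> V)" "\<lambda>z. d (snd (inv_into X e z))" "\<lambda>z. d (inv_into U' c' (snd z))"]
      by simp
    then show "\<exists>W. open W \<and> p \<in> W \<and> smooth_on (e ` (X \<inter> W)) (\<lambda>z. d (snd (inv_into X e z)))"
      using oV p by (intro exI[of _ "UNIV \<times> V"]) (auto simp: open_Times mem_Times_iff)
  qed (auto intro: continuous_intros)
qed

section \<open>Global functions with prescribed germs\<close>

lemma smooth_functions_extend_by_0:
  assumes A: "open_manifold A" and Uc: "(U, c) \<in> A" and S: "open S" "S \<subseteq> c ` U"
    and \<psi>: "smooth_on S \<psi>" and K: "compact K" "K \<subseteq> S" "\<And>x. x \<in> S \<Longrightarrow> x \<notin> K \<Longrightarrow> \<psi> x = 0"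
  shows "(\<lambda>q. if q \<in> U \<and> c q \<in> S then \<psi> (c q) else 0) \<in> smooth_functions A" (is "?f \<in> _")
proof -
  note cA = open_manifold_charted[OF A]
  let ?U = "U \<inter> c -` S"
  have oU: "open ?U" by (rule chart_vimage_open[OF cA Uc S(1)])
  let ?K = "inv_into U c ` K"
  have "compact ?K"
    using K S(2) continuous_on_subset[OF chart_inv_cont[OF cA Uc], of K]
    by (intro compact_continuous_image) auto
  \<comment> \<open>The Hausdorff property makes the compact image of \<open>K\<close> closed. Its
    complement and \<open>?U\<close> are then an open cover; the function is 0 on the former and a
    composition of smooth maps on the latter.\<close>
  then have oK: "open (- ?K)" using compact_imp_closed by blast
  have KU: "?K \<subseteq> ?U" 
  proof
    fix p assume "p \<in> ?K"
    then obtain x where x: "x \<in> K" "p = inv_into U c x" by blast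
    then have "x \<in> S" "x \<in> c ` U" using K(2) S(2) by auto
    then show "p \<in> ?U" using chart_inv_in[OF cA Uc] chart_inv'[OF cA Uc] x(2) by simp
  qed
  have notK: "?f q = 0" if "q \<notin> ?K" for q
    using that K(3)[of "c q"] chart_inv[OF cA Uc, of q] by force
  show ?thesis
  proof (rule smooth_functionsI[OF cA])
    fix V d q assume Vd: "(V, d) \<in> A" and q: "q \<in> V"
    show "\<exists>W. open W \<and> q \<in> W \<and> smooth_on (d ` (V \<inter> W)) (\<lambda>x. ?f (inv_into V d x))"
    proof (cases "q \<in> ?U")
      case True
      have T: "open (d ` (V \<inter> ?U))" by (rule chart_image_open[OF cA Vd oU])
      have "smooth_on (d ` (V \<inter> ?U)) (\<lambda>x. \<psi> (c (inv_into V d x)))"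
      proof (rule smooth_on_compose[OF T S(1) _ _ \<psi>])
        show "smooth_on (d ` (V \<inter> ?U)) (\<lambda>x. c (inv_into V d x))"
          using smooth_map_chart[OF smooth_map_id[OF A] Vd Uc] chart_image_open[OF cA Vd chart_open(1)[OF cA Uc]]
          by (intro smooth_on_subset[OF _ T, of "d ` (V \<inter> U)"]) auto
        show "(\<lambda>x. c (inv_into V d x)) ` d ` (V \<inter> ?U) \<subseteq> S"
          using chart_inv[OF cA Vd] by auto
      qed
      moreover have "?f (inv_into V d x) = \<psi> (c (inv_into V d x))" if "x \<in> d ` (V \<inter> ?U)" for x
        using that chart_inv[OF cA Vd] by auto
      ultimately have "smooth_on (d ` (V \<inter> ?U)) (\<lambda>x. ?f (inv_into V d x))"
        using smooth_on_cong[of "d ` (V \<inter> ?U)" "\<lambda>x. ?f (inv_into V d x)" "\<lambda>x. \<psi> (c (inv_into V d x))"]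
        by simp
      then show ?thesis using oU True by blast
    next
      case False
      have T: "open (d ` (V \<inter> - ?K))" by (rule chart_image_open[OF cA Vd oK])
      have "?f (inv_into V d x) = 0" if "x \<in> d ` (V \<inter> - ?K)" for x
        using that chart_inv[OF cA Vd] by (intro notK) auto
      then have "smooth_on (d ` (V \<inter> - ?K)) (\<lambda>x. ?f (inv_into V d x))"
        using smooth_on_cong[of "d ` (V \<inter> - ?K)" "\<lambda>x. ?f (inv_into V d x)" "\<lambda>_. 0"] smooth_on_const[OF T]
        by simp
      then show ?thesis using oK False KU by blast
    qed
  qed
qed

text \<open>A tangent vector can only be applied to a globally defined function, so a function given
  in a chart is first cut off. \<open>W\<close> is the neighbourhood on which the bump is 1 and the
  germ at \<open>q\<close> is untouched.\<close>

lemma smooth_function_globalize: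
  assumes A: "open_manifold A" and Uc: "(U, c) \<in> A" and q: "q \<in> U" and S: "open S" "S \<subseteq> c ` U" "c q \<in> S"
    and F: "smooth_on S F"
  obtains f W where "f \<in> smooth_functions A" "open W" "q \<in> W" "W \<subseteq> U" "c ` W \<subseteq> S"
    "\<And>p. p \<in> W \<Longrightarrow> f p = F (c p)" "\<And>p. p \<notin> U \<or> c p \<notin> S \<Longrightarrow> f p = 0"
proof -
  note cA = open_manifold_charted[OF A]
  obtain \<psi> :: "'b \<Rightarrow> real" and K W where \<psi>: "smooth_on UNIV \<psi>" "compact K" "K \<subseteq> S" "open W" "c q \<in> W" "W \<subseteq> K"
    "\<And>x. x \<notin> K \<Longrightarrow> \<psi> x = 0" "\<And>x. x \<in> W \<Longrightarrow> \<psi> x = 1"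
    using smooth_bump[OF S(1,3)] by metis
  show thesis
  proof
    let ?f = "\<lambda>q. if q \<in> U \<and> c q \<in> S then \<psi> (c q) * F (c q) else 0"
    show "?f \<in> smooth_functions A"
      using \<psi> smooth_on_subset[OF open_UNIV S(1) _ \<psi>(1)]
      by (intro smooth_functions_extend_by_0[OF A Uc S(1,2) smooth_on_mult[OF S(1) _ F] \<psi>(2,3)]) auto
    show "open (U \<inter> c -` W)" using chart_vimage_open[OF cA Uc \<psi>(4)] .
    show "q \<in> U \<inter> c -` W" "U \<inter> c -` W \<subseteq> U" "c ` (U \<inter> c -` W) \<subseteq> S" using q \<psi> by auto
    show "?f p = F (c p)" if "p \<in> U \<inter> c -` W" for p using that \<psi> by auto
    show "?f p = 0" if "p \<notin> U \<or> c p \<notin> S" for p using that by auto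
  qed
qed

lemma smooth_bump_function:
  assumes A: "open_manifold A" and O: "open S" "q \<in> S"
  obtains \<beta> where "\<beta> \<in> smooth_functions A" "\<beta> q = 1" "\<And>p. p \<notin> S \<Longrightarrow> \<beta> p = 0"
proof -
  note cA = open_manifold_charted[OF A]
  obtain U c where Uc: "(U, c) \<in> A" and q: "q \<in> U" using charted_at[OF cA] by blast
  have T: "open (c ` (U \<inter> S))" by (rule chart_image_open[OF cA Uc O(1)])
  obtain f W where f: "f \<in> smooth_functions A" "q \<in> W" "\<And>p. p \<in> W \<Longrightarrow> f p = 1"
    "\<And>p. p \<notin> U \<or> c p \<notin> c ` (U \<inter> S) \<Longrightarrow> f p = 0"
  proof (rule smooth_function_globalize[OF A Uc q T _ _ smooth_on_const[OF T, of 1]])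
    show "c ` (U \<inter> S) \<subseteq> c ` U" "c q \<in> c ` (U \<inter> S)" using q O by auto
  qed blast
  moreover have "p \<notin> U \<or> c p \<notin> c ` (U \<inter> S)" if "p \<notin> S" for p
    using that chart_inv[OF cA Uc] by (metis Int_iff imageE)
  ultimately show thesis using that by blast
qed

lemma smooth_functions_separate:
  assumes "open_manifold A" "p \<noteq> q"
  obtains f where "f \<in> smooth_functions A" "f p \<noteq> f q"
proof -
  have "open (- {q})" by auto
  then show thesis
    using smooth_bump_function[OF assms(1), of "- {q}" p] assms(2) that by (metis ComplI Compl_iff singletonD singletonI zero_neq_one)
qed

section \<open>Tangent vectors in charts\<close>

lemma tangent_spaceD:
  assumes "v \<in> tangent_space A p" "f \<in> smooth_functions A" "h \<in> smooth_functions A"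
  shows "v (\<lambda>x. f x + h x) = v f + v h"
    and "v (\<lambda>x. f x * h x) = v f * h p + f p * v h"
  using assms unfolding tangent_space_def plus_fun_def times_fun_def by blast+

lemma tangent_space_scale:
  "v \<in> tangent_space A p \<Longrightarrow> f \<in> smooth_functions A \<Longrightarrow> v (\<lambda>x. a * f x) = a * v f"
  unfolding tangent_space_def by (auto simp: scaleR_fun_def)

lemma tangent_space_not_smooth:
  "v \<in> tangent_space A p \<Longrightarrow> f \<notin> smooth_functions A \<Longrightarrow> v f = 0"
  unfolding tangent_space_def by blast

lemma tangent_spaceI:
  assumes "\<And>f h. f \<in> smooth_functions A \<Longrightarrow> h \<in> smooth_functions A \<Longrightarrow> v (\<lambda>x. f x + h x) = v f + v h"
    and "\<And>f h. f \<in> smooth_functions A \<Longrightarrow> h \<in> smooth_functions A \<Longrightarrow>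
      v (\<lambda>x. f x * h x) = v f * h p + f p * v h"
    and "\<And>a f. f \<in> smooth_functions A \<Longrightarrow> v (\<lambda>x. a * f x) = a * v f"
    and "\<And>f. f \<notin> smooth_functions A \<Longrightarrow> v f = 0"
  shows "v \<in> tangent_space A p"
  using assms unfolding tangent_space_def by (simp add: plus_fun_def times_fun_def scaleR_fun_def)

lemma subspace_tangent_space: "subspace (tangent_space A p)"
  unfolding subspace_def tangent_space_def by (auto simp: scaleR_fun_def algebra_simps)

context
  fixes A :: "('m::topological_space, 'e::euclidean_space) atlas" and v p
  assumes A: "charted A" and v: "v \<in> tangent_space A p"
begin

lemma tangent_const: "v (\<lambda>_. a) = 0"
proof -
  have "v (\<lambda>_. 1) = 0"
    using tangent_spaceD(2)[OF v smooth_functions_const[OF A, of 1] smooth_functions_const[OF A, of 1]]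
    by simp
  then show ?thesis
    using tangent_space_scale[OF v smooth_functions_const[OF A, of 1], of a] by simp
qed

lemma tangent_diff:
  assumes "f \<in> smooth_functions A" "h \<in> smooth_functions A"
  shows "v (\<lambda>x. f x - h x) = v f - v h"
proof -
  have "(\<lambda>x. (-1) * h x) \<in> smooth_functions A"
    using smooth_functions_mult[OF A smooth_functions_const[OF A] assms(2)] .
  then show ?thesis
    using tangent_spaceD(1)[OF v assms(1)] tangent_space_scale[OF v assms(2), of "-1"] by fastforce
qed

lemma tangent_sum:
  assumes "\<And>i. i \<in> I \<Longrightarrow> f i \<in> smooth_functions A"
  shows "v (\<lambda>x. \<Sum>i\<in>I. f i x) = (\<Sum>i\<in>I. v (f i))"
  using assms
  by (induction I rule: infinite_finite_induct)
    (simp_all add: tangent_const tangent_spaceD(1)[OF v] smooth_functions_sum[OF A])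

end

text \<open>For a bump \<beta> that is 1 at \<open>p\<close> and 0 off \<open>W\<close>, the product
  of \<beta> with \<open>f - f'\<close> is identically 0, and the Leibniz rule at \<open>p\<close>
  reduces its derivative to that of \<open>f - f'\<close>.\<close>

lemma tangent_local:
  assumes A: "open_manifold A" and v: "v \<in> tangent_space A p"
    and f: "f \<in> smooth_functions A" "f' \<in> smooth_functions A"
    and W: "open W" "p \<in> W" "\<And>x. x \<in> W \<Longrightarrow> f x = f' x"
  shows "v f = v f'"
proof -
  note cA = open_manifold_charted[OF A]
  obtain \<beta> where b: "\<beta> \<in> smooth_functions A" "\<beta> p = 1" "\<And>x. x \<notin> W \<Longrightarrow> \<beta> x = 0"
    using smooth_bump_function[OF A W(1,2)] by blast
  have "(\<lambda>x. (f x - f' x) * \<beta> x) = (\<lambda>_. 0)"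
    using b(3) W(3) by (metis diff_self mult_eq_0_iff)
  then have "v (\<lambda>x. (f x - f' x) * \<beta> x) = 0" using tangent_const[OF cA v] by simp
  then show ?thesis
    using tangent_spaceD(2)[OF v smooth_functions_diff[OF cA f] b(1)] tangent_diff[OF cA v f] b(2) W
    by simp
qed

definition chart_deriv :: "'m set \<Rightarrow> ('m \<Rightarrow> 'e::euclidean_space) \<Rightarrow> ('m \<Rightarrow> real) \<Rightarrow> 'm \<Rightarrow> 'e \<Rightarrow> real" where
  "chart_deriv U c f p = frechet_derivative (\<lambda>x. f (inv_into U c x)) (at (c p))"

lemma chart_has_derivative:
  assumes "charted A" "(U, c) \<in> A" "p \<in> U" "f \<in> smooth_functions A"
  shows "((\<lambda>x. f (inv_into U c x)) has_derivative chart_deriv U c f p) (at (c p))"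
  unfolding chart_deriv_def
  using smooth_on_D(1)[OF chart_open(2)[OF assms(1,2)] smooth_functions_chart[OF assms(4,2)]] assms(3)
  by auto

lemma chart_deriv_eqI:
  "((\<lambda>x. f (inv_into U c x)) has_derivative D) (at (c p)) \<Longrightarrow> chart_deriv U c f p = D"
  unfolding chart_deriv_def by (rule frechet_derivative_at[symmetric])

text \<open>Hadamard's lemma writes \<open>f\<close> near \<open>q\<close> as a constant plus
  products whose first factors are coordinates vanishing at \<open>q\<close>, so the Leibniz rule
  leaves only the derivatives of the coordinates. These, taken by \<open>v\<close>, are the
  components of \<open>b\<close>.\<close>

lemma tangent_in_chart:
  assumes A: "open_manifold A" and Uc: "(U, c) \<in> A" and q: "q \<in> U" and v: "v \<in> tangent_space A q"
  obtains b where "\<And>f. f \<in> smooth_functions A \<Longrightarrow> v f = chart_deriv U c f q b"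
proof -
  note cA = open_manifold_charted[OF A]
  obtain r where r: "r > 0" "ball (c q) r \<subseteq> c ` U"
    using chart_open(2)[OF cA Uc] q open_contains_ball by blast
  let ?B = "ball (c q) r"
  have B: "open ?B" "convex ?B" "c q \<in> ?B" using r by auto
  have coord: "smooth_on ?B (\<lambda>x. (x - c q) \<bullet> b)" for b
    using smooth_on_add[OF B(1) smooth_on_bounded_linear[OF B(1) bounded_linear_inner_left smooth_on_ident[OF B(1)], of b]
        smooth_on_const[OF B(1), of "- (c q \<bullet> b)"]]
    by (simp add: inner_diff_left)
  have ex: "\<exists>X W. X \<in> smooth_functions A \<and> open W \<and> q \<in> W \<and> W \<subseteq> U \<and> c ` W \<subseteq> ?B \<and> (\<forall>p\<in>W. X p = F (c p))"
    if "smooth_on ?B F" for F :: "_ \<Rightarrow> real"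
    using smooth_function_globalize[OF A Uc q B(1) r(2) B(3) that] by (metis (no_types, lifting))
  then have "\<exists>X. \<forall>b. \<exists>W. X b \<in> smooth_functions A \<and> open W \<and> q \<in> W \<and> W \<subseteq> U \<and> c ` W \<subseteq> ?B \<and> (\<forall>p\<in>W. X b p = (c p - c q) \<bullet> b)"
    using coord by (intro choice) blast
  then obtain X WX where X: "\<And>b. X b \<in> smooth_functions A" "\<And>b. open (WX b)" "\<And>b. q \<in> WX b" "\<And>b. WX b \<subseteq> U"
      "\<And>b. c ` WX b \<subseteq> ?B" "\<And>b p. p \<in> WX b \<Longrightarrow> X b p = (c p - c q) \<bullet> b"
    by metis
  have "v f = chart_deriv U c f q (\<Sum>b\<in>Basis. v (X b) *\<^sub>R b)" if f: "f \<in> smooth_functions A" for f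
  proof -
    let ?F = "\<lambda>x. f (inv_into U c x)"
    have F: "smooth_on ?B ?F"
      using smooth_on_subset[OF chart_open(2)[OF cA Uc] B(1) r(2) smooth_functions_chart[OF f Uc]] .
    obtain g where g: "\<And>b. smooth_on ?B (g b)"
      "\<And>x. x \<in> ?B \<Longrightarrow> ?F x = ?F (c q) + (\<Sum>b\<in>Basis. ((x - c q) \<bullet> b) * g b x)"
      "\<And>b. g b (c q) = frechet_derivative ?F (at (c q)) b"
      using Hadamard[OF B F] by blast
    have "\<exists>Y. \<forall>b. \<exists>W. Y b \<in> smooth_functions A \<and> open W \<and> q \<in> W \<and> W \<subseteq> U \<and> c ` W \<subseteq> ?B \<and> (\<forall>p\<in>W. Y b p = g b (c p))"
      using ex g(1) by (intro choice) blast
    then obtain Y WY where Y: "\<And>b. Y b \<in> smooth_functions A" "\<And>b. open (WY b)" "\<And>b. q \<in> WY b" 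
        "\<And>b p. p \<in> WY b \<Longrightarrow> Y b p = g b (c p)"
      by metis
    let ?W = "(\<Inter>b\<in>Basis. WX b \<inter> WY b)"
    have W: "open ?W" "q \<in> ?W" using X(2,3) Y(2,3) by (auto intro!: open_INT)
    have "f p = f q + (\<Sum>b\<in>Basis. X b p * Y b p)" if p: "p \<in> ?W" for p
    proof -
      obtain b0 :: 'b where "b0 \<in> Basis" using nonempty_Basis by blast
      then have "p \<in> WX b0" using p by blast
      then have "p \<in> U" "c p \<in> ?B" using X(4)[of b0] X(5)[of b0] by blast+
      then have "f p = f q + (\<Sum>b\<in>Basis. ((c p - c q) \<bullet> b) * g b (c p))"
        using g(2)[of "c p"] chart_inv[OF cA Uc] q by simp
      then show ?thesis using p X(6) Y(4) by simp
    qed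
    moreover have sm: "(\<lambda>p. \<Sum>b\<in>Basis. X b p * Y b p) \<in> smooth_functions A"
      using X(1) Y(1) by (intro smooth_functions_sum[OF cA] smooth_functions_mult[OF cA])
    ultimately have "v f = v (\<lambda>p. f q + (\<Sum>b\<in>Basis. X b p * Y b p))"
      using tangent_local[OF A v f _ W] smooth_functions_add[OF cA smooth_functions_const[OF cA] sm] by blast
    also have "\<dots> = (\<Sum>b\<in>Basis. v (\<lambda>p. X b p * Y b p))"
      using tangent_spaceD(1)[OF v smooth_functions_const[OF cA] sm] tangent_const[OF cA v]
        tangent_sum[OF cA v, of Basis "\<lambda>b p. X b p * Y b p"] smooth_functions_mult[OF cA X(1) Y(1)]
      by simp
    also have "\<dots> = (\<Sum>b\<in>Basis. v (X b) * chart_deriv U c f q b)"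
      using tangent_spaceD(2)[OF v X(1) Y(1)] X(3,6) Y(3,4) g(3) by (simp add: chart_deriv_def)
    also have "\<dots> = chart_deriv U c f q (\<Sum>b\<in>Basis. v (X b) *\<^sub>R b)"
      using has_derivative_linear[OF chart_has_derivative[OF cA Uc q f]]
      by (simp add: linear_sum linear_scale)
    finally show ?thesis .
  qed
  then show thesis using that by blast
qed

definition chart_vector ::
    "('m, 'e::euclidean_space) atlas \<Rightarrow> 'm set \<Rightarrow> ('m \<Rightarrow> 'e) \<Rightarrow> 'm \<Rightarrow> 'e \<Rightarrow> 'm tvec" where
  "chart_vector A U c q b = (\<lambda>f. if f \<in> smooth_functions A then chart_deriv U c f q b else 0)"

lemma chart_vector_in:
  assumes A: "charted A" and Uc: "(U, c) \<in> A" and q: "q \<in> U"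
  shows "chart_vector A U c q b \<in> tangent_space A q"
proof (rule tangent_spaceI)
  fix f h a assume f: "f \<in> smooth_functions A"
  note Df = chart_has_derivative[OF A Uc q f]
  show "chart_vector A U c q b (\<lambda>x. a * f x) = a * chart_vector A U c q b f"
    using chart_deriv_eqI[OF has_derivative_mult_right[OF Df, of a]] f
      smooth_functions_mult[OF A smooth_functions_const[OF A] f]
    by (simp add: chart_vector_def)
  assume h: "h \<in> smooth_functions A"
  note Dh = chart_has_derivative[OF A Uc q h]
  show "chart_vector A U c q b (\<lambda>x. f x + h x) = chart_vector A U c q b f + chart_vector A U c q b h"
    using chart_deriv_eqI[OF has_derivative_add[OF Df Dh]] f h smooth_functions_add[OF A f h]
    by (simp add: chart_vector_def)
  show "chart_vector A U c q b (\<lambda>x. f x * h x) =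
      chart_vector A U c q b f * h q + f q * chart_vector A U c q b h"
    using chart_deriv_eqI[OF has_derivative_mult[OF Df Dh]] f h smooth_functions_mult[OF A f h]
      chart_inv[OF A Uc q]
    by (simp add: chart_vector_def)
qed (simp add: chart_vector_def)

lemma linear_chart_vector:
  assumes A: "charted A" and Uc: "(U, c) \<in> A" and q: "q \<in> U"
  shows "linear (chart_vector A U c q)"
proof
  fix a b r
  note L = has_derivative_linear[OF chart_has_derivative[OF A Uc q]]
  show "chart_vector A U c q (a + b) = chart_vector A U c q a + chart_vector A U c q b"
    by (auto simp: chart_vector_def fun_eq_iff linear_add[OF L])
  show "chart_vector A U c q (r *\<^sub>R b) = r *\<^sub>R chart_vector A U c q b"
    by (auto simp: chart_vector_def fun_eq_iff linear_scale[OF L] scaleR_fun_def)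
qed

text \<open>The coordinates are replaced by global functions \<xi>. The coefficients of a vector
  then become its values on fixed smooth functions, so for a smooth field they depend smoothly on
  the point.\<close>

lemma chart_coordinates:
  assumes A: "open_manifold A" and Uc: "(U, c) \<in> A" and q: "q \<in> U"
  obtains \<xi> W where "open W" "q \<in> W" "W \<subseteq> U" "\<And>b. \<xi> b \<in> smooth_functions A"
    "\<And>p b a. p \<in> W \<Longrightarrow> b \<in> Basis \<Longrightarrow> chart_deriv U c (\<xi> b) p a = a \<bullet> b"
    "\<And>p v f. p \<in> W \<Longrightarrow> v \<in> tangent_space A p \<Longrightarrow> f \<in> smooth_functions A \<Longrightarrow>
      v f = (\<Sum>b\<in>Basis. v (\<xi> b) * chart_deriv U c f p b)"
proof -
  note cA = open_manifold_charted[OF A]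
  note o = chart_open(2)[OF cA Uc]
  have "\<exists>\<xi>. \<forall>b. \<exists>W. \<xi> b \<in> smooth_functions A \<and> open W \<and> q \<in> W \<and> W \<subseteq> U \<and> (\<forall>p\<in>W. \<xi> b p = c p \<bullet> b)"
  proof (intro choice allI)
    fix b
    show "\<exists>\<xi> W. \<xi> \<in> smooth_functions A \<and> open W \<and> q \<in> W \<and> W \<subseteq> U \<and> (\<forall>p\<in>W. \<xi> p = c p \<bullet> b)"
      using smooth_function_globalize[OF A Uc q o _ _
          smooth_on_bounded_linear[OF o bounded_linear_inner_left smooth_on_ident[OF o], of b]] q
      by (metis imageI order_refl)
  qed
  then obtain \<xi> W where \<xi>: "\<And>b. \<xi> b \<in> smooth_functions A" and W: "\<And>b. open (W b)" "\<And>b. q \<in> W b" "\<And>b. W b \<subseteq> U"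
    and \<xi>W: "\<And>b p. p \<in> W b \<Longrightarrow> \<xi> b p = c p \<bullet> b"
    by metis
  let ?W = "\<Inter>b\<in>Basis. W b"
  have WU: "?W \<subseteq> U" using W(3) nonempty_Basis by blast
  have D: "chart_deriv U c (\<xi> b) p a = a \<bullet> b" if p: "p \<in> ?W" and b: "b \<in> Basis" for p b a
  proof -
    have pU: "p \<in> U" using p WU by auto
    have "((\<lambda>x. x \<bullet> b) has_derivative (\<lambda>a. a \<bullet> b)) (at (c p))"
      by (rule bounded_linear_imp_has_derivative[OF bounded_linear_inner_left])
    then have "((\<lambda>x. \<xi> b (inv_into U c x)) has_derivative (\<lambda>a. a \<bullet> b)) (at (c p))"
    proof (rule has_derivative_transform_within_open)
      show "open (c ` (U \<inter> W b))" using chart_image_open[OF cA Uc W(1)] .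
      show "c p \<in> c ` (U \<inter> W b)" using p pU b by auto
      show "x \<bullet> b = \<xi> b (inv_into U c x)" if "x \<in> c ` (U \<inter> W b)" for x
        using that \<xi>W chart_inv[OF cA Uc] by auto
    qed
    then show ?thesis by (simp add: chart_deriv_eqI)
  qed
  show thesis
  proof
    show "open ?W" "q \<in> ?W" "?W \<subseteq> U" "\<And>b. \<xi> b \<in> smooth_functions A" using W WU \<xi> by auto
    show "chart_deriv U c (\<xi> b) p a = a \<bullet> b" if "p \<in> ?W" "b \<in> Basis" for p b a
      by (rule D[OF that])
    fix p v f assume p: "p \<in> ?W" and v: "v \<in> tangent_space A p" and f: "f \<in> smooth_functions A"
    have pU: "p \<in> U" using p WU by auto
    obtain a where a: "\<And>f. f \<in> smooth_functions A \<Longrightarrow> v f = chart_deriv U c f p a"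
      using tangent_in_chart[OF A Uc pU v] by blast
    have "v (\<xi> b) = a \<bullet> b" if "b \<in> Basis" for b
      using a[OF \<xi>] D[OF p that] by simp
    then show "v f = (\<Sum>b\<in>Basis. v (\<xi> b) * chart_deriv U c f p b)"
      using a[OF f] linear_euclidean_expand[OF has_derivative_linear[OF chart_has_derivative[OF cA Uc pU f]], of a]
      by simp
  qed
qed

text \<open>The derivations at a point thus form a space of the dimension of the chart model, from
  which \<open>ex_isometry\<close> starts.\<close>

lemma chart_vector_bij:
  assumes A: "open_manifold A" and Uc: "(U, c) \<in> A" and q: "q \<in> U"
  shows "bij_betw (chart_vector A U c q) UNIV (tangent_space A q)"
proof -
  note cA = open_manifold_charted[OF A]
  obtain \<xi> W where \<xi>: "q \<in> W" "\<And>b. \<xi> b \<in> smooth_functions A"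
    "\<And>p b a. p \<in> W \<Longrightarrow> b \<in> Basis \<Longrightarrow> chart_deriv U c (\<xi> b) p a = a \<bullet> b"
    using chart_coordinates[OF A Uc q] by metis
  have "inj (chart_vector A U c q)"
  proof (rule injI)
    fix a b assume "chart_vector A U c q a = chart_vector A U c q b"
    then have "chart_vector A U c q a (\<xi> i) = chart_vector A U c q b (\<xi> i)" for i by simp
    then have *: "chart_deriv U c (\<xi> i) q a = chart_deriv U c (\<xi> i) q b" for i
      using \<xi>(2) by (simp add: chart_vector_def)
    have "a \<bullet> i = b \<bullet> i" if "i \<in> Basis" for i
      using *[of i] unfolding \<xi>(3)[OF \<xi>(1) that] .
    then show "a = b" by (rule euclidean_eqI)
  qed
  moreover have "v \<in> range (chart_vector A U c q)" if v: "v \<in> tangent_space A q" for v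
  proof -
    obtain a where a: "\<And>f. f \<in> smooth_functions A \<Longrightarrow> v f = chart_deriv U c f q a"
      using tangent_in_chart[OF A Uc q v] by blast
    then have "v = chart_vector A U c q a"
      using tangent_space_not_smooth[OF v] by (auto simp: chart_vector_def fun_eq_iff)
    then show ?thesis by blast
  qed
  ultimately show ?thesis
    using chart_vector_in[OF cA Uc q] by (auto simp: bij_betw_def)
qed

section \<open>Functions on products: partial and mixed derivatives\<close>

lemma smooth_slice:
  assumes A: "open_manifold A" and B: "open_manifold B" and K: "K \<in> smooth_functions (prod_atlas A B)"
  shows "(\<lambda>y. K (p, y)) \<in> smooth_functions B" and "(\<lambda>x. K (x, q)) \<in> smooth_functions A"
proof -
  note cA = open_manifold_charted[OF A] and cB = open_manifold_charted[OF B]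
  show "(\<lambda>y. K (p, y)) \<in> smooth_functions B"
    by (rule smooth_functions_compose[OF cB charted_prod[OF cA cB] smooth_map_Pair[OF cB cA cB
            smooth_map_const[OF cB cA] smooth_map_id[OF B]] K])
  show "(\<lambda>x. K (x, q)) \<in> smooth_functions A"
    by (rule smooth_functions_compose[OF cA charted_prod[OF cA cB] smooth_map_Pair[OF cA cA cB
            smooth_map_id[OF A] smooth_map_const[OF cA cB]] K])
qed

context
  fixes A :: "('m::{t2_space,second_countable_topology}, 'e::euclidean_space) atlas"
    and B :: "('n::{t2_space,second_countable_topology}, 'f::euclidean_space) atlas"
    and K U c V d
  assumes A: "open_manifold A" and B: "open_manifold B" and K: "K \<in> smooth_functions (prod_atlas A B)"
    and Uc: "(U, c) \<in> A" and Vd: "(V, d) \<in> B"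
begin

abbreviation (input) K_chart where "K_chart \<equiv> \<lambda>z. K (inv_into U c (fst z), inv_into V d (snd z))"

lemma K_chart_open: "open (c ` U \<times> d ` V)"
  using chart_open(2)[OF open_manifold_charted[OF A] Uc] chart_open(2)[OF open_manifold_charted[OF B] Vd]
  by (rule open_Times)

lemma K_chart_smooth: "smooth_on (c ` U \<times> d ` V) K_chart"
proof -
  have X: "(U \<times> V, map_prod c d) \<in> prod_atlas A B" using Uc Vd by (auto simp: prod_atlas_def)
  have "map_prod c d ` (U \<times> V) = c ` U \<times> d ` V" by auto
  then have "smooth_on (c ` U \<times> d ` V) (\<lambda>x. K (inv_into (U \<times> V) (map_prod c d) x))"
    using smooth_functions_chart[OF K X] by simp
  moreover have "K (inv_into (U \<times> V) (map_prod c d) z) = K_chart z" if "z \<in> c ` U \<times> d ` V" for z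
    using prod_chart_inv[OF open_manifold_charted[OF A] open_manifold_charted[OF B] Uc Vd, of "fst z" "snd z"] that
    by auto
  ultimately show ?thesis
    using smooth_on_cong[of "c ` U \<times> d ` V" "\<lambda>x. K (inv_into (U \<times> V) (map_prod c d) x)" K_chart] by simp
qed

lemma K_chart_has_derivative:
  "p \<in> U \<Longrightarrow> q \<in> V \<Longrightarrow> (K_chart has_derivative frechet_derivative K_chart (at (c p, d q))) (at (c p, d q))"
  using smooth_on_D(1)[OF K_chart_open K_chart_smooth] by auto

lemma chart_deriv_snd:
  assumes "p \<in> U" "q \<in> V"
  shows "chart_deriv V d (\<lambda>y. K (p, y)) q b = frechet_derivative K_chart (at (c p, d q)) (0, b)"
proof -
  have "((\<lambda>y. (c p, y)) has_derivative (\<lambda>b. (0, b))) (at (d q))"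
    by (intro has_derivative_Pair has_derivative_const has_derivative_ident)
  from has_derivative_compose[OF this K_chart_has_derivative[OF assms]]
  have "((\<lambda>y. K (p, inv_into V d y)) has_derivative
      (\<lambda>b. frechet_derivative K_chart (at (c p, d q)) (0, b))) (at (d q))"
    using chart_inv[OF open_manifold_charted[OF A] Uc assms(1)] by simp
  then show ?thesis by (simp add: chart_deriv_eqI)
qed

lemma chart_deriv_fst:
  assumes "p \<in> U" "q \<in> V"
  shows "chart_deriv U c (\<lambda>x. K (x, q)) p a = frechet_derivative K_chart (at (c p, d q)) (a, 0)"
proof -
  have "((\<lambda>x. (x, d q)) has_derivative (\<lambda>a. (a, 0))) (at (c p))"
    by (intro has_derivative_Pair has_derivative_const has_derivative_ident)
  from has_derivative_compose[OF this K_chart_has_derivative[OF assms]]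
  have "((\<lambda>x. K (inv_into U c x, q)) has_derivative
      (\<lambda>a. frechet_derivative K_chart (at (c p, d q)) (a, 0))) (at (c p))"
    using chart_inv[OF open_manifold_charted[OF B] Vd assms(2)] by simp
  then show ?thesis by (simp add: chart_deriv_eqI)
qed

lemma chart_deriv_deriv_snd:
  assumes "p \<in> U" "q \<in> V" "\<And>x. x \<in> U \<Longrightarrow> F x = frechet_derivative K_chart (at (c x, d q)) (0, b)"
  shows "chart_deriv U c F p a =
    frechet_derivative (\<lambda>z. frechet_derivative K_chart (at z) (0, b)) (at (c p, d q)) (a, 0)"
proof -
  note cA = open_manifold_charted[OF A]
  let ?G = "\<lambda>z. frechet_derivative K_chart (at z) (0, b)"
  have "((\<lambda>x. (x, d q)) has_derivative (\<lambda>a. (a, 0))) (at (c p))"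
    by (intro has_derivative_Pair has_derivative_const has_derivative_ident)
  moreover have "(?G has_derivative frechet_derivative ?G (at (c p, d q))) (at (c p, d q))"
    using smooth_on_D(1)[OF K_chart_open smooth_on_D(2)[OF K_chart_open K_chart_smooth]] assms by auto
  ultimately have "((\<lambda>x. ?G (x, d q)) has_derivative (\<lambda>a. frechet_derivative ?G (at (c p, d q)) (a, 0))) (at (c p))"
    by (rule has_derivative_compose)
  then have "((\<lambda>x. F (inv_into U c x)) has_derivative (\<lambda>a. frechet_derivative ?G (at (c p, d q)) (a, 0))) (at (c p))"
    by (rule has_derivative_transform_within_open[OF _ chart_open(2)[OF cA Uc]])
      (use assms chart_inv[OF cA Uc] in auto)
  then show ?thesis by (simp add: chart_deriv_eqI)
qed

lemma chart_deriv_deriv_fst: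
  assumes "p \<in> U" "q \<in> V" "\<And>y. y \<in> V \<Longrightarrow> F y = frechet_derivative K_chart (at (c p, d y)) (a, 0)"
  shows "chart_deriv V d F q b =
    frechet_derivative (\<lambda>z. frechet_derivative K_chart (at z) (a, 0)) (at (c p, d q)) (0, b)"
proof -
  note cB = open_manifold_charted[OF B]
  let ?G = "\<lambda>z. frechet_derivative K_chart (at z) (a, 0)"
  have "((\<lambda>y. (c p, y)) has_derivative (\<lambda>b. (0, b))) (at (d q))"
    by (intro has_derivative_Pair has_derivative_const has_derivative_ident)
  moreover have "(?G has_derivative frechet_derivative ?G (at (c p, d q))) (at (c p, d q))"
    using smooth_on_D(1)[OF K_chart_open smooth_on_D(2)[OF K_chart_open K_chart_smooth]] assms by auto
  ultimately have "((\<lambda>y. ?G (c p, y)) has_derivative (\<lambda>b. frechet_derivative ?G (at (c p, d q)) (0, b))) (at (d q))"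
    by (rule has_derivative_compose)
  then have "((\<lambda>y. F (inv_into V d y)) has_derivative (\<lambda>b. frechet_derivative ?G (at (c p, d q)) (0, b))) (at (d q))"
    by (rule has_derivative_transform_within_open[OF _ chart_open(2)[OF cB Vd]])
      (use assms chart_inv[OF cB Vd] in auto)
  then show ?thesis by (simp add: chart_deriv_eqI)
qed

end

text \<open>The source of smoothness for fields built from the group law: in charts the value is a
  sum of smooth coefficients of \<open>V\<close> times partial derivatives of \<open>K\<close> along
  the graph of \<phi>.\<close>

lemma smooth_partial:
  assumes A: "open_manifold A" and B: "open_manifold B" and \<phi>: "smooth_map A B \<phi>"
    and V: "V \<in> fields_along A B \<phi>" and K: "K \<in> smooth_functions (prod_atlas A B)"
  shows "(\<lambda>p. V p (\<lambda>y. K (p, y))) \<in> smooth_functions A"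
proof -
  note cA = open_manifold_charted[OF A] and cB = open_manifold_charted[OF B]
  show ?thesis
  proof (rule smooth_functionsI[OF cA])
    fix U c p assume Uc: "(U, c) \<in> A" and p: "p \<in> U"
    obtain V' d where Vd: "(V', d) \<in> B" "\<phi> p \<in> V'" using charted_at[OF cB] by blast
    obtain \<xi> W where W: "open W" "\<phi> p \<in> W" "W \<subseteq> V'" and \<xi>: "\<And>b. \<xi> b \<in> smooth_functions B"
      and rep: "\<And>p v f. p \<in> W \<Longrightarrow> v \<in> tangent_space B p \<Longrightarrow> f \<in> smooth_functions B \<Longrightarrow>
        v f = (\<Sum>b\<in>Basis. v (\<xi> b) * chart_deriv V' d f p b)"
      using chart_coordinates[OF B Vd] by metis
    let ?K = "\<lambda>z. K (inv_into U c (fst z), inv_into V' d (snd z))"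
    note Ko = K_chart_open[OF A B K Uc Vd(1)]
    note Ks = K_chart_smooth[OF A B K Uc Vd(1)]
    have oW: "open (\<phi> -` W)" using smooth_map_cont[OF \<phi> W(1)] .
    let ?T = "c ` (U \<inter> \<phi> -` W)"
    have T: "open ?T" using chart_image_open[OF cA Uc oW] .
    have TU: "open (c ` U)" "?T \<subseteq> c ` U" using chart_open[OF cA Uc] by auto
    have d\<phi>: "smooth_on ?T (\<lambda>x. d (\<phi> (inv_into U c x)))"
      by (rule smooth_on_subset[OF chart_image_open[OF cA Uc smooth_map_cont[OF \<phi> chart_open(1)[OF cB Vd(1)]]]
            T _ smooth_map_chart[OF \<phi> Uc Vd(1)]]) (use W in auto)
    have "smooth_on ?T (\<lambda>x. \<Sum>b\<in>Basis. V (inv_into U c x) (\<xi> b) *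
        frechet_derivative ?K (at (x, d (\<phi> (inv_into U c x)))) (0, b))"
    proof (intro smooth_on_sum[OF T] smooth_on_mult[OF T])
      fix b :: 'd
      have "(\<lambda>p. V p (\<xi> b)) \<in> smooth_functions A" using V \<xi> by (auto simp: fields_along_def)
      then show "smooth_on ?T (\<lambda>x. V (inv_into U c x) (\<xi> b))"
        using smooth_functions_chart[OF _ Uc] smooth_on_subset[OF TU(1) T TU(2)] by blast
      show "smooth_on ?T (\<lambda>x. frechet_derivative ?K (at (x, d (\<phi> (inv_into U c x)))) (0, b))"
        by (rule smooth_on_compose[OF T Ko _ smooth_on_Pair[OF T smooth_on_ident[OF T] d\<phi>]
              smooth_on_D(2)[OF Ko Ks, of "(0, b)"]])
          (use W chart_inv[OF cA Uc] in auto)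
    qed
    moreover have "V (inv_into U c x) (\<lambda>y. K (inv_into U c x, y)) = (\<Sum>b\<in>Basis. V (inv_into U c x) (\<xi> b) *
        frechet_derivative ?K (at (x, d (\<phi> (inv_into U c x)))) (0, b))" if "x \<in> ?T" for x
    proof -
      have q: "inv_into U c x \<in> U" "\<phi> (inv_into U c x) \<in> W" "c (inv_into U c x) = x"
        using that chart_inv[OF cA Uc] by auto
      then have q': "\<phi> (inv_into U c x) \<in> V'" using W by auto
      have "V (inv_into U c x) \<in> tangent_space B (\<phi> (inv_into U c x))"
        using V by (auto simp: fields_along_def)
      from rep[OF q(2) this smooth_slice(1)[OF A B K, of "inv_into U c x"]] show ?thesis
        using chart_deriv_snd[OF A B K Uc Vd(1) q(1) q'] q(3)
        by simp
    qed
    ultimately have "smooth_on ?T (\<lambda>x. V (inv_into U c x) (\<lambda>y. K (inv_into U c x, y)))"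
      using smooth_on_cong[of ?T "\<lambda>x. V (inv_into U c x) (\<lambda>y. K (inv_into U c x, y))"] by simp
    then show "\<exists>W. open W \<and> p \<in> W \<and>
        smooth_on (c ` (U \<inter> W)) (\<lambda>x. V (inv_into U c x) (\<lambda>y. K (inv_into U c x, y)))"
      using oW W(2) by (intro exI[of _ "\<phi> -` W"]) auto
  qed
qed

lemma smooth_partial_const:
  assumes A: "open_manifold A" and B: "open_manifold B" and v: "v \<in> tangent_space B q"
    and K: "K \<in> smooth_functions (prod_atlas A B)"
  shows "(\<lambda>p. v (\<lambda>y. K (p, y))) \<in> smooth_functions A"
proof -
  note cA = open_manifold_charted[OF A] and cB = open_manifold_charted[OF B]
  \<comment> \<open>A fixed tangent vector is a smooth field along a constant map.\<close>
  have "(\<lambda>_. v) \<in> fields_along A B (\<lambda>_. q)"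
    using v smooth_functions_const[OF cA] by (auto simp: fields_along_def)
  then show ?thesis using smooth_partial[OF A B smooth_map_const[OF cA cB] _ K] by blast
qed

text \<open>The chain rule for the diagonal map, by splitting \<open>(b, b)\<close> as
  \<open>(b, 0) + (0, b)\<close>. It serves to differentiate conjugation and inversion in a
  group.\<close>

lemma tangent_diagonal:
  assumes A: "open_manifold A" and v: "v \<in> tangent_space A q" and K: "K \<in> smooth_functions (prod_atlas A A)"
  shows "v (\<lambda>x. K (x, x)) = v (\<lambda>x. K (x, q)) + v (\<lambda>y. K (q, y))"
proof -
  note cA = open_manifold_charted[OF A]
  obtain U c where Uc: "(U, c) \<in> A" "q \<in> U" using charted_at[OF cA] by blast
  obtain b where b: "\<And>f. f \<in> smooth_functions A \<Longrightarrow> v f = chart_deriv U c f q b"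
    using tangent_in_chart[OF A Uc v] by blast
  let ?K = "\<lambda>z. K (inv_into U c (fst z), inv_into U c (snd z))"
  let ?D = "frechet_derivative ?K (at (c q, c q))"
  have D: "(?K has_derivative ?D) (at (c q, c q))"
    by (rule K_chart_has_derivative[OF A A K Uc(1) Uc(1) Uc(2) Uc(2)])
  have "((\<lambda>x. (x, x)) has_derivative (\<lambda>b. (b, b))) (at (c q))"
    by (intro has_derivative_Pair has_derivative_ident)
  from has_derivative_compose[OF this D]
  have "chart_deriv U c (\<lambda>x. K (x, x)) q b = ?D (b, b)"
    by (simp add: chart_deriv_eqI)
  also have "\<dots> = ?D ((b, 0) + (0, b))" by simp
  also have "\<dots> = ?D (b, 0) + ?D (0, b)"
    by (rule linear_add[OF has_derivative_linear[OF D]])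
  finally have "chart_deriv U c (\<lambda>x. K (x, x)) q b =
      chart_deriv U c (\<lambda>x. K (x, q)) q b + chart_deriv U c (\<lambda>y. K (q, y)) q b"
    using chart_deriv_fst[OF A A K Uc(1) Uc(1) Uc(2) Uc(2)] chart_deriv_snd[OF A A K Uc(1) Uc(1) Uc(2) Uc(2)]
    by simp
  moreover have "(\<lambda>x. K (x, x)) \<in> smooth_functions A"
    by (rule smooth_functions_compose[OF cA charted_prod[OF cA cA]
          smooth_map_Pair[OF cA cA cA smooth_map_id[OF A] smooth_map_id[OF A]] K])
  ultimately show ?thesis
    using b smooth_slice[OF A A K] by simp
qed

lemma smooth_swap:
  assumes A: "open_manifold A" and B: "open_manifold B" and K: "K \<in> smooth_functions (prod_atlas A B)"
  shows "(\<lambda>z. K (snd z, fst z)) \<in> smooth_functions (prod_atlas B A)"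
proof -
  note cA = open_manifold_charted[OF A] and cB = open_manifold_charted[OF B]
  show ?thesis
    by (rule smooth_functions_compose[OF charted_prod[OF cB cA] charted_prod[OF cA cB]
          smooth_map_Pair[OF charted_prod[OF cB cA] cA cB smooth_map_snd[OF B A] smooth_map_fst[OF B A]] K])
qed

text \<open>Symmetry of mixed second derivatives. On a group it makes left invariant and right
  invariant fields commute.\<close>

lemma tangent_commute:
  assumes A: "open_manifold A" and B: "open_manifold B" and K: "K \<in> smooth_functions (prod_atlas A B)"
    and u: "u \<in> tangent_space A p" and v: "v \<in> tangent_space B q"
  shows "u (\<lambda>x. v (\<lambda>y. K (x, y))) = v (\<lambda>y. u (\<lambda>x. K (x, y)))"
proof -
  note cA = open_manifold_charted[OF A] and cB = open_manifold_charted[OF B]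
  obtain U c where Uc: "(U, c) \<in> A" "p \<in> U" using charted_at[OF cA] by blast
  obtain V d where Vd: "(V, d) \<in> B" "q \<in> V" using charted_at[OF cB] by blast
  obtain a where a: "\<And>f. f \<in> smooth_functions A \<Longrightarrow> u f = chart_deriv U c f p a"
    using tangent_in_chart[OF A Uc u] by blast
  obtain b where b: "\<And>f. f \<in> smooth_functions B \<Longrightarrow> v f = chart_deriv V d f q b"
    using tangent_in_chart[OF B Vd v] by blast
  let ?K = "\<lambda>z. K (inv_into U c (fst z), inv_into V d (snd z))"
  have sv: "(\<lambda>x. v (\<lambda>y. K (x, y))) \<in> smooth_functions A"
    by (rule smooth_partial_const[OF A B v K])
  have su: "(\<lambda>y. u (\<lambda>x. K (x, y))) \<in> smooth_functions B"
    using smooth_partial_const[OF B A u smooth_swap[OF A B K]] by simp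
  have "u (\<lambda>x. v (\<lambda>y. K (x, y))) =
      frechet_derivative (\<lambda>z. frechet_derivative ?K (at z) (0, b)) (at (c p, d q)) (a, 0)"
    unfolding a[OF sv]
    by (rule chart_deriv_deriv_snd[OF A B K Uc(1) Vd(1) Uc(2) Vd(2)])
      (use b[OF smooth_slice(1)[OF A B K]] chart_deriv_snd[OF A B K Uc(1) Vd(1) _ Vd(2)] in simp)
  also have "\<dots> = frechet_derivative (\<lambda>z. frechet_derivative ?K (at z) (a, 0)) (at (c p, d q)) (0, b)"
    by (rule second_derivative_symmetric[OF K_chart_open[OF A B K Uc(1) Vd(1)] _ K_chart_smooth[OF A B K Uc(1) Vd(1)]])
      (use Uc Vd in auto)
  also have "\<dots> = v (\<lambda>y. u (\<lambda>x. K (x, y)))"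
    unfolding b[OF su]
    by (rule chart_deriv_deriv_fst[OF A B K Uc(1) Vd(1) Uc(2) Vd(2), symmetric])
      (use a[OF smooth_slice(2)[OF A B K]] chart_deriv_fst[OF A B K Uc(1) Vd(1) Uc(2)] in simp)
  finally show ?thesis .
qed

text \<open>On a ball in a chart the derivative vanishes, so the function is locally constant;
  connectedness does the rest. This is how information on the Lie algebra is carried over to the
  whole group.\<close>

lemma tangent_zero_imp_const:
  fixes A :: "('m::{t2_space,second_countable_topology}, 'e::euclidean_space) atlas"
  assumes A: "open_manifold A" and conn: "connected (UNIV :: 'm set)" and f: "f \<in> smooth_functions A"
    and 0: "\<And>p v. v \<in> tangent_space A p \<Longrightarrow> v f = 0"
  shows "f p = f q"
proof (rule connected_local_const[OF conn UNIV_I UNIV_I], intro ballI)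
  note cA = open_manifold_charted[OF A]
  fix p :: 'm
  obtain U c where Uc: "(U, c) \<in> A" "p \<in> U" using charted_at[OF cA] by blast
  obtain r where r: "r > 0" "ball (c p) r \<subseteq> c ` U"
    using chart_open(2)[OF cA Uc(1)] Uc(2) open_contains_ball by blast
  have D: "((\<lambda>x. f (inv_into U c x)) has_derivative (\<lambda>_. 0)) (at x within ball (c p) r)"
    if x: "x \<in> ball (c p) r" for x
  proof -
    obtain q where q: "q \<in> U" "x = c q" using x r by auto
    have "chart_deriv U c f q b = 0" for b
      using 0[OF chart_vector_in[OF cA Uc(1) q(1), of b]] f by (simp add: chart_vector_def)
    then have "chart_deriv U c f q = (\<lambda>_. 0)" by blast
    then show ?thesis
      using chart_has_derivative[OF cA Uc(1) q(1) f] q(2) by (simp add: has_derivative_at_withinI)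
  qed
  have eq: "f q = f p" if "q \<in> U \<inter> c -` ball (c p) r" for q
    using has_derivative_zero_constant[OF convex_ball D] that r(1) chart_inv[OF cA Uc(1)] Uc(2)
    by (metis Int_iff centre_in_ball vimageE)
  have "open (U \<inter> c -` ball (c p) r)" "p \<in> U \<inter> c -` ball (c p) r"
    using chart_vimage_open[OF cA Uc(1)] Uc(2) r(1) by auto
  then show "eventually (\<lambda>b. f p = f b) (at p within UNIV)"
    unfolding eventually_at_topological using eq by (metis UNIV_I)
qed

section \<open>Vector-valued smooth functions\<close>

lemma scaleR_fun_apply: "(a *\<^sub>R f) x = a *\<^sub>R f x"
  by (simp add: scaleR_fun_def)

lemma fscale_apply: "fscale f V p = f p *\<^sub>R V p"
  by (simp add: fscale_def)

text \<open>Testing against all vectors rather than basis vectors lets smoothness be used for inner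
  products with any fixed vector.\<close>

definition smooth_vec :: "('m, 'e::euclidean_space) atlas \<Rightarrow> ('m \<Rightarrow> 'f::euclidean_space) \<Rightarrow> bool" where
  "smooth_vec A z \<longleftrightarrow> (\<forall>k. (\<lambda>p. z p \<bullet> k) \<in> smooth_functions A)"

definition tangent_vec :: "'m tvec \<Rightarrow> ('m \<Rightarrow> 'f::euclidean_space) \<Rightarrow> 'f" where
  "tangent_vec v z = (\<Sum>k\<in>Basis. v (\<lambda>p. z p \<bullet> k) *\<^sub>R k)"

lemma smooth_vecD: "smooth_vec A z \<Longrightarrow> (\<lambda>p. z p \<bullet> k) \<in> smooth_functions A"
  unfolding smooth_vec_def by blast

lemma smooth_vec_const: "charted A \<Longrightarrow> smooth_vec A (\<lambda>_. a)"
  by (simp add: smooth_vec_def smooth_functions_const)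

lemma smooth_vec_add: "charted A \<Longrightarrow> smooth_vec A z \<Longrightarrow> smooth_vec A w \<Longrightarrow> smooth_vec A (\<lambda>p. z p + w p)"
  by (simp add: smooth_vec_def inner_add_left smooth_functions_add)

lemma smooth_vec_scale:
  "charted A \<Longrightarrow> f \<in> smooth_functions A \<Longrightarrow> smooth_vec A z \<Longrightarrow> smooth_vec A (\<lambda>p. f p *\<^sub>R z p)"
  by (simp add: smooth_vec_def inner_scaleR_left smooth_functions_mult)

lemma smooth_vec_sum:
  "charted A \<Longrightarrow> (\<And>i. i \<in> I \<Longrightarrow> smooth_vec A (z i)) \<Longrightarrow> smooth_vec A (\<lambda>p. \<Sum>i\<in>I. z i p)"
  by (simp add: smooth_vec_def inner_sum_left smooth_functions_sum)

lemma smooth_vec_diff: "charted A \<Longrightarrow> smooth_vec A z \<Longrightarrow> smooth_vec A w \<Longrightarrow> smooth_vec A (\<lambda>p. z p - w p)"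
  by (simp add: smooth_vec_def inner_diff_left smooth_functions_diff)

lemma smooth_vec_linear:
  assumes "charted A" "linear L" "smooth_vec A z"
  shows "smooth_vec A (\<lambda>p. L (z p))"
proof -
  have "smooth_vec A (\<lambda>p. \<Sum>i\<in>Basis. (z p \<bullet> i) *\<^sub>R L i)"
    by (intro smooth_vec_sum[OF assms(1)] smooth_vec_scale[OF assms(1)] smooth_vec_const[OF assms(1)] smooth_vecD[OF assms(3)])
  moreover have "(\<lambda>p. \<Sum>i\<in>Basis. (z p \<bullet> i) *\<^sub>R L i) = (\<lambda>p. L (z p))"
    by (intro ext linear_euclidean_expand[OF assms(2), symmetric])
  ultimately show ?thesis by simp
qed

lemma smooth_vec_bilinear:
  assumes "charted A" "bilinear \<beta>" "smooth_vec A z" "smooth_vec A w"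
  shows "smooth_vec A (\<lambda>p. \<beta> (z p) (w p))"
proof -
  have "smooth_vec A (\<lambda>p. \<Sum>i\<in>Basis. (z p \<bullet> i) *\<^sub>R \<beta> i (w p))"
  proof (intro smooth_vec_sum[OF assms(1)] smooth_vec_scale[OF assms(1)] smooth_vecD[OF assms(3)])
    show "smooth_vec A (\<lambda>p. \<beta> i (w p))" for i
      using assms(2) by (intro smooth_vec_linear[OF assms(1) _ assms(4)]) (auto simp: bilinear_def)
  qed
  moreover have "(\<lambda>p. \<Sum>i\<in>Basis. (z p \<bullet> i) *\<^sub>R \<beta> i (w p)) = (\<lambda>p. \<beta> (z p) (w p))"
    using assms(2) by (intro ext linear_euclidean_expand[symmetric]) (auto simp: bilinear_def)
  ultimately show ?thesis by simp
qed

context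
  fixes A :: "('m::topological_space, 'e::euclidean_space) atlas" and v p
  assumes A: "charted A" and v: "v \<in> tangent_space A p"
begin

lemma inner_tangent_vec:
  assumes "smooth_vec A z"
  shows "tangent_vec v z \<bullet> k = v (\<lambda>p. z p \<bullet> k)"
proof -
  have "v (\<lambda>p. z p \<bullet> k) = v (\<lambda>p. \<Sum>i\<in>Basis. (k \<bullet> i) * (z p \<bullet> i))"
    by (simp add: euclidean_inner[of _ k] mult.commute)
  also have "\<dots> = (\<Sum>i\<in>Basis. (k \<bullet> i) * v (\<lambda>p. z p \<bullet> i))"
    using smooth_vecD[OF assms]
    by (simp add: tangent_sum[OF A v] tangent_space_scale[OF v] smooth_functions_mult[OF A smooth_functions_const[OF A]])
  also have "\<dots> = tangent_vec v z \<bullet> k"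
    unfolding tangent_vec_def inner_sum_left by (simp add: inner_commute[of k] mult.commute)
  finally show ?thesis by simp
qed

lemma tangent_vec_const: "tangent_vec v (\<lambda>_. a) = 0"
  by (simp add: tangent_vec_def tangent_const[OF A v])

lemma tangent_vec_add:
  assumes "smooth_vec A z" "smooth_vec A w"
  shows "tangent_vec v (\<lambda>p. z p + w p) = tangent_vec v z + tangent_vec v w"
  using smooth_vecD[OF assms(1)] smooth_vecD[OF assms(2)]
  by (simp add: tangent_vec_def inner_add_left tangent_spaceD(1)[OF v] scaleR_add_left sum.distrib)

lemma tangent_vec_scale:
  assumes "f \<in> smooth_functions A" "smooth_vec A z"
  shows "tangent_vec v (\<lambda>p. f p *\<^sub>R z p) = v f *\<^sub>R z p + f p *\<^sub>R tangent_vec v z"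
proof (rule euclidean_eqI)
  fix k
  have "tangent_vec v (\<lambda>p. f p *\<^sub>R z p) \<bullet> k = v (\<lambda>p. f p * (z p \<bullet> k))"
    using inner_tangent_vec[OF smooth_vec_scale[OF A assms]] by simp
  then show "tangent_vec v (\<lambda>p. f p *\<^sub>R z p) \<bullet> k = (v f *\<^sub>R z p + f p *\<^sub>R tangent_vec v z) \<bullet> k"
    using tangent_spaceD(2)[OF v assms(1) smooth_vecD[OF assms(2), of k]]
    by (simp add: inner_add_left inner_tangent_vec[OF assms(2)])
qed

lemma tangent_vec_sum:
  assumes "\<And>i. i \<in> I \<Longrightarrow> smooth_vec A (z i)"
  shows "tangent_vec v (\<lambda>p. \<Sum>i\<in>I. z i p) = (\<Sum>i\<in>I. tangent_vec v (z i))"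
  using assms
  by (induction I rule: infinite_finite_induct)
    (simp_all add: tangent_vec_const tangent_vec_add smooth_vec_sum[OF A])

lemma tangent_vec_linear:
  assumes "linear L" "smooth_vec A z"
  shows "tangent_vec v (\<lambda>p. L (z p)) = L (tangent_vec v z)"
proof -
  have "tangent_vec v (\<lambda>p. L (z p)) = tangent_vec v (\<lambda>p. \<Sum>i\<in>Basis. (z p \<bullet> i) *\<^sub>R L i)"
    by (rule arg_cong[of _ _ "tangent_vec v"], rule ext, rule linear_euclidean_expand[OF assms(1)])
  also have "\<dots> = (\<Sum>i\<in>Basis. (tangent_vec v z \<bullet> i) *\<^sub>R L i)"
    by (simp add: tangent_vec_sum smooth_vec_scale[OF A] smooth_vecD[OF assms(2)] smooth_vec_const[OF A]
        tangent_vec_scale tangent_vec_const inner_tangent_vec[OF assms(2)])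
  also have "\<dots> = L (tangent_vec v z)"
    by (rule linear_euclidean_expand[OF assms(1), symmetric])
  finally show ?thesis .
qed

lemma tangent_vec_bilinear:
  assumes "bilinear \<beta>" "smooth_vec A z" "smooth_vec A w"
  shows "tangent_vec v (\<lambda>p. \<beta> (z p) (w p)) = \<beta> (tangent_vec v z) (w p) + \<beta> (z p) (tangent_vec v w)"
proof -
  have lin: "linear (\<beta> i)" "linear (\<lambda>x. \<beta> x y)" for i y using assms(1) by (auto simp: bilinear_def)
  have ex: "\<beta> x y = (\<Sum>i\<in>Basis. (x \<bullet> i) *\<^sub>R \<beta> i y)" for x y
    by (rule linear_euclidean_expand[OF lin(2)])
  have "tangent_vec v (\<lambda>p. \<beta> (z p) (w p)) = tangent_vec v (\<lambda>p. \<Sum>i\<in>Basis. (z p \<bullet> i) *\<^sub>R \<beta> i (w p))"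
    by (rule arg_cong[of _ _ "tangent_vec v"], rule ext, rule ex)
  also have "\<dots> = (\<Sum>i\<in>Basis. (tangent_vec v z \<bullet> i) *\<^sub>R \<beta> i (w p)) + (\<Sum>i\<in>Basis. (z p \<bullet> i) *\<^sub>R \<beta> i (tangent_vec v w))"
    using assms(2,3)
    by (simp add: tangent_vec_sum smooth_vec_scale[OF A] smooth_vecD smooth_vec_linear[OF A lin(1)]
        tangent_vec_scale tangent_vec_linear[OF lin(1)] inner_tangent_vec sum.distrib)
  finally show ?thesis using ex[of "tangent_vec v z"] ex[of "z p" "tangent_vec v w"] by metis
qed

lemma tangent_inner:
  assumes "smooth_vec A z" "smooth_vec A w"
  shows "v (\<lambda>p. z p \<bullet> w p) = tangent_vec v z \<bullet> w p + z p \<bullet> tangent_vec v w"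
proof -
  have "v (\<lambda>p. z p \<bullet> w p) = v (\<lambda>p. \<Sum>i\<in>Basis. (z p \<bullet> i) * (w p \<bullet> i))"
    by (rule arg_cong[of _ _ v], rule ext, rule euclidean_inner)
  also have "\<dots> = (\<Sum>i\<in>Basis. (tangent_vec v z \<bullet> i) * (w p \<bullet> i) + (z p \<bullet> i) * (tangent_vec v w \<bullet> i))"
    using smooth_vecD[OF assms(1)] smooth_vecD[OF assms(2)]
    by (simp add: tangent_sum[OF A v] smooth_functions_mult[OF A] tangent_spaceD(2)[OF v]
        inner_tangent_vec[OF assms(1)] inner_tangent_vec[OF assms(2)])
  finally show ?thesis
    by (simp only: sum.distrib euclidean_inner[symmetric])
qed

end

lemma tangent_vec_add_left: "tangent_vec (u + v) z = tangent_vec u z + tangent_vec v z"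
  by (simp add: tangent_vec_def scaleR_add_left sum.distrib)

lemma tangent_vec_scale_left: "tangent_vec (a *\<^sub>R v) z = a *\<^sub>R tangent_vec v z"
  by (simp add: tangent_vec_def scaleR_fun_def scaleR_sum_right)

lemma pushforward_add: "pushforward B \<phi> (u + v) = pushforward B \<phi> u + pushforward B \<phi> v"
  by (auto simp: pushforward_def fun_eq_iff)

lemma pushforward_scale: "pushforward B \<phi> (a *\<^sub>R v) = a *\<^sub>R pushforward B \<phi> v"
  by (auto simp: pushforward_def fun_eq_iff scaleR_fun_def)

lemma linear_pushforward: "linear (pushforward B \<phi>)"
  by (rule linearI) (simp_all add: pushforward_add pushforward_scale)

lemma pushforward_in:
  assumes A: "charted A" and B: "charted B" and \<phi>: "smooth_map A B \<phi>" and v: "v \<in> tangent_space A p"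
  shows "pushforward B \<phi> v \<in> tangent_space B (\<phi> p)"
proof (rule tangent_spaceI)
  note C = smooth_functions_compose[OF A B \<phi>]
  fix f h a assume f: "f \<in> smooth_functions B"
  show "pushforward B \<phi> v (\<lambda>x. a * f x) = a * pushforward B \<phi> v f"
    using f smooth_functions_mult[OF B smooth_functions_const[OF B] f] tangent_space_scale[OF v C[OF f]]
    by (simp add: pushforward_def o_def)
  assume h: "h \<in> smooth_functions B"
  show "pushforward B \<phi> v (\<lambda>x. f x + h x) = pushforward B \<phi> v f + pushforward B \<phi> v h"
    using f h smooth_functions_add[OF B f h] tangent_spaceD(1)[OF v C[OF f] C[OF h]]
    by (simp add: pushforward_def o_def)
  show "pushforward B \<phi> v (\<lambda>x. f x * h x) = pushforward B \<phi> v f * h (\<phi> p) + f (\<phi> p) * pushforward B \<phi> v h"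
    using f h smooth_functions_mult[OF B f h] tangent_spaceD(2)[OF v C[OF f] C[OF h]]
    by (simp add: pushforward_def o_def)
qed (simp add: pushforward_def)

lemma pushforward_field:
  assumes A: "charted A" and B: "charted B" and \<phi>: "smooth_map A B \<phi>" and X: "X \<in> vector_fields A"
  shows "(\<lambda>p. pushforward B \<phi> (X p)) \<in> fields_along A B \<phi>"
proof -
  have X': "X p \<in> tangent_space A p" "f \<in> smooth_functions A \<Longrightarrow> (\<lambda>p. X p f) \<in> smooth_functions A" for p f
    using X by (auto simp: vector_fields_def fields_along_def)
  then show ?thesis
    using pushforward_in[OF A B \<phi>] smooth_functions_compose[OF A B \<phi>]
    by (auto simp: fields_along_def pushforward_def o_def)
qed

lemma vector_fieldsD:
  "X \<in> vector_fields A \<Longrightarrow> X p \<in> tangent_space A p"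
  "X \<in> vector_fields A \<Longrightarrow> f \<in> smooth_functions A \<Longrightarrow> (\<lambda>p. X p f) \<in> smooth_functions A"
  by (auto simp: vector_fields_def fields_along_def)

section \<open>Connections in an orthonormal frame with constant structure coefficients\<close>

text \<open>The abstract left invariant orthonormal frame: a vector of the Euclidean model labels a
  global field. The group is forgotten; isometry at every point and constant structure coefficients
  \<open>br\<close> determine the connection and the curvature.\<close>

locale framed =
  fixes B :: "('n::{t2_space,second_countable_topology}, 'f::euclidean_space) atlas"
    and h :: "'n metric" and \<Lambda> :: "'f \<Rightarrow> 'n \<Rightarrow> 'n tvec" and br :: "'f \<Rightarrow> 'f \<Rightarrow> 'f"
  assumes open_manifold: "open_manifold B"
    and riemannian: "riemannian_metric B h"
    and linear_frame: "linear (\<lambda>x. \<Lambda> x q)"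
    and range_frame: "range (\<lambda>x. \<Lambda> x q) = tangent_space B q"
    and frame_field: "\<Lambda> x \<in> vector_fields B"
    and frame_inner: "h q (\<Lambda> x q) (\<Lambda> y q) = x \<bullet> y"
    and frame_bracket: "bracket (\<Lambda> x) (\<Lambda> y) = \<Lambda> (br x y)"
begin

lemma charted: "charted B" by (rule open_manifold_charted[OF open_manifold])

lemma frame_in: "\<Lambda> x q \<in> tangent_space B q" using range_frame by blast

definition coframe :: "'n \<Rightarrow> 'n tvec \<Rightarrow> 'f" where
  "coframe q v = (\<Sum>k\<in>Basis. h q v (\<Lambda> k q) *\<^sub>R k)"

lemma coframe_frame [simp]: "coframe q (\<Lambda> x q) = x"
  by (simp add: coframe_def frame_inner euclidean_representation)

lemma frame_coframe: "v \<in> tangent_space B q \<Longrightarrow> \<Lambda> (coframe q v) q = v"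
proof -
  assume "v \<in> tangent_space B q"
  then obtain x where "v = \<Lambda> x q" using range_frame by blast
  then show ?thesis by simp
qed

lemma frame_eq_iff: "\<Lambda> x q = \<Lambda> y q \<longleftrightarrow> x = y"
  by (metis coframe_frame)

lemma frame_zero_iff: "\<Lambda> x q = 0 \<longleftrightarrow> x = 0"
  using frame_eq_iff[of x q 0] linear_0[OF linear_frame] by simp

lemma coframe_add: "u \<in> tangent_space B q \<Longrightarrow> v \<in> tangent_space B q \<Longrightarrow> coframe q (u + v) = coframe q u + coframe q v"
  by (metis frame_coframe coframe_frame linear_add[OF linear_frame])

lemma coframe_scale: "v \<in> tangent_space B q \<Longrightarrow> coframe q (a *\<^sub>R v) = a *\<^sub>R coframe q v"
  by (metis frame_coframe coframe_frame linear_scale[OF linear_frame])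

lemma coframe_inner: "v \<in> tangent_space B q \<Longrightarrow> h q v (\<Lambda> k q) = coframe q v \<bullet> k"
  by (metis frame_coframe frame_inner)

lemma frame_eqI:
  assumes "v \<in> tangent_space B q" "\<And>f. f \<in> smooth_functions B \<Longrightarrow> v f = \<Lambda> x q f"
  shows "v = \<Lambda> x q"
  using assms tangent_space_not_smooth[OF assms(1)] tangent_space_not_smooth[OF frame_in]
  by (metis ext)

lemma frame_apply_linear:
  "\<Lambda> (x + y) q f = \<Lambda> x q f + \<Lambda> y q f" "\<Lambda> (a *\<^sub>R x) q f = a * \<Lambda> x q f"
  "\<Lambda> (x - y) q f = \<Lambda> x q f - \<Lambda> y q f" "\<Lambda> 0 q f = 0"
  using linear_add[OF linear_frame, of x y q] linear_scale[OF linear_frame, of a x q]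
    linear_diff[OF linear_frame, of x y q] linear_0[OF linear_frame, of q]
  by (simp_all add: scaleR_fun_def)

lemma frame_apply_expand: "\<Lambda> x q f = (\<Sum>k\<in>Basis. (x \<bullet> k) * \<Lambda> k q f)"
proof -
  have "linear (\<lambda>x. \<Lambda> x q f)"
    by (rule linearI) (simp_all add: frame_apply_linear)
  from linear_euclidean_expand[OF this, of x] show ?thesis by (simp only: real_scaleR_def)
qed

lemma frame_apply_smooth: "f \<in> smooth_functions B \<Longrightarrow> (\<lambda>q. \<Lambda> x q f) \<in> smooth_functions B"
  using vector_fieldsD(2)[OF frame_field] .

lemma bracket_apply: "\<Lambda> (br x y) q f = \<Lambda> x q (\<lambda>q. \<Lambda> y q f) - \<Lambda> y q (\<lambda>q. \<Lambda> x q f)"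
  by (simp flip: frame_bracket add: bracket_def)

text \<open>The Lie algebra identities of \<open>br\<close> are not axioms of the locale. They are
  inherited from commutators of derivations, since the label of a frame field is determined by its
  value at any point.\<close>

lemma br_skew: "br x y = - br y x"
proof -
  have "\<Lambda> (br x y) q = \<Lambda> (- br y x) q" for q
    by (rule frame_eqI[OF frame_in])
      (use frame_apply_linear(3)[of 0 "br y x"] in \<open>simp add: bracket_apply frame_apply_linear(4)\<close>)
  then show ?thesis by (simp add: frame_eq_iff)
qed

lemma br_self: "br x x = 0"
proof -
  have "2 *\<^sub>R br x x = 0" using br_skew[of x x] by (metis ab_left_minus scaleR_2)
  then show ?thesis by simp
qed

lemma br_add: "br (x + y) z = br x z + br y z"
proof -
  have "\<Lambda> (br (x + y) z) q = \<Lambda> (br x z + br y z) q" for q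
    by (rule frame_eqI[OF frame_in])
      (simp add: bracket_apply frame_apply_linear tangent_spaceD(1)[OF frame_in] frame_apply_smooth)
  then show ?thesis by (simp add: frame_eq_iff)
qed

lemma br_scale: "br (a *\<^sub>R x) z = a *\<^sub>R br x z"
proof -
  have "\<Lambda> (br (a *\<^sub>R x) z) q = \<Lambda> (a *\<^sub>R br x z) q" for q
    by (rule frame_eqI[OF frame_in])
      (simp add: bracket_apply frame_apply_linear tangent_space_scale[OF frame_in] frame_apply_smooth algebra_simps)
  then show ?thesis by (simp add: frame_eq_iff)
qed

lemma bilinear_br: "bilinear br"
  unfolding bilinear_def
proof (intro conjI allI linearI)
  show "br z (x + y) = br z x + br z y" for x y z
    using br_add[of x y z] br_skew[of z] by (simp add: br_skew[of z x] br_skew[of z y])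
  show "br z (a *\<^sub>R x) = a *\<^sub>R br z x" for a x z
    using br_scale[of a x z] br_skew[of z "a *\<^sub>R x"] br_skew[of z x] by simp
qed (simp_all add: br_add br_scale)

lemma br_jacobi: "br x (br y z) = br (br x y) z + br y (br x z)"
proof -
  have "\<Lambda> (br x (br y z)) q f = \<Lambda> (br (br x y) z + br y (br x z)) q f" if "f \<in> smooth_functions B" for q f
    using that by (simp add: bracket_apply frame_apply_linear tangent_diff[OF charted frame_in] frame_apply_smooth)
  then have "\<Lambda> (br x (br y z)) q = \<Lambda> (br (br x y) z + br y (br x z)) q" for q
    by (rule frame_eqI[OF frame_in])
  then show ?thesis by (simp add: frame_eq_iff)
qed

text \<open>Koszul's formula for left invariant fields.\<close>

definition lc :: "'f \<Rightarrow> 'f \<Rightarrow> 'f" where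
  "lc x y = (\<Sum>k\<in>Basis. ((br x y \<bullet> k - br y k \<bullet> x + br k x \<bullet> y) / 2) *\<^sub>R k)"

lemma inner_lc: "lc x y \<bullet> z = (br x y \<bullet> z - br y z \<bullet> x + br z x \<bullet> y) / 2"
proof -
  have lin: "linear (br u)" "linear (\<lambda>u. br u v)" for u v
    using bilinear_br by (auto simp: bilinear_def)
  have "linear (\<lambda>z. (br x y \<bullet> z - br y z \<bullet> x + br z x \<bullet> y) / 2)"
    by (rule linearI)
      (simp_all add: linear_add[OF lin(1)] linear_add[OF lin(2)] linear_scale[OF lin(1)] linear_scale[OF lin(2)]
        inner_add_left inner_add_right algebra_simps add_divide_distrib diff_divide_distrib)
  note ex = linear_euclidean_expand[OF this, of z]
  have "lc x y \<bullet> z = (\<Sum>k\<in>Basis. (br x y \<bullet> k - br y k \<bullet> x + br k x \<bullet> y) / 2 * (k \<bullet> z))"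
    unfolding lc_def inner_sum_left inner_scaleR_left ..
  also have "\<dots> = (\<Sum>k\<in>Basis. (z \<bullet> k) *\<^sub>R ((br x y \<bullet> k - br y k \<bullet> x + br k x \<bullet> y) / 2))"
    by (rule sum.cong) (simp_all add: inner_commute[of z])
  finally show ?thesis unfolding ex .
qed

lemma lc_torsion: "lc x y - lc y x = br x y"
proof (rule euclidean_eqI)
  fix b
  show "(lc x y - lc y x) \<bullet> b = br x y \<bullet> b"
    by (simp add: inner_diff_left inner_lc br_skew[of y x] br_skew[of b x] br_skew[of b y] field_simps)
qed

lemma lc_metric: "lc x y \<bullet> z = - (y \<bullet> lc x z)"
proof -
  have "lc x y \<bullet> z = - (lc x z \<bullet> y)"
    unfolding inner_lc br_skew[of z y] br_skew[of z x] br_skew[of y x] by (simp add: field_simps)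
  then show ?thesis by (simp add: inner_commute)
qed

lemma bilinear_lc: "bilinear lc"
proof -
  have lin: "linear (br u)" "linear (\<lambda>u. br u v)" for u v
    using bilinear_br by (auto simp: bilinear_def)
  note L = linear_add[OF lin(1)] linear_add[OF lin(2)] linear_scale[OF lin(1)] linear_scale[OF lin(2)]
  show ?thesis
    unfolding bilinear_def
    by (intro conjI allI linearI; rule euclidean_eqI)
      (simp_all add: L inner_lc inner_add_left inner_add_right algebra_simps add_divide_distrib diff_divide_distrib)
qed

lemma extension_in:
  assumes "v \<in> tangent_space B q"
  shows "extension B q v \<in> vector_fields B" "extension B q v q = v"
proof -
  have "\<exists>X. X \<in> vector_fields B \<and> X q = v"
    using frame_field frame_coframe[OF assms] by blast
  from someI_ex[OF this] show "extension B q v \<in> vector_fields B" "extension B q v q = v"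
    unfolding extension_def by auto
qed

section \<open>Connections along a map in frame coordinates\<close>

definition coef :: "('m \<Rightarrow> 'n) \<Rightarrow> ('m \<Rightarrow> 'n tvec) \<Rightarrow> 'm \<Rightarrow> 'f" where
  "coef \<phi> V = (\<lambda>p. coframe (\<phi> p) (V p))"

definition field :: "('m \<Rightarrow> 'n) \<Rightarrow> ('m \<Rightarrow> 'f) \<Rightarrow> 'm \<Rightarrow> 'n tvec" where
  "field \<phi> z = (\<lambda>p. \<Lambda> (z p) (\<phi> p))"

text \<open>One formula for two connections: the Levi-Civita connection for \<phi> =
  \<open>id\<close>, the pull-back connection in general.\<close>

definition conn :: "('m \<Rightarrow> 'n) \<Rightarrow> ('m \<Rightarrow> 'm tvec) \<Rightarrow> ('m \<Rightarrow> 'n tvec) \<Rightarrow> 'm \<Rightarrow> 'n tvec" where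
  "conn \<phi> X V = field \<phi> (\<lambda>p. tangent_vec (X p) (coef \<phi> V) +
     lc (coef \<phi> (\<lambda>p. pushforward B \<phi> (X p)) p) (coef \<phi> V p))"

lemma coef_field [simp]: "coef \<phi> (field \<phi> z) = z"
  by (simp add: coef_def field_def)

end

text \<open>A Riemannian metric is only required to be smooth on pairs of vector fields of the
  target, so smoothness of frame coefficients of fields along \<phi> is made an assumption. It is
  discharged by the metric for the identity, and by \<open>framed_map_lie\<close> for maps into a
  Lie group.\<close>

locale framed_map = framed B h \<Lambda> br
  for B :: "('n::{t2_space,second_countable_topology}, 'f::euclidean_space) atlas" and h \<Lambda> br +
  fixes A :: "('m::{t2_space,second_countable_topology}, 'e::euclidean_space) atlas" and \<phi> :: "'m \<Rightarrow> 'n"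
  assumes dom: "open_manifold A" and smooth: "smooth_map A B \<phi>"
    and coef_smooth: "V \<in> fields_along A B \<phi> \<Longrightarrow> (\<lambda>p. h (\<phi> p) (V p) (\<Lambda> k (\<phi> p))) \<in> smooth_functions A"
begin

lemma cA: "charted A" by (rule open_manifold_charted[OF dom])

lemma along_in: "V \<in> fields_along A B \<phi> \<Longrightarrow> V p \<in> tangent_space B (\<phi> p)"
  by (simp add: fields_along_def)

lemma smooth_coef: "V \<in> fields_along A B \<phi> \<Longrightarrow> smooth_vec A (coef \<phi> V)"
  unfolding smooth_vec_def coef_def using coef_smooth[of V] coframe_inner[OF along_in] by simp

lemma field_coef: "V \<in> fields_along A B \<phi> \<Longrightarrow> field \<phi> (coef \<phi> V) = V"
  unfolding field_def coef_def using frame_coframe[OF along_in] by simp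

lemma field_along:
  assumes "smooth_vec A z"
  shows "field \<phi> z \<in> fields_along A B \<phi>"
  unfolding fields_along_def field_def
proof (intro CollectI conjI allI ballI)
  fix f assume f: "f \<in> smooth_functions B"
  have "(\<lambda>p. \<Sum>k\<in>Basis. (z p \<bullet> k) * \<Lambda> k (\<phi> p) f) \<in> smooth_functions A"
    by (intro smooth_functions_sum[OF cA] smooth_functions_mult[OF cA] smooth_vecD[OF assms]
        smooth_functions_compose[OF cA charted smooth frame_apply_smooth[OF f]])
  then show "(\<lambda>p. \<Lambda> (z p) (\<phi> p) f) \<in> smooth_functions A"
    by (subst frame_apply_expand)
qed (rule frame_in)

lemma push_along: "X \<in> vector_fields A \<Longrightarrow> (\<lambda>p. pushforward B \<phi> (X p)) \<in> fields_along A B \<phi>"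
  by (rule pushforward_field[OF cA charted smooth])

lemma smooth_conn:
  assumes X: "X \<in> vector_fields A" and V: "V \<in> fields_along A B \<phi>"
  shows "smooth_vec A (\<lambda>p. tangent_vec (X p) (coef \<phi> V) +
     lc (coef \<phi> (\<lambda>p. pushforward B \<phi> (X p)) p) (coef \<phi> V p))"
proof (rule smooth_vec_add[OF cA])
  show "smooth_vec A (\<lambda>p. tangent_vec (X p) (coef \<phi> V))"
    unfolding smooth_vec_def
    using inner_tangent_vec[OF cA vector_fieldsD(1)[OF X] smooth_coef[OF V]]
      vector_fieldsD(2)[OF X smooth_vecD[OF smooth_coef[OF V]]] by simp
  show "smooth_vec A (\<lambda>p. lc (coef \<phi> (\<lambda>p. pushforward B \<phi> (X p)) p) (coef \<phi> V p))"
    by (intro smooth_vec_bilinear[OF cA bilinear_lc] smooth_coef push_along X V)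
qed

lemma fields_add: "V \<in> fields_along A B \<phi> \<Longrightarrow> W \<in> fields_along A B \<phi> \<Longrightarrow> V + W \<in> fields_along A B \<phi>"
  unfolding fields_along_def
  using subspace_add[OF subspace_tangent_space] smooth_functions_add[OF cA] by fastforce

lemma fields_scale: "f \<in> smooth_functions A \<Longrightarrow> V \<in> fields_along A B \<phi> \<Longrightarrow> fscale f V \<in> fields_along A B \<phi>"
  by (simp add: fields_along_def fscale_apply subspace_scale[OF subspace_tangent_space])
    (simp add: scaleR_fun_apply smooth_functions_mult[OF cA])

lemma coef_add: "V \<in> fields_along A B \<phi> \<Longrightarrow> W \<in> fields_along A B \<phi> \<Longrightarrow> coef \<phi> (V + W) = (\<lambda>p. coef \<phi> V p + coef \<phi> W p)"
  by (simp add: coef_def coframe_add along_in)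

lemma coef_scale: "V \<in> fields_along A B \<phi> \<Longrightarrow> coef \<phi> (fscale f V) = (\<lambda>p. f p *\<^sub>R coef \<phi> V p)"
  by (simp add: coef_def coframe_scale along_in fscale_def)

lemma connection_conn: "connection_along A B \<phi> (conn \<phi>)"
  unfolding connection_along_def
proof (intro ballI conjI)
  fix X V assume X: "X \<in> vector_fields A" and V: "V \<in> fields_along A B \<phi>"
  have lin: "linear (lc u)" "linear (\<lambda>u. lc u v)" for u v
    using bilinear_lc by (auto simp: bilinear_def)
  note L = linear_add[OF lin(1)] linear_add[OF lin(2)] linear_scale[OF lin(1)] linear_scale[OF lin(2)]
  note Xt = vector_fieldsD(1)[OF X]
  show "conn \<phi> X V \<in> fields_along A B \<phi>"
    unfolding conn_def by (intro field_along smooth_conn X V)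
  show "conn \<phi> (X + Y) V = conn \<phi> X V + conn \<phi> Y V" if Y: "Y \<in> vector_fields A" for Y
  proof -
    have "(\<lambda>p. pushforward B \<phi> ((X + Y) p)) = (\<lambda>p. pushforward B \<phi> (X p)) + (\<lambda>p. pushforward B \<phi> (Y p))"
      by (rule ext) (simp add: pushforward_add)
    then have "coef \<phi> (\<lambda>p. pushforward B \<phi> ((X + Y) p)) =
        (\<lambda>p. coef \<phi> (\<lambda>p. pushforward B \<phi> (X p)) p + coef \<phi> (\<lambda>p. pushforward B \<phi> (Y p)) p)"
      using coef_add[OF push_along[OF X] push_along[OF Y]] by simp
    then show ?thesis
      by (simp add: conn_def field_def fun_eq_iff L tangent_vec_add_left frame_apply_linear)
  qed
  show "conn \<phi> X (V + W) = conn \<phi> X V + conn \<phi> X W" if W: "W \<in> fields_along A B \<phi>" for W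
    using tangent_vec_add[OF cA Xt smooth_coef[OF V] smooth_coef[OF W]]
    by (simp add: conn_def field_def fun_eq_iff coef_add[OF V W] L frame_apply_linear)
  fix f assume f: "f \<in> smooth_functions A"
  have "coef \<phi> (\<lambda>p. pushforward B \<phi> (fscale f X p)) = (\<lambda>p. f p *\<^sub>R coef \<phi> (\<lambda>p. pushforward B \<phi> (X p)) p)"
    using coef_scale[OF push_along[OF X], of f] by (simp add: pushforward_scale fscale_def)
  then show "conn \<phi> (fscale f X) V = fscale f (conn \<phi> X V)"
    by (simp add: conn_def field_def fun_eq_iff fscale_apply L tangent_vec_scale_left frame_apply_linear
        scaleR_fun_apply algebra_simps)
  show "conn \<phi> X (fscale f V) = fscale (\<lambda>p. X p f) V + fscale f (conn \<phi> X V)"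
  proof (intro ext)
    fix p u
    have "V p u = \<Lambda> (coef \<phi> V p) (\<phi> p) u"
      using fun_cong[OF field_coef[OF V], of p] by (simp add: field_def)
    then show "conn \<phi> X (fscale f V) p u = (fscale (\<lambda>p. X p f) V + fscale f (conn \<phi> X V)) p u"
      using tangent_vec_scale[OF cA Xt f smooth_coef[OF V]]
      by (simp add: conn_def field_def coef_scale[OF V] L fscale_apply frame_apply_linear scaleR_fun_apply algebra_simps)
  qed
qed

text \<open>By additivity and the Leibniz rule a connection is determined by its values on the frame
  fields along \<phi>. This is the uniqueness needed to identify the connection picked by
  choice.\<close>

lemma connection_expand:
  assumes D: "connection_along A B \<phi> D" and X: "X \<in> vector_fields A" and V: "V \<in> fields_along A B \<phi>"
  shows "D X V = (\<lambda>p. \<Sum>k\<in>Basis. X p (\<lambda>p. coef \<phi> V p \<bullet> k) *\<^sub>R \<Lambda> k (\<phi> p) + (coef \<phi> V p \<bullet> k) *\<^sub>R D X (\<Lambda> k \<circ> \<phi>) p)"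
proof -
  have F: "\<Lambda> k \<circ> \<phi> \<in> fields_along A B \<phi>" for k
    using field_along[OF smooth_vec_const[OF cA, of k]] by (simp add: field_def o_def)
  have D': "D X (V + W) = D X V + D X W" "D X (fscale f V) = fscale (\<lambda>p. X p f) V + fscale f (D X V)"
    if "V \<in> fields_along A B \<phi>" "W \<in> fields_along A B \<phi>" "f \<in> smooth_functions A" for V W f
    using D X that unfolding connection_along_def by blast+
  note cs = smooth_vecD[OF smooth_coef[OF V]]
  have zero: "0 \<in> fields_along A B \<phi>"
    using field_along[OF smooth_vec_const[OF cA, of 0]] linear_0[OF linear_frame] by (simp add: field_def zero_fun_def)
  \<comment> \<open>Additivity is available only for sections, hence membership in
    \<open>fields_along\<close> is carried through the induction over partial sums.\<close>
  have "(\<lambda>p. \<Sum>k\<in>I. (coef \<phi> V p \<bullet> k) *\<^sub>R \<Lambda> k (\<phi> p)) \<in> fields_along A B \<phi> \<and>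
     D X (\<lambda>p. \<Sum>k\<in>I. (coef \<phi> V p \<bullet> k) *\<^sub>R \<Lambda> k (\<phi> p)) =
     (\<lambda>p. \<Sum>k\<in>I. X p (\<lambda>p. coef \<phi> V p \<bullet> k) *\<^sub>R \<Lambda> k (\<phi> p) + (coef \<phi> V p \<bullet> k) *\<^sub>R D X (\<Lambda> k \<circ> \<phi>) p)"
    if "finite I" for I
    using that
  proof (induction I)
    case empty
    have "fscale (\<lambda>_. 0) V = 0" for V :: "'m \<Rightarrow> 'n tvec"
      by (rule ext) (simp add: fscale_apply)
    then have "D X 0 = fscale (\<lambda>p. X p (\<lambda>_. 0)) 0"
      using D'(2)[OF zero zero smooth_functions_const[OF cA, of 0]] by simp
    also have "\<dots> = 0" by (rule ext) (simp add: fscale_apply)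
    finally show ?case using zero by (simp add: zero_fun_def)
  next
    case (insert k I)
    let ?S = "\<lambda>p. \<Sum>k\<in>I. (coef \<phi> V p \<bullet> k) *\<^sub>R \<Lambda> k (\<phi> p)"
    let ?F = "fscale (\<lambda>p. coef \<phi> V p \<bullet> k) (\<Lambda> k \<circ> \<phi>)"
    have eq: "(\<lambda>p. \<Sum>k\<in>insert k I. (coef \<phi> V p \<bullet> k) *\<^sub>R \<Lambda> k (\<phi> p)) = ?F + ?S"
      using insert.hyps by (simp add: fscale_def plus_fun_def)
    have F': "?F \<in> fields_along A B \<phi>" by (rule fields_scale[OF cs F])
    have S: "?S \<in> fields_along A B \<phi>" using insert.IH by blast
    have "D X (?F + ?S) = (fscale (\<lambda>p. X p (\<lambda>p. coef \<phi> V p \<bullet> k)) (\<Lambda> k \<circ> \<phi>) +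
        fscale (\<lambda>p. coef \<phi> V p \<bullet> k) (D X (\<Lambda> k \<circ> \<phi>))) +
        (\<lambda>p. \<Sum>k\<in>I. X p (\<lambda>p. coef \<phi> V p \<bullet> k) *\<^sub>R \<Lambda> k (\<phi> p) + (coef \<phi> V p \<bullet> k) *\<^sub>R D X (\<Lambda> k \<circ> \<phi>) p)"
      unfolding D'(1)[OF F' S cs] D'(2)[OF F F cs] conjunct2[OF insert.IH] ..
    also have "\<dots> = (\<lambda>p. \<Sum>k\<in>insert k I. X p (\<lambda>p. coef \<phi> V p \<bullet> k) *\<^sub>R \<Lambda> k (\<phi> p) + (coef \<phi> V p \<bullet> k) *\<^sub>R D X (\<Lambda> k \<circ> \<phi>) p)"
      by (rule ext) (simp add: insert.hyps fscale_apply)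
    finally have "D X (?F + ?S) = \<dots>" .
    with fields_add[OF F' S] show ?case unfolding eq by (rule conjI)
  qed
  note DI = conjunct2[OF this[OF finite_Basis]]
  have "V = (\<lambda>p. \<Sum>k\<in>Basis. (coef \<phi> V p \<bullet> k) *\<^sub>R \<Lambda> k (\<phi> p))"
  proof
    fix p
    have "V p = \<Lambda> (coef \<phi> V p) (\<phi> p)" using fun_cong[OF field_coef[OF V], of p] by (simp add: field_def)
    then show "V p = (\<Sum>k\<in>Basis. (coef \<phi> V p \<bullet> k) *\<^sub>R \<Lambda> k (\<phi> p))"
      using linear_euclidean_expand[OF linear_frame, of "coef \<phi> V p" "\<phi> p"] by simp
  qed
  from trans[OF arg_cong[OF this, of "D X"] DI] show ?thesis .
qed

end

section \<open>The Levi-Civita connection and its curvature\<close>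

context framed
begin

lemma framed_map_id: "framed_map B h \<Lambda> br B id"
proof
  show "smooth_map B B id" using smooth_map_id[OF open_manifold] by (simp add: id_def)
  show "(\<lambda>p. h (id p) (V p) (\<Lambda> k (id p))) \<in> smooth_functions B" if "V \<in> fields_along B B id" for V k
    using riemannian that frame_field by (auto simp: riemannian_metric_def vector_fields_def)
qed (rule open_manifold)

interpretation I: framed_map B h \<Lambda> br B id by (rule framed_map_id)

lemma along_id: "fields_along B B id = vector_fields B" by (simp add: vector_fields_def)

lemma pushforward_id: "v \<in> tangent_space B q \<Longrightarrow> pushforward B id v = v"
  using tangent_space_not_smooth by (fastforce simp: pushforward_def)

lemma conn_id:
  assumes "X \<in> vector_fields B"
  shows "conn id X Y p = \<Lambda> (tangent_vec (X p) (coef id Y) + lc (coef id X p) (coef id Y p)) p"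
  using pushforward_id[OF vector_fieldsD(1)[OF assms]] by (simp add: conn_def field_def)

lemma vector_eq_frame: "X \<in> vector_fields B \<Longrightarrow> X p = \<Lambda> (coef id X p) p"
  using fun_cong[OF I.field_coef, of X p] by (simp add: along_id field_def)

lemma bracket_frame:
  assumes X: "X \<in> vector_fields B" and Y: "Y \<in> vector_fields B"
  shows "bracket X Y p = \<Lambda> (tangent_vec (X p) (coef id Y) - tangent_vec (Y p) (coef id X) +
    br (coef id X p) (coef id Y p)) p" (is "_ = \<Lambda> ?z p")
proof
  fix f
  \<comment> \<open>The Leibniz rule for \<open>Y\<close> expanded in the frame: \<open>v\<close>
    hits either the coefficients or the frame fields. In the commutator the second kind of terms
    combines to \<open>br\<close>.\<close>
  have *: "v (\<lambda>q. Y q f) = \<Lambda> (tangent_vec v (coef id Y)) p f + v (\<lambda>q. \<Lambda> (coef id Y p) q f)"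
    if v: "v \<in> tangent_space B p" and Y: "Y \<in> vector_fields B" and f: "f \<in> smooth_functions B" for v Y
  proof -
    have sY: "smooth_vec B (coef id Y)" using I.smooth_coef Y by (simp add: along_id)
    note cs = smooth_vecD[OF sY]
    have "v (\<lambda>q. Y q f) = v (\<lambda>q. \<Sum>k\<in>Basis. (coef id Y q \<bullet> k) * \<Lambda> k q f)"
      by (simp add: vector_eq_frame[OF Y] flip: frame_apply_expand)
    also have "\<dots> = (\<Sum>k\<in>Basis. v (\<lambda>q. coef id Y q \<bullet> k) * \<Lambda> k p f + (coef id Y p \<bullet> k) * v (\<lambda>q. \<Lambda> k q f))"
      by (simp add: tangent_sum[OF charted v] smooth_functions_mult[OF charted] cs frame_apply_smooth[OF f]
          tangent_spaceD(2)[OF v])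
    finally have 1: "v (\<lambda>q. Y q f) = (\<Sum>k\<in>Basis. v (\<lambda>q. coef id Y q \<bullet> k) * \<Lambda> k p f) +
        (\<Sum>k\<in>Basis. (coef id Y p \<bullet> k) * v (\<lambda>q. \<Lambda> k q f))"
      by (simp add: sum.distrib)
    have 2: "(\<Sum>k\<in>Basis. (coef id Y p \<bullet> k) * v (\<lambda>q. \<Lambda> k q f)) = v (\<lambda>q. \<Sum>k\<in>Basis. (coef id Y p \<bullet> k) * \<Lambda> k q f)"
      by (simp add: tangent_sum[OF charted v] smooth_functions_mult[OF charted smooth_functions_const[OF charted]]
          frame_apply_smooth[OF f] tangent_space_scale[OF v])
    show ?thesis
      unfolding 1 2 by (simp only: inner_tangent_vec[OF charted v sY, symmetric] frame_apply_expand[symmetric])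
  qed
  show "bracket X Y p f = \<Lambda> ?z p f"
  proof (cases "f \<in> smooth_functions B")
    case True
    have "X p (\<lambda>q. \<Lambda> (coef id Y p) q f) - Y p (\<lambda>q. \<Lambda> (coef id X p) q f) = \<Lambda> (br (coef id X p) (coef id Y p)) p f"
      by (simp add: bracket_apply vector_eq_frame[OF X, of p] vector_eq_frame[OF Y, of p])
    then show ?thesis
      using *[OF vector_fieldsD(1)[OF X] Y True] *[OF vector_fieldsD(1)[OF Y] X True]
      by (simp add: bracket_def frame_apply_linear)
  next
    case False
    then have "X q f = 0" "Y q f = 0" "\<Lambda> z q f = 0" for q z
      using tangent_space_not_smooth[OF _ False] vector_fieldsD(1)[OF X] vector_fieldsD(1)[OF Y] frame_in by blast+
    then show ?thesis
      using tangent_const[OF charted vector_fieldsD(1)[OF X]] tangent_const[OF charted vector_fieldsD(1)[OF Y]]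
      by (simp add: bracket_def)
  qed
qed

lemma bracket_field:
  assumes X: "X \<in> vector_fields B" and Y: "Y \<in> vector_fields B"
  shows "bracket X Y \<in> vector_fields B"
proof -
  have s: "smooth_vec B (coef id X)" "smooth_vec B (coef id Y)"
    using I.smooth_coef X Y by (simp_all add: along_id)
  have t: "smooth_vec B (\<lambda>p. tangent_vec (X p) z)" if "X \<in> vector_fields B" "smooth_vec B z" for X and z :: "_ \<Rightarrow> 'f"
    unfolding smooth_vec_def
    using inner_tangent_vec[OF charted vector_fieldsD(1)[OF that(1)] that(2)]
      vector_fieldsD(2)[OF that(1) smooth_vecD[OF that(2)]] by simp
  have "smooth_vec B (\<lambda>p. tangent_vec (X p) (coef id Y) - tangent_vec (Y p) (coef id X) +
    br (coef id X p) (coef id Y p))"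
    by (intro smooth_vec_add[OF charted] smooth_vec_diff[OF charted] smooth_vec_bilinear[OF charted bilinear_br] t X Y s)
  from I.field_along[OF this] show ?thesis
    by (simp add: along_id field_def flip: bracket_frame[OF X Y])
qed

lemma levi_civita_conn: "is_levi_civita B h (conn id)"
  unfolding is_levi_civita_def
proof (intro conjI ballI allI I.connection_conn)
  fix X Y assume X: "X \<in> vector_fields B" and Y: "Y \<in> vector_fields B"
  show "conn id X Y - conn id Y X = bracket X Y"
    by (intro ext) (simp add: conn_id[OF X] conn_id[OF Y] bracket_frame[OF X Y]
        frame_apply_linear flip: lc_torsion)
  fix Z p assume Z: "Z \<in> vector_fields B"
  have s: "smooth_vec B (coef id Z)" "smooth_vec B (coef id Y)"
    using I.smooth_coef Z Y by (simp_all add: along_id)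
  have "h q (Y q) (Z q) = coef id Y q \<bullet> coef id Z q" for q
    using vector_eq_frame[OF Y, of q] vector_eq_frame[OF Z, of q] by (metis frame_inner)
  moreover have "h p (conn id X Y p) (Z p) = (tangent_vec (X p) (coef id Y) + lc (coef id X p) (coef id Y p)) \<bullet> coef id Z p"
    using vector_eq_frame[OF Z, of p] conn_id[OF X, of Y p] by (metis frame_inner)
  moreover have "h p (Y p) (conn id X Z p) = coef id Y p \<bullet> (tangent_vec (X p) (coef id Z) + lc (coef id X p) (coef id Z p))"
    using vector_eq_frame[OF Y, of p] conn_id[OF X, of Z p] by (metis frame_inner)
  ultimately show "X p (\<lambda>q. h q (Y q) (Z q)) = h p (conn id X Y p) (Z p) + h p (Y p) (conn id X Z p)"
    using tangent_inner[OF charted vector_fieldsD(1)[OF X] s(2,1)]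
    by (simp add: inner_add_left inner_add_right lc_metric)
qed

text \<open>The difference tensor \<open>?s\<close> is symmetric in its first two arguments, as both
  torsions vanish, and skew in the last two, as both connections are metric. Permuting the arguments
  cyclically then gives \<open>?s = - ?s\<close>.\<close>

lemma levi_civita_unique:
  assumes n: "is_levi_civita B h nabla" and X: "X \<in> vector_fields B" and Y: "Y \<in> vector_fields B"
  shows "nabla X Y = conn id X Y"
proof -
  let ?s = "\<lambda>X Y Z p. h p (nabla X Y p) (Z p) - h p (conn id X Y p) (Z p)"
  note m = levi_civita_conn
  have in_vf: "nabla X Y \<in> vector_fields B" "conn id X Y \<in> vector_fields B"
    if "X \<in> vector_fields B" "Y \<in> vector_fields B" for X Y
    using n m that unfolding is_levi_civita_def connection_along_def along_id by auto
  have hsub: "h p u w - h p v w = h p (u - v) w"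
    if "u \<in> tangent_space B p" "v \<in> tangent_space B p" "w \<in> tangent_space B p" for p u v w
    using riemannian that unfolding riemannian_metric_def
    by (metis (no_types, opaque_lifting) diff_conv_add_uminus mult_1 mult_minus1 scaleR_minus1_left scaleR_one)
  have sym: "?s X Y Z p = ?s Y X Z p"
    if "X \<in> vector_fields B" "Y \<in> vector_fields B" "Z \<in> vector_fields B" for X Y Z p
  proof -
    have "nabla X Y - nabla Y X = conn id X Y - conn id Y X"
      using n m that unfolding is_levi_civita_def by auto
    from fun_cong[OF this, of p] have "nabla X Y p - conn id X Y p = nabla Y X p - conn id Y X p"
      by (simp add: algebra_simps)
    then show ?thesis
      by (simp add: hsub[OF vector_fieldsD(1)[OF in_vf(1)] vector_fieldsD(1)[OF in_vf(2)] vector_fieldsD(1)] that)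
  qed
  have skew: "?s X Y Z p = - ?s X Z Y p"
    if "X \<in> vector_fields B" "Y \<in> vector_fields B" "Z \<in> vector_fields B" for X Y Z p
  proof -
    have "X p (\<lambda>q. h q (Y q) (Z q)) = h p (nabla X Y p) (Z p) + h p (Y p) (nabla X Z p)"
      "X p (\<lambda>q. h q (Y q) (Z q)) = h p (conn id X Y p) (Z p) + h p (Y p) (conn id X Z p)"
      using n m that unfolding is_levi_civita_def by blast+
    moreover have hs: "h p u v = h p v u" if "u \<in> tangent_space B p" "v \<in> tangent_space B p" for u v
      using riemannian that unfolding riemannian_metric_def by blast
    have "h p (Y p) (nabla X Z p) = h p (nabla X Z p) (Y p)" "h p (Y p) (conn id X Z p) = h p (conn id X Z p) (Y p)"
      by (rule hs[OF vector_fieldsD(1)[OF that(2)] vector_fieldsD(1)[OF in_vf(1)[OF that(1,3)]]],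
          rule hs[OF vector_fieldsD(1)[OF that(2)] vector_fieldsD(1)[OF in_vf(2)[OF that(1,3)]]])
    ultimately show ?thesis by linarith
  qed
  have s0: "?s X Y Z p = 0" if Z: "Z \<in> vector_fields B" for Z p
    using sym[OF X Y Z, of p] skew[OF X Y Z, of p] sym[OF X Z Y, of p] skew[OF Z X Y, of p]
      sym[OF Z Y X, of p] skew[OF Y Z X, of p] by linarith
  show ?thesis
  proof
    fix p
    have "coframe p (nabla X Y p) = coframe p (conn id X Y p)"
      using s0[OF frame_field] by (simp add: coframe_def)
    then show "nabla X Y p = conn id X Y p"
      using frame_coframe in_vf[OF X Y] vector_fieldsD(1) by metis
  qed
qed

lemma levi_civita_eq:
  assumes X: "X \<in> vector_fields B" and Y: "Y \<in> vector_fields B"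
  shows "levi_civita B h X Y = conn id X Y"
proof -
  have "is_levi_civita B h (levi_civita B h)"
    unfolding levi_civita_def by (rule someI[of "is_levi_civita B h", OF levi_civita_conn])
  then show ?thesis by (rule levi_civita_unique[OF _ X Y])
qed

lemma conn_id_field: "X \<in> vector_fields B \<Longrightarrow> Y \<in> vector_fields B \<Longrightarrow> conn id X Y \<in> vector_fields B"
  using I.connection_conn unfolding connection_along_def along_id by blast

lemma coef_conn_id:
  "X \<in> vector_fields B \<Longrightarrow>
    coef id (conn id X Y) p = tangent_vec (X p) (coef id Y) + lc (coef id X p) (coef id Y p)"
  using conn_id[of X Y p] by (simp add: coef_def)

lemma smooth_coef_id: "X \<in> vector_fields B \<Longrightarrow> smooth_vec B (coef id X)"
  using I.smooth_coef by (simp add: along_id)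

definition curv :: "'f \<Rightarrow> 'f \<Rightarrow> 'f \<Rightarrow> 'f" where
  "curv x y z = lc x (lc y z) - lc y (lc x z) - lc (br x y) z"

lemma coef_conn_id': "X \<in> vector_fields B \<Longrightarrow>
    coef id (conn id X Y) = (\<lambda>p. tangent_vec (X p) (coef id Y) + lc (coef id X p) (coef id Y p))"
  using coef_conn_id by blast

lemma smooth_vec_derivative:
  "X \<in> vector_fields B \<Longrightarrow> smooth_vec B z \<Longrightarrow> smooth_vec B (\<lambda>p. tangent_vec (X p) z)"
  unfolding smooth_vec_def[of B "\<lambda>p. tangent_vec (X p) z"]
  using inner_tangent_vec[OF charted vector_fieldsD(1)[of X B] , of z]
    vector_fieldsD(2)[OF _ smooth_vecD, of X B z] by simp

text \<open>The extensions picked by choice need not be left invariant, so derivatives of their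
  coefficients \<open>?c\<close> occur in all three terms. They cancel; this is tensoriality,
  verified by computation.\<close>

lemma curvature_eq:
  "curvature B h p (\<Lambda> x p) (\<Lambda> y p) (\<Lambda> z p) = \<Lambda> (curv x y z) p"
proof -
  let ?E = "\<lambda>x. extension B p (\<Lambda> x p)"
  have E: "?E x \<in> vector_fields B" "?E x p = \<Lambda> x p" for x using extension_in[OF frame_in] by auto
  have cE: "coef id (?E x) p = x" for x by (simp add: coef_def E)
  note lc2 = levi_civita_eq[OF E(1) E(1)] levi_civita_eq[OF E(1) conn_id_field[OF E(1) E(1)]]
    levi_civita_eq[OF bracket_field[OF E(1) E(1)] E(1)]
  let ?c = "\<lambda>x. coef id (?E x)"
  let ?d = "\<lambda>x. tangent_vec (\<Lambda> x p)"
  note s = smooth_coef_id[OF E(1)]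
  have lin: "linear (lc u)" "linear (\<lambda>u. lc u v)" for u v
    using bilinear_lc by (auto simp: bilinear_def)
  note L = linear_add[OF lin(1)] linear_add[OF lin(2)] linear_diff[OF lin(2)]
  have n2: "conn id (?E x) (conn id (?E y) (?E z)) p =
     \<Lambda> (tangent_vec (\<Lambda> x p) (\<lambda>q. tangent_vec (?E y q) (?c z)) + lc (?d x (?c y)) z + lc y (?d x (?c z)) + lc x (?d y (?c z)) + lc x (lc y z)) p"
    for x y
    using tangent_vec_add[OF charted frame_in smooth_vec_derivative[OF E(1) s] smooth_vec_bilinear[OF charted bilinear_lc s s]]
      tangent_vec_bilinear[OF charted frame_in bilinear_lc s s]
    by (simp add: conn_id[OF E(1)] coef_conn_id'[OF E(1)] cE E(2) L add.assoc frame_eq_iff)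
  have b: "bracket (?E x) (?E y) p = \<Lambda> (?d x (?c y) - ?d y (?c x) + br x y) p"
    by (simp add: bracket_frame[OF E(1) E(1)] cE E(2))
  then have b': "coef id (bracket (?E x) (?E y)) p = ?d x (?c y) - ?d y (?c x) + br x y" by (simp add: coef_def)
  \<comment> \<open>By definition the bracket is the commutator of derivations. This matches the
    second derivatives of \<open>?c z\<close> that come from the iterated connections.\<close>
  have "tangent_vec (bracket (?E x) (?E y) p) (?c z) =
      tangent_vec (\<Lambda> x p) (\<lambda>q. tangent_vec (?E y q) (?c z)) - tangent_vec (\<Lambda> y p) (\<lambda>q. tangent_vec (?E x q) (?c z))"
  proof (rule euclidean_eqI)
    fix k :: 'f
    have "bracket (?E x) (?E y) p (\<lambda>q. (?c z) q \<bullet> k) =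
        \<Lambda> x p (\<lambda>q. tangent_vec (?E y q) (?c z) \<bullet> k) - \<Lambda> y p (\<lambda>q. tangent_vec (?E x q) (?c z) \<bullet> k)"
      using inner_tangent_vec[OF charted vector_fieldsD(1)[OF E(1)] s] by (simp add: bracket_def E(2))
    then show "tangent_vec (bracket (?E x) (?E y) p) (?c z) \<bullet> k =
      (tangent_vec (\<Lambda> x p) (\<lambda>q. tangent_vec (?E y q) (?c z)) - tangent_vec (\<Lambda> y p) (\<lambda>q. tangent_vec (?E x q) (?c z))) \<bullet> k"
      using inner_tangent_vec[OF charted vector_fieldsD(1)[OF bracket_field[OF E(1) E(1)]] s]
        inner_tangent_vec[OF charted frame_in smooth_vec_derivative[OF E(1) s]]
      by (simp add: inner_diff_left)
  qed
  then have n3: "conn id (bracket (?E x) (?E y)) (?E z) p =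
      \<Lambda> (tangent_vec (\<Lambda> x p) (\<lambda>q. tangent_vec (?E y q) (?c z)) - tangent_vec (\<Lambda> y p) (\<lambda>q. tangent_vec (?E x q) (?c z))
         + lc (?d x (?c y)) z - lc (?d y (?c x)) z + lc (br x y) z) p"
    by (simp add: conn_id[OF bracket_field[OF E(1) E(1)]] b' cE L frame_eq_iff algebra_simps)
  show ?thesis
    unfolding curvature_def Let_def fun_diff_def lc2 n2[of x y] n2[of y x] n3
    by (simp add: fun_eq_iff frame_apply_linear curv_def algebra_simps)
qed

end

section \<open>The pull-back connection\<close>

context framed_map
begin

lemma conn_pullback:
  assumes X: "X \<in> vector_fields A" and Y: "Y \<in> vector_fields B"
  shows "conn \<phi> X (Y \<circ> \<phi>) p = levi_civita B h (extension B (\<phi> p) (pushforward B \<phi> (X p))) Y (\<phi> p)"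
proof -
  have v: "pushforward B \<phi> (X p) \<in> tangent_space B (\<phi> p)" using along_in[OF push_along[OF X]] .
  note E = extension_in[OF v]
  have sY: "smooth_vec B (coef id Y)" using smooth_coef_id[OF Y] .
  have "coef \<phi> (Y \<circ> \<phi>) = (\<lambda>p. coef id Y (\<phi> p))" by (simp add: coef_def)
  moreover have "tangent_vec (X p) (\<lambda>p. coef id Y (\<phi> p)) = tangent_vec (pushforward B \<phi> (X p)) (coef id Y)"
    using smooth_vecD[OF sY] by (simp add: tangent_vec_def pushforward_def o_def)
  ultimately show ?thesis
    unfolding levi_civita_eq[OF E(1) Y] conn_id[OF E(1)] by (simp add: conn_def field_def coef_def E(2))
qed

text \<open>\<open>conn\<close> witnesses that the choice is not vacuous. The defining property
  fixes the values on the frame fields along \<phi>, and \<open>connection_expand\<close> extends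
  the agreement to all sections.\<close>

lemma pullback_connection_eq:
  assumes X: "X \<in> vector_fields A" and V: "V \<in> fields_along A B \<phi>"
  shows "pullback_connection A B h \<phi> X V = conn \<phi> X V"
proof -
  let ?P = "\<lambda>D. connection_along A B \<phi> D \<and>
     (\<forall>X\<in>vector_fields A. \<forall>Y\<in>vector_fields B. \<forall>p.
        D X (Y \<circ> \<phi>) p = levi_civita B h (extension B (\<phi> p) (pushforward B \<phi> (X p))) Y (\<phi> p))"
  have "?P (conn \<phi>)" using connection_conn conn_pullback by blast
  then have P: "?P (pullback_connection A B h \<phi>)"
    unfolding pullback_connection_def by (rule someI[of ?P])
  then have "pullback_connection A B h \<phi> X (\<Lambda> k \<circ> \<phi>) p = conn \<phi> X (\<Lambda> k \<circ> \<phi>) p" for k p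
    using X frame_field conn_pullback by simp
  then show ?thesis
    using connection_expand[OF _ X V, of "pullback_connection A B h \<phi>"] connection_expand[OF connection_conn X V] P
    by simp
qed

end

section \<open>Linear algebra in orthonormal bases\<close>

text \<open>The hypothesis is Parseval's identity instead of orthonormality, so that the family may
  have more members than the dimension. It thus also covers the images of an orthonormal basis under
  a submersion.\<close>

lemma sum_bilinear_orthonormal:
  fixes \<beta> :: "'e::euclidean_space \<Rightarrow> 'e \<Rightarrow> 'z::real_vector"
  assumes \<beta>: "\<And>x. linear (\<beta> x)" "\<And>y. linear (\<lambda>x. \<beta> x y)" and fin: "finite I"
    and parseval: "\<And>x y. (\<Sum>i\<in>I. (u i \<bullet> x) * (u i \<bullet> y)) = x \<bullet> y"
  shows "(\<Sum>i\<in>I. \<beta> (u i) (u i)) = (\<Sum>b\<in>Basis. \<beta> b b)"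
proof -
  have "\<beta> x x = (\<Sum>b\<in>Basis. \<Sum>c\<in>Basis. ((x \<bullet> b) * (x \<bullet> c)) *\<^sub>R \<beta> b c)" for x
  proof -
    have "\<beta> x x = (\<Sum>b\<in>Basis. (x \<bullet> b) *\<^sub>R \<beta> b x)" by (rule linear_euclidean_expand[OF \<beta>(2)])
    also have "\<dots> = (\<Sum>b\<in>Basis. (x \<bullet> b) *\<^sub>R (\<Sum>c\<in>Basis. (x \<bullet> c) *\<^sub>R \<beta> b c))"
      by (intro sum.cong refl arg_cong2[of _ _ _ _ "(*\<^sub>R)"] linear_euclidean_expand[OF \<beta>(1)])
    finally show ?thesis by (simp add: scaleR_sum_right)
  qed
  then have "(\<Sum>i\<in>I. \<beta> (u i) (u i)) =
      (\<Sum>i\<in>I. \<Sum>b\<in>Basis. \<Sum>c\<in>Basis. ((u i \<bullet> b) * (u i \<bullet> c)) *\<^sub>R \<beta> b c)" by simp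
  also have "\<dots> = (\<Sum>b\<in>Basis. \<Sum>c\<in>Basis. \<Sum>i\<in>I. ((u i \<bullet> b) * (u i \<bullet> c)) *\<^sub>R \<beta> b c)"
    by (subst sum.swap) (intro sum.cong refl sum.swap)
  also have "\<dots> = (\<Sum>b\<in>Basis. \<Sum>c\<in>Basis. (b \<bullet> c) *\<^sub>R \<beta> b c)"
    by (simp add: parseval flip: scaleR_sum_left)
  also have "\<dots> = (\<Sum>b\<in>Basis. \<beta> b b)"
    by (intro sum.cong refl) (simp add: inner_Basis if_distrib[of "\<lambda>r. r *\<^sub>R _"] sum.delta cong: if_cong)
  finally show ?thesis .
qed

lemma parseval_Basis: "(\<Sum>b\<in>Basis. (b \<bullet> x) * (b \<bullet> y)) = x \<bullet> (y::'e::euclidean_space)"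
  by (simp add: euclidean_inner[of x y] inner_commute)

lemma parseval_orthonormal:
  fixes u :: "nat \<Rightarrow> 'e::euclidean_space"
  assumes on: "\<And>i j. i < DIM('e) \<Longrightarrow> j < DIM('e) \<Longrightarrow> u i \<bullet> u j = (if i = j then 1 else 0)"
  shows "(\<Sum>i<DIM('e). (u i \<bullet> x) * (u i \<bullet> y)) = x \<bullet> y"
proof -
  let ?n = "DIM('e)"
  have inj: "inj_on u {..<?n}"
    by (rule inj_onI) (metis lessThan_iff on zero_neq_one)
  have "independent (u ` {..<?n})"
  proof (rule pairwise_orthogonal_independent)
    show "pairwise orthogonal (u ` {..<?n})"
      by (auto simp: pairwise_def orthogonal_def on)
    show "0 \<notin> u ` {..<?n}"
    proof
      assume "0 \<in> u ` {..<?n}"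
      then obtain i where "i < ?n" "u i = 0" by force
      then show False using on[of i i] by simp
    qed
  qed
  moreover have "card (u ` {..<?n}) = ?n" using inj by (simp add: card_image)
  ultimately have sp: "span (u ` {..<?n}) = UNIV"
    by (metis card_eq_dim dim_UNIV finite_imageI finite_lessThan span_UNIV subset_UNIV top.extremum_uniqueI)
  have rep: "x = (\<Sum>i<?n. (u i \<bullet> x) *\<^sub>R u i)" for x
  proof -
    let ?y = "x - (\<Sum>i<?n. (u i \<bullet> x) *\<^sub>R u i)"
    have "u j \<bullet> ?y = 0" if "j < ?n" for j
    proof -
      have "(\<Sum>i<?n. (u i \<bullet> x) * (u j \<bullet> u i)) = (\<Sum>i<?n. if i = j then u i \<bullet> x else 0)"
        by (intro sum.cong refl) (use on that in auto)
      then show ?thesis using that by (simp add: inner_diff_right inner_sum_right)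
    qed
    then have "\<And>z. z \<in> u ` {..<?n} \<Longrightarrow> orthogonal ?y z" by (auto simp: orthogonal_def inner_commute)
    then have "orthogonal ?y ?y" using orthogonal_to_span[of ?y "u ` {..<?n}" ?y] sp by blast
    then show ?thesis by (simp add: orthogonal_def)
  qed
  have "x \<bullet> y = (\<Sum>i<?n. (u i \<bullet> x) *\<^sub>R u i) \<bullet> y" using rep[of x] by simp
  then show ?thesis by (simp add: inner_sum_left)
qed

lemma skew_if_trace_zero:
  fixes L :: "'f::euclidean_space \<Rightarrow> 'f"
  assumes L: "linear L" and 0: "(\<Sum>f\<in>Basis. L f \<bullet> L f + L (L f) \<bullet> f) = 0"
  shows "L x \<bullet> x = 0"
proof -
  let ?M = "\<lambda>f e. L f \<bullet> e"
  have M2: "L (L f) \<bullet> f = (\<Sum>e\<in>Basis. ?M f e * ?M e f)" for f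
  proof -
    have "L (L f) = (\<Sum>e\<in>Basis. ?M f e *\<^sub>R L e)" by (rule linear_euclidean_expand[OF L])
    then show ?thesis by (simp add: inner_sum_left)
  qed
  have M1: "L f \<bullet> L f = (\<Sum>e\<in>Basis. ?M f e * ?M f e)" for f by (rule euclidean_inner)
  have sw: "(\<Sum>f\<in>Basis. \<Sum>e\<in>Basis. ?M f e * ?M f e) = (\<Sum>f\<in>Basis. \<Sum>e\<in>Basis. ?M e f * ?M e f)"
    by (rule sum.swap)
  have "(\<Sum>f\<in>Basis. \<Sum>e\<in>Basis. (?M f e + ?M e f)\<^sup>2) =
      (\<Sum>f\<in>Basis. \<Sum>e\<in>Basis. ?M f e * ?M f e) + (\<Sum>f\<in>Basis. \<Sum>e\<in>Basis. ?M e f * ?M e f) +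
      2 * (\<Sum>f\<in>Basis. \<Sum>e\<in>Basis. ?M f e * ?M e f)"
    by (simp add: power2_eq_square algebra_simps sum.distrib sum_distrib_left)
  also have "\<dots> = 2 * (\<Sum>f\<in>Basis. L f \<bullet> L f + L (L f) \<bullet> f)"
    by (simp add: M1 M2 sum.distrib flip: sw)
  finally have "(\<Sum>f\<in>Basis. \<Sum>e\<in>Basis. (?M f e + ?M e f)\<^sup>2) = 0" using 0 by simp
  then have sk: "?M f e = - ?M e f" if "f \<in> Basis" "e \<in> Basis" for f e
  proof -
    have "\<forall>f\<in>Basis. (\<Sum>e\<in>Basis. (?M f e + ?M e f)\<^sup>2) = 0"
      using \<open>(\<Sum>f\<in>Basis. \<Sum>e\<in>Basis. (?M f e + ?M e f)\<^sup>2) = 0\<close>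
      by (subst (asm) sum_nonneg_eq_0_iff) (auto intro: sum_nonneg)
    then have "(\<Sum>e\<in>Basis. (?M f e + ?M e f)\<^sup>2) = 0" using that by blast
    then have "\<forall>e\<in>Basis. (?M f e + ?M e f)\<^sup>2 = 0"
      by (subst (asm) sum_nonneg_eq_0_iff) auto
    then have "(?M f e + ?M e f)\<^sup>2 = 0" using that(2) by blast
    then show ?thesis by simp
  qed
  have Lx: "L x \<bullet> x = (\<Sum>f\<in>Basis. \<Sum>e\<in>Basis. (x \<bullet> f) * (x \<bullet> e) * ?M f e)"
  proof -
    have "L x \<bullet> x = (\<Sum>f\<in>Basis. (x \<bullet> f) *\<^sub>R L f) \<bullet> x" using linear_euclidean_expand[OF L, of x] by simp
    also have "\<dots> = (\<Sum>f\<in>Basis. (x \<bullet> f) * (L f \<bullet> x))" by (simp add: inner_sum_left)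
    also have "\<dots> = (\<Sum>f\<in>Basis. (x \<bullet> f) * (\<Sum>e\<in>Basis. (L f \<bullet> e) * (x \<bullet> e)))"
      by (intro sum.cong refl arg_cong2[of _ _ _ _ "(*)"] euclidean_inner)
    finally show ?thesis by (simp add: sum_distrib_left mult_ac)
  qed
  also have "\<dots> = (\<Sum>f\<in>Basis. \<Sum>e\<in>Basis. - ((x \<bullet> e) * (x \<bullet> f) * ?M e f))"
  proof (intro sum.cong refl)
    fix f e :: 'f assume "f \<in> Basis" "e \<in> Basis"
    then show "(x \<bullet> f) * (x \<bullet> e) * ?M f e = - ((x \<bullet> e) * (x \<bullet> f) * ?M e f)"
      by (simp add: sk[of f e])
  qed
  also have "\<dots> = - (\<Sum>f\<in>Basis. \<Sum>e\<in>Basis. (x \<bullet> e) * (x \<bullet> f) * ?M e f)"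
    by (simp add: sum_negf)
  also have "(\<Sum>f\<in>Basis. \<Sum>e\<in>Basis. (x \<bullet> e) * (x \<bullet> f) * ?M e f) = L x \<bullet> x"
    unfolding Lx by (rule sum.swap)
  finally show ?thesis by simp
qed

lemma orthogonal_in_dim_2:
  fixes t w z :: "'f::euclidean_space"
  assumes "DIM('f) = 2" "t \<noteq> 0" "w \<noteq> 0" "t \<bullet> w = 0" "z \<bullet> t = 0" "z \<bullet> w = 0"
  shows "z = 0"
proof (rule ccontr)
  assume "z \<noteq> 0"
  have ne: "t \<noteq> w" "z \<noteq> t" "z \<noteq> w" using assms \<open>z \<noteq> 0\<close> by auto
  have "independent {t, w, z}"
    using assms \<open>z \<noteq> 0\<close>
    by (intro pairwise_orthogonal_independent) (auto simp: pairwise_def orthogonal_def inner_commute)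
  then have "card {t, w, z} \<le> DIM('f)" using independent_bound by blast
  then show False using ne assms(1) by simp
qed

context framed
begin

lemma manifold_dim_eq: "manifold_dim B = DIM('f)"
  using open_manifold by (simp add: manifold_dim_def open_manifold_def)

lemma orthonormal_frame_exists: "\<exists>E. orthonormal_frame_at B h p E"
proof -
  obtain e where "bij_betw e {0..<DIM('f)} (Basis::'f set)"
    using ex_bij_betw_nat_finite[OF finite_Basis] by blast
  then have e: "inj_on e {0..<DIM('f)}" "\<And>i. i < DIM('f) \<Longrightarrow> e i \<in> Basis"
    by (auto simp: bij_betw_def)
  have "h q (\<Lambda> (e i) q) (\<Lambda> (e j) q) = (if i = j then 1 else 0)" if "i < DIM('f)" "j < DIM('f)" for q i j
    using e that by (auto simp: frame_inner inner_Basis inj_on_eq_iff)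
  then have "orthonormal_frame_at B h p (\<lambda>i. \<Lambda> (e i))"
    unfolding orthonormal_frame_at_def manifold_dim_eq
    using frame_field by (intro conjI exI[of _ UNIV]) auto
  then show ?thesis by blast
qed

end

section \<open>Tension and bitension of a homomorphism\<close>

locale framed_hom =
  framed_map B h \<Lambda> br A \<phi> + G: framed A g \<Lambda>G brG
  for B :: "('n::{t2_space,second_countable_topology}, 'f::euclidean_space) atlas" and h \<Lambda> br
    and A :: "('m::{t2_space,second_countable_topology}, 'e::euclidean_space) atlas" and \<phi> g \<Lambda>G brG +
  fixes \<xi> :: "'e \<Rightarrow> 'f"
  assumes push_frame: "pushforward B \<phi> (\<Lambda>G x p) = \<Lambda> (\<xi> x) (\<phi> p)"
    and \<xi>_br: "\<xi> (brG x y) = br (\<xi> x) (\<xi> y)"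
begin

lemma linear_\<xi>: "linear \<xi>"
proof (rule linearI)
  fix x y a
  \<comment> \<open>A frame label can be read off at any single point, so an arbitrary base point
    suffices.\<close>
  show "\<xi> (x + y) = \<xi> x + \<xi> y"
    using push_frame[of "x + y" undefined]
    by (simp add: linear_add[OF G.linear_frame] pushforward_add push_frame frame_eq_iff
        flip: linear_add[OF linear_frame])
  show "\<xi> (a *\<^sub>R x) = a *\<^sub>R \<xi> x"
    using push_frame[of "a *\<^sub>R x" undefined]
    by (simp add: linear_scale[OF G.linear_frame] pushforward_scale push_frame frame_eq_iff
        flip: linear_scale[OF linear_frame])
qed

lemma linear_lc: "linear (lc u)" "linear (\<lambda>u. lc u v)"
  and linear_br: "linear (br u)" "linear (\<lambda>u. br u v)"
  and linear_lcG: "linear (G.lc u')" "linear (\<lambda>u. G.lc u v')"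
  and linear_brG: "linear (brG u')" "linear (\<lambda>u. brG u v')"
  using bilinear_lc bilinear_br G.bilinear_lc G.bilinear_br by (auto simp: bilinear_def)

lemma push_coef: "X \<in> vector_fields A \<Longrightarrow> pushforward B \<phi> (X p) = \<Lambda> (\<xi> (G.coef id X p)) (\<phi> p)"
  by (subst G.vector_eq_frame[of X p]) (auto simp: push_frame)

lemma coef_push: "X \<in> vector_fields A \<Longrightarrow>
    coef \<phi> (\<lambda>p. pushforward B \<phi> (X p)) = (\<lambda>p. \<xi> (G.coef id X p))"
  by (rule ext) (simp add: coef_def push_coef)

text \<open>The derivative of the coefficients of \<open>Y\<close> occurs in both terms, because the
  differential of \<phi> is the constant linear map \<xi> in the frames. It cancels, and the
  algebraic part remains.\<close>

lemma second_fundamental_form_eq: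
  assumes X: "X \<in> vector_fields A" and Y: "Y \<in> vector_fields A"
  shows "second_fundamental_form A g B h \<phi> X Y p =
    \<Lambda> (lc (\<xi> (G.coef id X p)) (\<xi> (G.coef id Y p)) - \<xi> (G.lc (G.coef id X p) (G.coef id Y p))) (\<phi> p)"
proof -
  have "pullback_connection A B h \<phi> X (\<lambda>p. pushforward B \<phi> (Y p)) p =
      \<Lambda> (\<xi> (tangent_vec (X p) (G.coef id Y)) + lc (\<xi> (G.coef id X p)) (\<xi> (G.coef id Y p))) (\<phi> p)"
    using tangent_vec_linear[OF cA vector_fieldsD(1)[OF X] linear_\<xi> G.smooth_coef_id[OF Y]]
    by (simp add: pullback_connection_eq[OF X push_along[OF Y]] conn_def field_def coef_push X Y)
  moreover have "pushforward B \<phi> (levi_civita A g X Y p) =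
      \<Lambda> (\<xi> (tangent_vec (X p) (G.coef id Y)) + \<xi> (G.lc (G.coef id X p) (G.coef id Y p))) (\<phi> p)"
    by (simp add: G.levi_civita_eq[OF X Y] G.conn_id[OF X] push_frame linear_add[OF linear_\<xi>])
  ultimately show ?thesis
    by (simp add: second_fundamental_form_def fun_eq_iff frame_apply_linear)
qed

text \<open>The very frame that \<open>tension_field\<close> and \<open>bitension_field\<close>
  select by choice.\<close>

definition frame_at :: "'m \<Rightarrow> nat \<Rightarrow> 'm \<Rightarrow> 'm tvec" where
  "frame_at p = (SOME E. orthonormal_frame_at A g p E)"

lemma frame_at: "i < DIM('e) \<Longrightarrow> frame_at p i \<in> vector_fields A"
    "i < DIM('e) \<Longrightarrow> j < DIM('e) \<Longrightarrow>
      G.coef id (frame_at p i) p \<bullet> G.coef id (frame_at p j) p = (if i = j then 1 else 0)"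
proof -
  have "orthonormal_frame_at A g p (frame_at p)"
    unfolding frame_at_def using someI_ex[OF G.orthonormal_frame_exists] .
  then have E: "i < DIM('e) \<Longrightarrow> frame_at p i \<in> vector_fields A"
    "i < DIM('e) \<Longrightarrow> j < DIM('e) \<Longrightarrow> g p (frame_at p i p) (frame_at p j p) = (if i = j then 1 else 0)" for i j
    unfolding orthonormal_frame_at_def G.manifold_dim_eq by blast+
  show "i < DIM('e) \<Longrightarrow> frame_at p i \<in> vector_fields A" by (rule E(1))
  show "G.coef id (frame_at p i) p \<bullet> G.coef id (frame_at p j) p = (if i = j then 1 else 0)"
    if "i < DIM('e)" "j < DIM('e)"
    using E(2)[OF that] G.frame_inner[of p "G.coef id (frame_at p i) p" "G.coef id (frame_at p j) p"]
      G.vector_eq_frame[OF E(1)[OF that(1)], of p] G.vector_eq_frame[OF E(1)[OF that(2)], of p] by simp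
qed

text \<open>The selected frame is orthonormal at \<open>p\<close>, so its labels there form an
  orthonormal basis of the model, and the trace of a bilinear map does not see which one.\<close>

lemma sum_frame_at:
  fixes \<beta> :: "'e \<Rightarrow> 'e \<Rightarrow> 'f"
  assumes "\<And>x. linear (\<beta> x)" "\<And>y. linear (\<lambda>x. \<beta> x y)"
  shows "(\<Sum>i<DIM('e). \<Lambda> (\<beta> (G.coef id (frame_at p i) p) (G.coef id (frame_at p i) p)) q) =
    \<Lambda> (\<Sum>b\<in>Basis. \<beta> b b) q"
  using sum_bilinear_orthonormal[OF assms finite_lessThan parseval_orthonormal[OF frame_at(2)]]
  by (simp flip: linear_sum[OF linear_frame])

definition \<tau> :: 'f where "\<tau> = (\<Sum>b\<in>Basis. lc (\<xi> b) (\<xi> b) - \<xi> (G.lc b b))"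

definition \<tau>2 :: 'f where
  "\<tau>2 = (\<Sum>b\<in>Basis. lc (\<xi> b) (lc (\<xi> b) \<tau>) - lc (\<xi> (G.lc b b)) \<tau> + curv \<tau> (\<xi> b) (\<xi> b))"

lemmas linear_rules =
  linear_add[OF linear_lc(1)] linear_add[OF linear_lc(2)] linear_scale[OF linear_lc(1)] linear_scale[OF linear_lc(2)]
  linear_add[OF linear_br(1)] linear_add[OF linear_br(2)] linear_scale[OF linear_br(1)] linear_scale[OF linear_br(2)]
  linear_add[OF linear_lcG(1)] linear_add[OF linear_lcG(2)] linear_scale[OF linear_lcG(1)] linear_scale[OF linear_lcG(2)]
  linear_add[OF linear_\<xi>] linear_scale[OF linear_\<xi>]

lemma tension_field_eq: "tension_field A g B h \<phi> p = \<Lambda> \<tau> (\<phi> p)"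
proof -
  have "tension_field A g B h \<phi> p =
      (\<Sum>i<DIM('e). second_fundamental_form A g B h \<phi> (frame_at p i) (frame_at p i) p)"
    by (simp add: tension_field_def frame_at_def G.manifold_dim_eq Let_def)
  also have "\<dots> = \<Lambda> \<tau> (\<phi> p)"
    unfolding \<tau>_def
    by (subst sum_frame_at[of "\<lambda>x y. lc (\<xi> x) (\<xi> y) - \<xi> (G.lc x y)" p "\<phi> p", symmetric])
      (auto intro!: linearI simp: linear_rules algebra_simps second_fundamental_form_eq frame_at(1))
  finally show ?thesis .
qed

lemma second_covariant_derivative_eq:
  assumes X: "X \<in> vector_fields A"
  shows "second_covariant_derivative A g B h \<phi> X X (tension_field A g B h \<phi>) p =
    \<Lambda> (lc (\<xi> (G.coef id X p)) (lc (\<xi> (G.coef id X p)) \<tau>) - lc (\<xi> (G.lc (G.coef id X p) (G.coef id X p))) \<tau>) (\<phi> p)"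
proof -
  let ?x = "G.coef id X"
  have T: "tension_field A g B h \<phi> = field \<phi> (\<lambda>_. \<tau>)"
    by (rule ext) (simp add: tension_field_eq field_def)
  have TF: "field \<phi> (\<lambda>_. \<tau>) \<in> fields_along A B \<phi>"
    by (rule field_along[OF smooth_vec_const[OF cA]])
  have D: "pullback_connection A B h \<phi> Y (field \<phi> (\<lambda>_. \<tau>)) = field \<phi> (\<lambda>p. lc (\<xi> (G.coef id Y p)) \<tau>)"
    if Y: "Y \<in> vector_fields A" for Y
    by (simp add: pullback_connection_eq[OF Y TF] conn_def coef_push[OF Y]
        tangent_vec_const[OF cA vector_fieldsD(1)[OF Y]])
  have lin: "linear (\<lambda>x. lc (\<xi> x) \<tau>)"
    by (rule linearI) (simp_all add: linear_rules)
  have s: "smooth_vec A (\<lambda>p. lc (\<xi> (?x p)) \<tau>)"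
    by (rule smooth_vec_linear[OF cA lin G.smooth_coef_id[OF X]])
  have nX: "levi_civita A g X X \<in> vector_fields A"
    by (simp add: G.levi_civita_eq[OF X X] G.conn_id_field[OF X X])
  \<comment> \<open>The coefficients of the tension are constant, but those of its first derivative
    vary with \<open>X\<close>. The extra term is the one contributed by
    \<open>levi_civita A g X X\<close>, so both cancel in the difference.\<close>
  have "pullback_connection A B h \<phi> X (field \<phi> (\<lambda>p. lc (\<xi> (?x p)) \<tau>)) p =
      \<Lambda> (lc (\<xi> (tangent_vec (X p) ?x)) \<tau> + lc (\<xi> (?x p)) (lc (\<xi> (?x p)) \<tau>)) (\<phi> p)"
    using tangent_vec_linear[OF cA vector_fieldsD(1)[OF X] lin G.smooth_coef_id[OF X]]
    by (simp add: pullback_connection_eq[OF X field_along[OF s]] conn_def coef_push[OF X]) (simp add: field_def)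
  moreover have "pullback_connection A B h \<phi> (levi_civita A g X X) (field \<phi> (\<lambda>_. \<tau>)) p =
      \<Lambda> (lc (\<xi> (tangent_vec (X p) ?x)) \<tau> + lc (\<xi> (G.lc (?x p) (?x p))) \<tau>) (\<phi> p)"
    unfolding D[OF nX] by (simp add: field_def G.levi_civita_eq[OF X X] G.coef_conn_id[OF X] linear_rules)
  ultimately show ?thesis
    unfolding second_covariant_derivative_def Let_def T D[OF X]
    by (simp add: fun_eq_iff frame_apply_linear)
qed

lemma bitension_field_eq: "bitension_field A g B h \<phi> p = - \<Lambda> \<tau>2 (\<phi> p)"
proof -
  let ?\<beta> = "\<lambda>x y. lc (\<xi> x) (lc (\<xi> y) \<tau>) - lc (\<xi> (G.lc x y)) \<tau> + curv \<tau> (\<xi> x) (\<xi> y)"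
  have "bitension_field A g B h \<phi> p =
      - (\<Sum>i<DIM('e). second_covariant_derivative A g B h \<phi> (frame_at p i) (frame_at p i) (tension_field A g B h \<phi>) p +
        curvature B h (\<phi> p) (tension_field A g B h \<phi> p) (pushforward B \<phi> (frame_at p i p)) (pushforward B \<phi> (frame_at p i p)))"
    by (simp add: bitension_field_def frame_at_def G.manifold_dim_eq Let_def)
  also have "(\<Sum>i<DIM('e). second_covariant_derivative A g B h \<phi> (frame_at p i) (frame_at p i) (tension_field A g B h \<phi>) p +
        curvature B h (\<phi> p) (tension_field A g B h \<phi> p) (pushforward B \<phi> (frame_at p i p)) (pushforward B \<phi> (frame_at p i p))) =
      (\<Sum>i<DIM('e). \<Lambda> (?\<beta> (G.coef id (frame_at p i) p) (G.coef id (frame_at p i) p)) (\<phi> p))"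
    by (intro sum.cong refl)
      (simp add: second_covariant_derivative_eq frame_at(1) tension_field_eq push_coef curvature_eq
        linear_add[OF linear_frame])
  also have "\<dots> = \<Lambda> \<tau>2 (\<phi> p)"
    unfolding \<tau>2_def
    by (rule sum_frame_at) (auto intro!: linearI simp: linear_rules curv_def algebra_simps)
  finally show ?thesis .
qed

lemma harmonic_iff: "harmonic A g B h \<phi> \<longleftrightarrow> \<tau> = 0"
  by (simp add: harmonic_def tension_field_eq frame_zero_iff)

lemma biharmonic_iff: "biharmonic A g B h \<phi> \<longleftrightarrow> \<tau>2 = 0"
  unfolding biharmonic_def bitension_field_eq neg_equal_0_iff_equal frame_zero_iff by simp

section \<open>Biharmonicity and the adjoint action of the tension\<close>

lemma \<tau>2_zero_if: "\<tau> = 0 \<Longrightarrow> \<tau>2 = 0"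
  by (simp add: \<tau>2_def curv_def linear_0[OF linear_lc(1)] linear_0[OF linear_lc(2)] linear_0[OF linear_br(2)])

text \<open>Metric compatibility moves the outer factor of the curvature onto \<open>x\<close>.
  Writing \<open>lc y x\<close> as \<open>lc x y - br x y\<close> cancels the products of mixed
  derivatives, and Koszul's formula turns the rest into brackets.\<close>

lemma curv_identity:
  "lc y x \<bullet> lc y x - curv x y y \<bullet> x = lc y y \<bullet> lc x x + br x y \<bullet> br x y + br x (br x y) \<bullet> y"
proof -
  let ?w = "br x y"
  have c: "curv x y y \<bullet> x = - (lc y y \<bullet> lc x x) + lc x y \<bullet> lc y x - lc ?w y \<bullet> x"
    by (simp add: curv_def inner_diff_left lc_metric[of x "lc y y" x] lc_metric[of y "lc x y" x])
  have "lc y x = lc x y - ?w" using lc_torsion[of x y] by (simp add: algebra_simps)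
  then have a: "lc y x \<bullet> lc y x = lc x y \<bullet> lc y x - ?w \<bullet> lc y x"
    by (metis inner_diff_left)
  have "lc ?w y \<bullet> x - lc y x \<bullet> ?w = ?w \<bullet> ?w + br x ?w \<bullet> y"
    unfolding inner_lc by (simp add: br_skew[of y x] field_simps)
  then show ?thesis using a c by (simp add: inner_commute[of ?w "lc y x"])
qed

definition UG :: 'e where "UG = (\<Sum>b\<in>Basis. G.lc b b)"

definition UH :: 'f where "UH = (\<Sum>b\<in>Basis. lc (\<xi> b) (\<xi> b))"

lemma \<tau>_eq: "\<tau> = UH - \<xi> UG"
  by (simp add: \<tau>_def UH_def UG_def sum_subtractf linear_sum[OF linear_\<xi>])

text \<open>Koszul's formula with two equal arguments. Hence \<open>UG\<close> is the metric dual of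
  the trace of the adjoint representation.\<close>

lemma inner_UG: "UG \<bullet> x = (\<Sum>b\<in>Basis. brG x b \<bullet> b)"
proof -
  have "G.lc b b \<bullet> x = brG x b \<bullet> b" for b
    by (simp add: G.br_self G.inner_lc G.br_skew[of b x])
  then show ?thesis by (simp add: UG_def inner_sum_left)
qed

lemma inner_UH: "UH \<bullet> y = (\<Sum>b\<in>Basis. br y (\<xi> b) \<bullet> \<xi> b)"
proof -
  have "lc z z \<bullet> y = br y z \<bullet> z" for z
    by (simp add: br_self inner_lc br_skew[of z y])
  then show ?thesis by (simp add: UH_def inner_sum_left)
qed

lemma inner_\<tau>2:
  "\<tau>2 \<bullet> \<tau> = - (br (\<xi> UG) \<tau> \<bullet> \<tau> + (\<Sum>b\<in>Basis. br \<tau> (\<xi> b) \<bullet> br \<tau> (\<xi> b) + br \<tau> (br \<tau> (\<xi> b)) \<bullet> \<xi> b))"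
proof -
  let ?Q = "\<lambda>y. br \<tau> y \<bullet> br \<tau> y + br \<tau> (br \<tau> y) \<bullet> y"
  \<comment> \<open>Metric compatibility for a field of constant length. It removes the terms of
    \<open>\<tau>2\<close> that contain \<open>\<xi> (G.lc b b)\<close>.\<close>
  have sk: "lc z \<tau> \<bullet> \<tau> = 0" for z using lc_metric[of z \<tau> \<tau>] by (simp add: inner_commute)
  have "(lc y (lc y \<tau>) + curv \<tau> y y) \<bullet> \<tau> = - (lc y y \<bullet> lc \<tau> \<tau> + ?Q y)" for y
    using curv_identity[of y \<tau>] by (simp add: inner_add_left lc_metric[of y "lc y \<tau>" \<tau>])
  then have "(lc y (lc y \<tau>) - lc z \<tau> + curv \<tau> y y) \<bullet> \<tau> = - (lc y y \<bullet> lc \<tau> \<tau> + ?Q y)" for y z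
    by (simp add: inner_add_left inner_diff_left sk)
  then have "\<tau>2 \<bullet> \<tau> = (\<Sum>b\<in>Basis. - (lc (\<xi> b) (\<xi> b) \<bullet> lc \<tau> \<tau> + ?Q (\<xi> b)))"
    by (simp add: \<tau>2_def inner_sum_left)
  also have "\<dots> = - (UH \<bullet> lc \<tau> \<tau> + (\<Sum>b\<in>Basis. ?Q (\<xi> b)))"
    by (simp add: sum_negf sum.distrib UH_def inner_sum_left del: minus_add_distrib)
  \<comment> \<open>\<open>UH\<close> is \<tau> plus the image of \<open>UG\<close>, and the \<tau>
    part is orthogonal to \<open>lc \<tau> \<tau>\<close>; so only the defect of unimodularity of
    the domain survives.\<close>
  also have "UH \<bullet> lc \<tau> \<tau> = \<tau> \<bullet> lc \<tau> \<tau> + lc \<tau> \<tau> \<bullet> \<xi> UG"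
    using \<tau>_eq by (simp add: inner_add_left[symmetric] inner_commute[of "lc \<tau> \<tau>"] algebra_simps)
  also have "\<dots> = br (\<xi> UG) \<tau> \<bullet> \<tau>"
    using sk[of \<tau>] by (simp add: br_self inner_commute[of \<tau>] inner_lc br_skew[of \<tau> "\<xi> UG"])
  finally show ?thesis .
qed

lemma UG_zero: "(\<And>x. (\<Sum>b\<in>Basis. brG x b \<bullet> b) = 0) \<Longrightarrow> UG = 0"
  using inner_UG[of UG] by simp

section \<open>Two-step nilpotent targets, submersions, and submersions onto surfaces\<close>

lemma case_two_step:
  assumes uni: "\<And>x. (\<Sum>b\<in>Basis. brG x b \<bullet> b) = 0" and two: "\<And>x y z. br x (br y z) = 0" and "\<tau>2 = 0"
  shows "\<tau> = 0"
proof -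
  have U: "UG = 0" by (rule UG_zero[OF uni])
  have "(\<Sum>b\<in>Basis. br \<tau> (\<xi> b) \<bullet> br \<tau> (\<xi> b)) = 0"
    using inner_\<tau>2 assms(3) two U by (simp add: linear_0[OF linear_\<xi>] linear_0[OF linear_br(2)])
  then have "\<forall>b\<in>Basis. br \<tau> (\<xi> b) \<bullet> br \<tau> (\<xi> b) = 0"
    by (subst (asm) sum_nonneg_eq_0_iff) auto
  \<comment> \<open>With \<open>UG = 0\<close> the tension is \<open>UH\<close>, so this says that
    \<tau> is orthogonal to itself.\<close>
  then have "UH \<bullet> \<tau> = 0" by (simp add: inner_UH)
  then show ?thesis using \<tau>_eq U linear_0[OF linear_\<xi>] by simp
qed

text \<open>The range of the adjoint is orthogonal to the kernel, so there \<xi> preserves inner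
  products. Hence \<open>?P\<close> annihilates \<open>?P y - y\<close>, and so does the adjoint,
  because its squared norm is given by \<open>?P\<close>. Surjectivity then forces
  \<open>?P y - y\<close> to vanish.\<close>

lemma adjoint_section:
  assumes sub: "\<And>x y. (\<And>u. \<xi> u = 0 \<Longrightarrow> u \<bullet> x = 0) \<Longrightarrow> (\<And>u. \<xi> u = 0 \<Longrightarrow> u \<bullet> y = 0) \<Longrightarrow> \<xi> x \<bullet> \<xi> y = x \<bullet> y"
    and surj: "surj \<xi>"
  shows "\<xi> (adjoint \<xi> y) = y"
proof -
  let ?P = "\<lambda>y. \<xi> (adjoint \<xi> y)"
  note adj = adjoint_works[OF linear_\<xi>]
  have "?P y \<bullet> ?P z = ?P y \<bullet> z" for y z
    using sub[of "adjoint \<xi> y" "adjoint \<xi> z"] by (simp add: adj inner_commute)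
  then have "?P z \<bullet> (?P y - y) = 0" for z
    by (simp add: inner_diff_right)
  then have "?P (?P y - y) \<bullet> z = 0" for z
    by (metis adj inner_commute)
  then have "?P (?P y - y) = 0" using inner_eq_zero_iff by blast
  then have "adjoint \<xi> (?P y - y) \<bullet> adjoint \<xi> (?P y - y) = 0"
    by (metis adj inner_zero_left)
  then have a0: "adjoint \<xi> (?P y - y) = 0" by simp
  obtain u where u: "\<xi> u = ?P y - y" using surj by (metis surjD)
  have "(?P y - y) \<bullet> (?P y - y) = u \<bullet> adjoint \<xi> (?P y - y)"
    by (metis adj u)
  then have "(?P y - y) \<bullet> (?P y - y) = 0" using a0 by simp
  then show ?thesis by simp
qed

text \<open>If \<xi> composed with its adjoint is the identity, the vectors \<open>\<xi> b\<close>
  satisfy Parseval's identity, although in general there are more of them than the dimension of the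
  target.\<close>

lemma sum_submersion:
  fixes \<beta> :: "'f \<Rightarrow> 'f \<Rightarrow> real"
  assumes \<xi>\<xi>: "\<And>y. \<xi> (adjoint \<xi> y) = y" and \<beta>: "\<And>x. linear (\<beta> x)" "\<And>y. linear (\<lambda>x. \<beta> x y)"
  shows "(\<Sum>b\<in>Basis. \<beta> (\<xi> b) (\<xi> b)) = (\<Sum>f\<in>Basis. \<beta> f f)"
proof (rule sum_bilinear_orthonormal[OF \<beta> finite_Basis])
  fix x y
  have "(\<Sum>b\<in>Basis. (\<xi> b \<bullet> x) * (\<xi> b \<bullet> y)) = adjoint \<xi> x \<bullet> adjoint \<xi> y"
    by (simp add: parseval_Basis flip: adjoint_works[OF linear_\<xi>])
  also have "\<dots> = x \<bullet> y"
    by (metis \<xi>\<xi> adjoint_works[OF linear_\<xi>] inner_commute)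
  finally show "(\<Sum>b\<in>Basis. (\<xi> b \<bullet> x) * (\<xi> b \<bullet> y)) = x \<bullet> y" .
qed

lemma inner_UH_submersion:
  assumes "\<And>y. \<xi> (adjoint \<xi> y) = y"
  shows "UH \<bullet> y = (\<Sum>f\<in>Basis. br y f \<bullet> f)"
  unfolding inner_UH
  by (rule sum_submersion[OF assms, of "\<lambda>a b. br y a \<bullet> b"])
    (auto intro!: linearI simp: linear_rules inner_add_left inner_add_right)

lemma ad_skew_submersion:
  assumes \<xi>\<xi>: "\<And>y. \<xi> (adjoint \<xi> y) = y" and "\<tau>2 = 0" and "br (\<xi> UG) \<tau> \<bullet> \<tau> = 0"
  shows "br \<tau> x \<bullet> x = 0"
proof (rule skew_if_trace_zero[OF linear_br(1)])
  have "(\<Sum>b\<in>Basis. br \<tau> (\<xi> b) \<bullet> br \<tau> (\<xi> b) + br \<tau> (br \<tau> (\<xi> b)) \<bullet> \<xi> b) =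
      (\<Sum>f\<in>Basis. br \<tau> f \<bullet> br \<tau> f + br \<tau> (br \<tau> f) \<bullet> f)"
    by (rule sum_submersion[OF \<xi>\<xi>, of "\<lambda>a b. br \<tau> a \<bullet> br \<tau> b + br \<tau> (br \<tau> a) \<bullet> b"])
      (auto intro!: linearI simp: linear_rules inner_add_left inner_add_right algebra_simps)
  then show "(\<Sum>f\<in>Basis. br \<tau> f \<bullet> br \<tau> f + br \<tau> (br \<tau> f) \<bullet> f) = 0"
    using inner_\<tau>2 assms(2,3) by simp
qed

lemma case_submersion:
  assumes uni: "\<And>x. (\<Sum>b\<in>Basis. brG x b \<bullet> b) = 0" and \<xi>\<xi>: "\<And>y. \<xi> (adjoint \<xi> y) = y" and "\<tau>2 = 0"
  shows "\<tau> = 0"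
proof -
  have U: "UG = 0" by (rule UG_zero[OF uni])
  then have "br \<tau> x \<bullet> x = 0" for x
    using assms(3) by (intro ad_skew_submersion[OF \<xi>\<xi>]) (simp_all add: linear_0[OF linear_\<xi>] linear_0[OF linear_br(2)])
  then have "UH \<bullet> \<tau> = 0" by (simp add: inner_UH_submersion[OF \<xi>\<xi>])
  then show ?thesis using \<tau>_eq U linear_0[OF linear_\<xi>] by simp
qed

lemma case_dim_2:
  assumes \<xi>\<xi>: "\<And>y. \<xi> (adjoint \<xi> y) = y"
    and K: "finite K" "\<And>k. k \<in> K \<Longrightarrow> \<xi> k = 0" "\<And>x. \<xi> x = 0 \<Longrightarrow> x = (\<Sum>k\<in>K. (x \<bullet> k) *\<^sub>R k)"
    and uni: "\<And>x. \<xi> x = 0 \<Longrightarrow> (\<Sum>k\<in>K. brG x k \<bullet> k) = 0"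
    and dim: "DIM('f) = 2" and nonab: "br x0 y0 \<noteq> 0" and "\<tau>2 = 0"
  shows "\<tau> = 0"
proof (rule ccontr)
  assume \<tau>: "\<tau> \<noteq> 0"
  note adj = adjoint_works[OF linear_\<xi>]
  let ?a = "adjoint \<xi>"
  \<comment> \<open>The trace of the adjoint action on the kernel, which has orthonormal basis
    \<open>K\<close>.\<close>
  let ?\<rho> = "\<lambda>x. \<Sum>k\<in>K. brG x k \<bullet> k"
  have lin\<rho>: "linear ?\<rho>"
    by (rule linearI)
      (simp_all add: linear_add[OF linear_brG(2)] linear_scale[OF linear_brG(2)] inner_add_left sum.distrib sum_distrib_left)
  \<comment> \<open>Orthogonal decomposition into the kernel and the range of the adjoint, the
    latter being the horizontal part.\<close>
  have split: "x = (\<Sum>k\<in>K. (x \<bullet> k) *\<^sub>R k) + ?a (\<xi> x)" for x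
  proof -
    have z: "\<xi> (x - ?a (\<xi> x)) = 0" by (simp add: linear_diff[OF linear_\<xi>] \<xi>\<xi>)
    have "?a (\<xi> x) \<bullet> k = 0" if "k \<in> K" for k
      using K(2)[OF that] adj[of k "\<xi> x"] by (simp add: inner_commute)
    then have "(\<Sum>k\<in>K. ((x - ?a (\<xi> x)) \<bullet> k) *\<^sub>R k) = (\<Sum>k\<in>K. (x \<bullet> k) *\<^sub>R k)"
      by (simp add: inner_diff_left)
    then show ?thesis using K(3)[OF z] by (metis diff_add_cancel)
  qed
  \<comment> \<open>The kernel is an ideal with quotient the target algebra, so the trace of the
    adjoint action is the sum of the traces on the two.\<close>
  have tr: "(\<Sum>b\<in>Basis. brG x b \<bullet> b) = ?\<rho> x + (\<Sum>f\<in>Basis. br (\<xi> x) f \<bullet> f)" for x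
  proof -
    let ?T = "brG x"
    have "?T b \<bullet> b = (\<Sum>k\<in>K. (?T b \<bullet> k) * (k \<bullet> b)) + br (\<xi> x) (\<xi> b) \<bullet> \<xi> b" for b
    proof -
      have "?T b \<bullet> b = ((\<Sum>k\<in>K. (?T b \<bullet> k) *\<^sub>R k) + ?a (\<xi> (?T b))) \<bullet> b"
        using split[of "?T b"] by simp
      moreover have "?a (\<xi> (?T b)) \<bullet> b = br (\<xi> x) (\<xi> b) \<bullet> \<xi> b"
        using adj[of b "\<xi> (?T b)"] by (simp add: inner_commute \<xi>_br)
      ultimately show ?thesis by (simp only: inner_add_left inner_sum_left inner_scaleR_left)
    qed
    then have "(\<Sum>b\<in>Basis. ?T b \<bullet> b) = (\<Sum>b\<in>Basis. \<Sum>k\<in>K. (?T b \<bullet> k) * (k \<bullet> b)) +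
        (\<Sum>b\<in>Basis. br (\<xi> x) (\<xi> b) \<bullet> \<xi> b)" by (simp add: sum.distrib)
    also have "(\<Sum>b\<in>Basis. \<Sum>k\<in>K. (?T b \<bullet> k) * (k \<bullet> b)) = (\<Sum>k\<in>K. \<Sum>b\<in>Basis. (?T b \<bullet> k) * (k \<bullet> b))"
      by (rule sum.swap)
    also have "\<dots> = ?\<rho> x"
    proof (rule sum.cong[OF refl])
      fix k
      have "?T k = (\<Sum>b\<in>Basis. (k \<bullet> b) *\<^sub>R ?T b)" by (rule linear_euclidean_expand[OF linear_brG(1)])
      then show "(\<Sum>b\<in>Basis. (?T b \<bullet> k) * (k \<bullet> b)) = ?T k \<bullet> k"
        by (simp add: inner_sum_left mult.commute)
    qed
    finally show ?thesis using inner_UH inner_UH_submersion[OF \<xi>\<xi>] by simp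
  qed
  \<comment> \<open>The trace over the target occurs in \<open>UH\<close> and, through
    \<open>tr\<close>, in the image of \<open>UG\<close>; the difference leaves the trace over the
    kernel.\<close>
  have \<tau>_inner: "\<tau> \<bullet> y = - ?\<rho> (?a y)" for y
  proof -
    have "\<xi> UG \<bullet> y = UG \<bullet> ?a y" by (metis adj)
    then show ?thesis
      by (simp add: \<tau>_eq inner_diff_left inner_UG tr \<xi>\<xi> inner_UH_submersion[OF \<xi>\<xi>])
  qed
  \<comment> \<open>By the Jacobi identity a bracket acts on the kernel as a commutator of
    endomorphisms, and commutators have trace 0.\<close>
  have \<rho>br: "?\<rho> (brG a b) = 0" for a b
  proof -
    have ker: "brG c k = (\<Sum>l\<in>K. (brG c k \<bullet> l) *\<^sub>R l)" if "k \<in> K" for c k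
      using K(2)[OF that] by (intro K(3)) (simp add: \<xi>_br linear_0[OF linear_br(1)])
    have two: "brG a (brG b k) \<bullet> k = (\<Sum>l\<in>K. (brG b k \<bullet> l) * (brG a l \<bullet> k))" if "k \<in> K" for a b k
    proof -
      have "brG a (brG b k) = brG a (\<Sum>l\<in>K. (brG b k \<bullet> l) *\<^sub>R l)" using ker[OF that, of b] by simp
      also have "\<dots> = (\<Sum>l\<in>K. (brG b k \<bullet> l) *\<^sub>R brG a l)"
        by (simp add: linear_sum[OF linear_brG(1)] linear_scale[OF linear_brG(1)])
      finally show ?thesis by (simp add: inner_sum_left)
    qed
    have "brG (brG a b) k \<bullet> k = brG a (brG b k) \<bullet> k - brG b (brG a k) \<bullet> k" for k
      using G.br_jacobi[of a b k] by (simp add: inner_add_left)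
    then have "?\<rho> (brG a b) = (\<Sum>k\<in>K. brG a (brG b k) \<bullet> k) - (\<Sum>k\<in>K. brG b (brG a k) \<bullet> k)"
      by (simp add: sum_subtractf)
    also have "(\<Sum>k\<in>K. brG a (brG b k) \<bullet> k) = (\<Sum>k\<in>K. \<Sum>l\<in>K. (brG b k \<bullet> l) * (brG a l \<bullet> k))"
      using two by simp
    also have "\<dots> = (\<Sum>l\<in>K. \<Sum>k\<in>K. (brG a l \<bullet> k) * (brG b k \<bullet> l))"
      by (subst sum.swap) (simp add: mult.commute)
    also have "\<dots> = (\<Sum>k\<in>K. brG b (brG a k) \<bullet> k)" using two by simp
    finally show ?thesis by simp
  qed
  \<comment> \<open>The horizontal lift of a bracket and the bracket of the horizontal lifts differ
    by an element of the kernel, where \<open>?\<rho>\<close> is 0 by unimodularity.\<close>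
  have perp: "\<tau> \<bullet> br x y = 0" for x y
  proof -
    have "\<xi> (?a (br x y) - brG (?a x) (?a y)) = 0"
      by (simp add: linear_diff[OF linear_\<xi>] \<xi>\<xi> \<xi>_br)
    then have "?\<rho> (?a (br x y) - brG (?a x) (?a y)) = 0" by (rule uni)
    then show ?thesis using \<rho>br by (simp add: \<tau>_inner linear_diff[OF lin\<rho>])
  qed
  have skew: "br \<tau> x \<bullet> x = 0" for x
    by (rule ad_skew_submersion[OF \<xi>\<xi> assms(8)]) (metis perp inner_commute)
  let ?w = "br x0 y0"
  have tw: "\<tau> \<bullet> ?w = 0" by (rule perp)
  note zero = orthogonal_in_dim_2[OF dim \<tau> nonab tw]
  \<comment> \<open>This bracket is orthogonal to \<tau> by \<open>perp\<close> and to
    \<open>?w\<close> by skewness. In dimension two nothing else is left.\<close>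
  have \<tau>w: "br \<tau> ?w = 0" 
  proof (rule zero)
    show "br \<tau> ?w \<bullet> \<tau> = 0" by (metis perp inner_commute)
  qed (rule skew)
  have rep: "x = (x \<bullet> \<tau> / (\<tau> \<bullet> \<tau>)) *\<^sub>R \<tau> + (x \<bullet> ?w / (?w \<bullet> ?w)) *\<^sub>R ?w" for x
  proof -
    have "x - ((x \<bullet> \<tau> / (\<tau> \<bullet> \<tau>)) *\<^sub>R \<tau> + (x \<bullet> ?w / (?w \<bullet> ?w)) *\<^sub>R ?w) = 0"
      by (rule zero) (use \<tau> nonab tw in \<open>simp_all add: inner_diff_left inner_add_left inner_commute[of ?w \<tau>]\<close>)
    then show ?thesis by simp
  qed
  \<comment> \<open>\<tau> and \<open>?w\<close> commute and span the algebra by \<open>rep\<close>,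
    so every bracket would vanish, contrary to the choice of \<open>x0\<close> and
    \<open>y0\<close>.\<close>
  have "br ?w \<tau> = 0" using \<tau>w br_skew[of ?w \<tau>] by simp
  then have "br (a *\<^sub>R \<tau> + b *\<^sub>R ?w) (c *\<^sub>R \<tau> + d *\<^sub>R ?w) = 0" for a b c d
    using \<tau>w br_self by (simp add: linear_rules)
  then have "br x0 y0 = 0" using rep[of x0] rep[of y0] by metis
  then show False using nonab by simp
qed

end

section \<open>Left invariant frames\<close>

text \<open>Gram-Schmidt for an inner product other than the built-in one; \<sigma> sends the
  standard basis to an orthonormal one. It transports the metric at the identity to the model
  space.\<close>

lemma inner_product_orthonormalize:
  fixes ip :: "'e::euclidean_space \<Rightarrow> 'e \<Rightarrow> real"
  assumes lin: "\<And>y. linear (\<lambda>x. ip x y)" and sym: "\<And>x y. ip x y = ip y x"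
    and pos: "\<And>x. x \<noteq> 0 \<Longrightarrow> ip x x > 0"
  obtains \<sigma> :: "'e \<Rightarrow> 'e" where "linear \<sigma>" "bij \<sigma>" "\<And>x y. ip (\<sigma> x) (\<sigma> y) = x \<bullet> y"
proof -
  have lin': "linear (ip x)" for x
  proof -
    have "ip x = (\<lambda>y. ip y x)" using sym by blast
    then show ?thesis using lin[of x] by simp
  qed
  have "\<exists>u. \<forall>i<m. \<forall>j<m. ip (u i) (u j) = (if i = j then 1 else 0)" if "m \<le> DIM('e)" for m :: nat
    using that
  proof (induction m)
    case (Suc m)
    then obtain u where u: "\<And>i j. i < m \<Longrightarrow> j < m \<Longrightarrow> ip (u i) (u j) = (if i = j then 1 else 0)" by auto
    have "dim (u ` {..<m}) \<le> card (u ` {..<m})" by (rule dim_le_card') simp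
    also have "\<dots> \<le> m" using card_image_le[of "{..<m}" u] by simp
    \<comment> \<open>As long as \<open>m\<close> is below the dimension, some vector lies outside
      the span, so its remainder \<open>b\<close> after projection is nonzero and can be
      normalized.\<close>
    finally have "span (u ` {..<m}) \<noteq> UNIV" using Suc.prems
      by (metis Suc_n_not_le_n dim_UNIV dim_span le_trans)
    then obtain a where a: "a \<notin> span (u ` {..<m})" by blast
    define b where "b = a - (\<Sum>i<m. ip a (u i) *\<^sub>R u i)"
    have "(\<Sum>i<m. ip a (u i) *\<^sub>R u i) \<in> span (u ` {..<m})"
      by (intro span_sum span_scale span_base) auto
    then have b0: "b \<noteq> 0" using a by (auto simp: b_def)
    have orth: "ip b (u j) = 0" if "j < m" for j
    proof -
      have "ip b (u j) = ip a (u j) - (\<Sum>i<m. ip a (u i) * ip (u i) (u j))"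
        by (simp add: b_def linear_diff[OF lin] linear_sum[OF lin] linear_scale[OF lin])
      also have "(\<Sum>i<m. ip a (u i) * ip (u i) (u j)) = (\<Sum>i<m. if i = j then ip a (u i) else 0)"
        by (intro sum.cong refl) (use u that in auto)
      finally show ?thesis using that by simp
    qed
    define c where "c = b /\<^sub>R sqrt (ip b b)"
    have "ip c c = inverse (sqrt (ip b b)) * (inverse (sqrt (ip b b)) * ip b b)"
      unfolding c_def linear_scale[OF lin] linear_scale[OF lin'] by simp
    then have "ip c c = 1"
      using pos[OF b0] real_sqrt_mult_self[of "ip b b"] by (simp add: field_simps)
    moreover have "ip c (u j) = 0" if "j < m" for j
      using orth[OF that] by (simp add: c_def linear_scale[OF lin])
    ultimately have "\<forall>i<Suc m. \<forall>j<Suc m. ip ((u(m := c)) i) ((u(m := c)) j) = (if i = j then 1 else 0)"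
      using u sym by (auto simp: less_Suc_eq)
    then show ?case by blast
  qed simp
  then obtain u where u: "\<And>i j. i < DIM('e) \<Longrightarrow> j < DIM('e) \<Longrightarrow> ip (u i) (u j) = (if i = j then 1 else 0)"
    by blast
  obtain e where e: "bij_betw e {..<DIM('e)} (Basis::'e set)"
    using ex_bij_betw_nat_finite[OF finite_Basis] by (metis atLeast0LessThan)
  define \<sigma> :: "'e \<Rightarrow> 'e" where "\<sigma> x = (\<Sum>i<DIM('e). (x \<bullet> e i) *\<^sub>R u i)" for x
  have l\<sigma>: "linear \<sigma>"
    by (rule linearI) (simp_all add: \<sigma>_def inner_add_left scaleR_add_left sum.distrib scaleR_sum_right)
  have ip\<sigma>: "ip (\<sigma> x) (\<sigma> y) = x \<bullet> y" for x y
  proof -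
    have "ip (\<sigma> x) (\<sigma> y) = (\<Sum>i<DIM('e). (x \<bullet> e i) * (\<Sum>j<DIM('e). (y \<bullet> e j) * ip (u i) (u j)))"
    proof -
      have 1: "ip (\<sigma> x) z = (\<Sum>i<DIM('e). (x \<bullet> e i) * ip (u i) z)" for z
        by (simp add: \<sigma>_def linear_sum[OF lin] linear_scale[OF lin])
      have 2: "ip z (\<sigma> y) = (\<Sum>j<DIM('e). (y \<bullet> e j) * ip z (u j))" for z
        by (simp add: \<sigma>_def linear_sum[OF lin'] linear_scale[OF lin'])
      show ?thesis by (subst 1) (simp only: 2)
    qed
    also have "\<dots> = (\<Sum>i<DIM('e). (x \<bullet> e i) * (y \<bullet> e i))"
    proof (intro sum.cong refl arg_cong2[of _ _ _ _ "(*)"])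
      fix i assume "i \<in> {..<DIM('e)}"
      then have "(\<Sum>j<DIM('e). (y \<bullet> e j) * ip (u i) (u j)) = (\<Sum>j<DIM('e). if i = j then y \<bullet> e j else 0)"
        by (intro sum.cong refl) (use u in auto)
      then show "(\<Sum>j<DIM('e). (y \<bullet> e j) * ip (u i) (u j)) = y \<bullet> e i" using \<open>i \<in> _\<close> by simp
    qed
    also have "\<dots> = (\<Sum>b\<in>Basis. (x \<bullet> b) * (y \<bullet> b))"
      by (rule sum.reindex_bij_betw[OF e])
    finally show ?thesis by (simp add: euclidean_inner[of x y])
  qed
  have "inj \<sigma>"
    unfolding linear_injective_0[OF l\<sigma>]
  proof (intro allI impI)
    fix x assume "\<sigma> x = 0"
    then have "x \<bullet> x = 0" using ip\<sigma>[of x x] linear_0[OF lin] by simp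
    then show "x = 0" by simp
  qed
  then have "bij \<sigma>" using linear_injective_imp_surjective[OF l\<sigma>] by (simp add: bij_def)
  from that[OF l\<sigma> this ip\<sigma>] show thesis .
qed

lemma pushforward_compose:
  assumes "charted B" "charted C" "smooth_map B C \<psi>"
  shows "pushforward C \<psi> (pushforward B \<phi> v) = pushforward C (\<lambda>x. \<psi> (\<phi> x)) v"
  using smooth_functions_compose[OF assms] by (auto simp: pushforward_def fun_eq_iff o_def)

lemma pushforward_ident: "v \<in> tangent_space A p \<Longrightarrow> pushforward A (\<lambda>x. x) v = v"
  using tangent_space_not_smooth by (fastforce simp: pushforward_def o_def)

lemma bracket_in_tangent_space:
  assumes A: "charted A" and X: "X \<in> vector_fields A" and Y: "Y \<in> vector_fields A"
  shows "bracket X Y p \<in> tangent_space A p"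
proof (rule tangent_spaceI)
  note Xp = vector_fieldsD(1)[OF X] and Yp = vector_fieldsD(1)[OF Y]
  note Xs = vector_fieldsD(2)[OF X] and Ys = vector_fieldsD(2)[OF Y]
  fix f h a assume f: "f \<in> smooth_functions A"
  show "bracket X Y p (\<lambda>x. a * f x) = a * bracket X Y p f"
    by (simp add: bracket_def tangent_space_scale[OF Xp] tangent_space_scale[OF Yp] f Xs[OF f] Ys[OF f] algebra_simps)
  assume h: "h \<in> smooth_functions A"
  show "bracket X Y p (\<lambda>x. f x + h x) = bracket X Y p f + bracket X Y p h"
    by (simp add: bracket_def tangent_spaceD(1)[OF Xp] tangent_spaceD(1)[OF Yp] f h Xs Ys)
  show "bracket X Y p (\<lambda>x. f x * h x) = bracket X Y p f * h p + f p * bracket X Y p h"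
    by (simp add: bracket_def tangent_spaceD[OF Xp] tangent_spaceD[OF Yp] f h Xs Ys
        smooth_functions_mult[OF A] algebra_simps)
next
  fix f assume f: "f \<notin> smooth_functions A"
  then have "X q f = 0" "Y q f = 0" for q
    using tangent_space_not_smooth[OF vector_fieldsD(1)[OF X] f] tangent_space_not_smooth[OF vector_fieldsD(1)[OF Y] f]
    by auto
  then show "bracket X Y p f = 0"
    by (simp add: bracket_def tangent_const[OF A vector_fieldsD(1)[OF X]] tangent_const[OF A vector_fieldsD(1)[OF Y]])
qed

locale lie =
  fixes G :: "'g::{t2_space,second_countable_topology} monoid"
    and A :: "('g, 'e::euclidean_space) atlas" and g :: "'g metric"
  assumes riemannian_lie: "riemannian_lie_group G A g" and open_mfd: "open_manifold A"
begin

abbreviation mul (infixl "\<cdot>" 70) where "x \<cdot> y \<equiv> x \<otimes>\<^bsub>G\<^esub> y"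
abbreviation (input) e where "e \<equiv> \<one>\<^bsub>G\<^esub>"
abbreviation iv where "iv x \<equiv> inv\<^bsub>G\<^esub> x"
abbreviation (input) T where "T \<equiv> tangent_space A e"

lemma lie: "lie_group G A" and metric: "riemannian_metric A g"
  and invariant: "u \<in> tangent_space A x \<Longrightarrow> v \<in> tangent_space A x \<Longrightarrow>
    g (a \<cdot> x) (pushforward A (\<lambda>y. a \<cdot> y) u) (pushforward A (\<lambda>y. a \<cdot> y) v) = g x u v"
  using riemannian_lie by (auto simp: riemannian_lie_group_def)

lemma group: "Group.group G" and carrier: "carrier G = UNIV"
  using lie by (auto simp: lie_group_def)

lemma assoc: "x \<cdot> y \<cdot> z = x \<cdot> (y \<cdot> z)"
  and mul_one [simp]: "x \<cdot> e = x" "e \<cdot> x = x"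
  and mul_inv [simp]: "x \<cdot> iv x = e" "iv x \<cdot> x = e"
  and iv_one [simp]: "iv e = e"
  and iv_mul: "iv (x \<cdot> y) = iv y \<cdot> iv x"
  using group carrier
  by (simp_all add: group.is_monoid monoid.m_assoc monoid.r_one monoid.l_one group.r_inv group.l_inv
      monoid.inv_one group.inv_mult_group)

lemma cancel [simp]: "x \<cdot> (iv x \<cdot> y) = y" "iv x \<cdot> (x \<cdot> y) = y"
  by (simp_all flip: assoc)

lemma cA: "charted A" by (rule open_manifold_charted[OF open_mfd])

lemma smooth_iv: "smooth_map A A iv"
  using lie by (simp add: lie_group_def)

lemma smooth_mul:
  assumes "charted C" "smooth_map C A \<phi>" "smooth_map C A \<psi>"
  shows "smooth_map C A (\<lambda>x. \<phi> x \<cdot> \<psi> x)"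
proof -
  have "smooth_map (prod_atlas A A) A (\<lambda>(x, y). x \<cdot> y)" using lie by (simp add: lie_group_def)
  from smooth_map_compose[OF assms(1) charted_prod[OF cA cA] cA smooth_map_Pair[OF assms(1) cA cA assms(2,3)] this]
  show ?thesis by simp
qed

lemma smooth_left: "smooth_map A A (\<lambda>y. a \<cdot> y)" and smooth_right: "smooth_map A A (\<lambda>y. y \<cdot> a)"
  by (intro smooth_mul cA smooth_map_const smooth_map_id open_mfd)+

lemma smooth_mul_fun: "f \<in> smooth_functions A \<Longrightarrow> (\<lambda>z. f (fst z \<cdot> snd z)) \<in> smooth_functions (prod_atlas A A)"
  by (rule smooth_functions_compose[OF charted_prod[OF cA cA] cA
        smooth_mul[OF charted_prod[OF cA cA] smooth_map_fst[OF open_mfd open_mfd] smooth_map_snd[OF open_mfd open_mfd]]])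

lemma smooth_left_fun: "f \<in> smooth_functions A \<Longrightarrow> (\<lambda>y. f (a \<cdot> y)) \<in> smooth_functions A"
  by (rule smooth_functions_compose[OF cA cA smooth_left])

abbreviation LI where "LI \<equiv> left_invariant_field G A"

lemma LI_apply: "f \<in> smooth_functions A \<Longrightarrow> LI u p f = u (\<lambda>q. f (p \<cdot> q))"
  by (simp add: left_invariant_field_def pushforward_def o_def)

lemma LI_in: "u \<in> T \<Longrightarrow> LI u p \<in> tangent_space A p"
  using pushforward_in[OF cA cA smooth_left, of u e p] by (simp add: left_invariant_field_def)

lemma LI_field: "u \<in> T \<Longrightarrow> LI u \<in> vector_fields A"
  using smooth_partial_const[OF open_mfd open_mfd _ smooth_mul_fun, of u e]
  by (auto simp: vector_fields_def fields_along_def LI_in LI_apply)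

lemma LI_one: "u \<in> T \<Longrightarrow> LI u e = u"
proof -
  have "(\<lambda>q. e \<cdot> q) = (\<lambda>q. q)" by (rule ext) simp
  then show "u \<in> T \<Longrightarrow> LI u e = u" by (simp only: left_invariant_field_def pushforward_ident)
qed

lemma LI_linear: "linear (\<lambda>u. LI u p)"
  unfolding left_invariant_field_def by (rule linear_pushforward)

lemma LI_translate:
  assumes "v \<in> tangent_space A p"
  shows "pushforward A (\<lambda>q. iv p \<cdot> q) v \<in> T" "LI (pushforward A (\<lambda>q. iv p \<cdot> q) v) p = v"
  using pushforward_in[OF cA cA smooth_left assms, of "iv p"]
  by (simp_all add: left_invariant_field_def pushforward_compose[OF cA cA smooth_left] pushforward_ident[OF assms])

lemma LI_inner: "u \<in> T \<Longrightarrow> v \<in> T \<Longrightarrow> g p (LI u p) (LI v p) = g e u v"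
  using invariant[of u e v p] by (simp add: left_invariant_field_def)

lemma lie_bracket_in: "u \<in> T \<Longrightarrow> v \<in> T \<Longrightarrow> lie_bracket G A u v \<in> T"
  unfolding lie_bracket_def by (intro bracket_in_tangent_space cA LI_field)

lemma LI_LI_apply:
  assumes "u \<in> T" "v \<in> T" "f \<in> smooth_functions A"
  shows "LI u p (\<lambda>q. LI v q f) = u (\<lambda>x. v (\<lambda>y. f (p \<cdot> x \<cdot> y)))"
  using LI_apply[OF vector_fieldsD(2)[OF LI_field[OF assms(2)] assms(3)], of u p] by (simp add: LI_apply assms)

lemma lie_bracket_apply:
  assumes "u \<in> T" "v \<in> T" "f \<in> smooth_functions A"
  shows "lie_bracket G A u v f = u (\<lambda>x. v (\<lambda>y. f (x \<cdot> y))) - v (\<lambda>x. u (\<lambda>y. f (x \<cdot> y)))"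
  using assms by (simp add: lie_bracket_def bracket_def LI_LI_apply)

text \<open>By associativity, applying both fields at \<open>p\<close> to \<open>f\<close> amounts
  to differentiating \<open>f (p \<cdot> (x \<cdot> y))\<close> at the identity, that is, to taking
  the bracket at the identity of a left translate of \<open>f\<close>.\<close>

lemma bracket_LI:
  assumes "u \<in> T" "v \<in> T"
  shows "bracket (LI u) (LI v) = LI (lie_bracket G A u v)"
proof (intro ext)
  fix p f
  have t: "bracket (LI u) (LI v) p \<in> tangent_space A p" "LI (lie_bracket G A u v) p \<in> tangent_space A p"
    by (intro bracket_in_tangent_space cA LI_field LI_in lie_bracket_in assms)+
  show "bracket (LI u) (LI v) p f = LI (lie_bracket G A u v) p f"
  proof (cases "f \<in> smooth_functions A")
    case True
    show ?thesis
      unfolding bracket_def LI_LI_apply[OF assms True] LI_LI_apply[OF assms(2,1) True]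
        LI_apply[OF True, of "lie_bracket G A u v"] lie_bracket_apply[OF assms smooth_left_fun[OF True]] assoc ..
  next
    case False
    then show ?thesis using t tangent_space_not_smooth by metis
  qed
qed

lemma ex_isometry:
  "\<exists>\<iota>. linear \<iota> \<and> bij_betw \<iota> (UNIV :: 'e set) T \<and> (\<forall>x y. g e (\<iota> x) (\<iota> y) = x \<bullet> y)"
proof -
  obtain U c where Uc: "(U, c) \<in> A" "e \<in> U" using charted_at[OF cA] by blast
  let ?k = "chart_vector A U c e"
  have k: "linear ?k" "bij_betw ?k UNIV T" "?k x \<in> T" for x
    using linear_chart_vector[OF cA Uc] chart_vector_bij[OF open_mfd Uc] chart_vector_in[OF cA Uc] by auto
  note m = metric[unfolded riemannian_metric_def]
  have gl: "g e (a *\<^sub>R u + b *\<^sub>R v) w = a * g e u w + b * g e v w" and gs: "g e u w = g e w u"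
    if "u \<in> T" "v \<in> T" "w \<in> T" for a b u v w
    using m that by blast+
  have "linear (\<lambda>x. g e (?k x) (?k y))" for y
  proof (rule linearI)
    show "g e (?k (a + b)) (?k y) = g e (?k a) (?k y) + g e (?k b) (?k y)" for a b
      using gl[OF k(3) k(3) k(3), of 1 a 1 b y] by (simp add: linear_add[OF k(1)])
    show "g e (?k (r *\<^sub>R b)) (?k y) = r *\<^sub>R g e (?k b) (?k y)" for r b
      using gl[OF k(3) k(3) k(3), of r b 0 b y] by (simp add: linear_scale[OF k(1)])
  qed
  moreover have "g e (?k x) (?k y) = g e (?k y) (?k x)" for x y using gs k(3) by blast
  moreover have "g e (?k x) (?k x) > 0" if "x \<noteq> 0" for x
  proof -
    have "?k x \<noteq> ?k 0" using k(2) that by (auto simp: bij_betw_def inj_on_def)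
    then have "?k x \<noteq> 0" using linear_0[OF k(1)] by simp
    then show ?thesis using m k(3) by blast
  qed
  ultimately obtain \<sigma> :: "'e \<Rightarrow> 'e" where s: "linear \<sigma>" "bij \<sigma>" "\<And>x y. g e (?k (\<sigma> x)) (?k (\<sigma> y)) = x \<bullet> y"
    using inner_product_orthonormalize[of "\<lambda>x y. g e (?k x) (?k y)"] by blast
  show ?thesis
  proof (intro exI conjI allI)
    show "linear (?k \<circ> \<sigma>)" by (rule linear_compose[OF s(1) k(1)])
    show "bij_betw (?k \<circ> \<sigma>) UNIV T" by (rule bij_betw_trans[OF s(2) k(2)])
    show "g e ((?k \<circ> \<sigma>) x) ((?k \<circ> \<sigma>) y) = x \<bullet> y" for x y by (simp add: s(3))
  qed
qed

definition \<iota> :: "'e \<Rightarrow> 'g tvec" where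
  "\<iota> = (SOME \<iota>. linear \<iota> \<and> bij_betw \<iota> UNIV T \<and> (\<forall>x y. g e (\<iota> x) (\<iota> y) = x \<bullet> y))"

lemma \<iota>: "linear \<iota>" "bij_betw \<iota> UNIV T" "g e (\<iota> x) (\<iota> y) = x \<bullet> y"
  using someI_ex[OF ex_isometry] unfolding \<iota>_def by blast+

lemma \<iota>_in: "\<iota> x \<in> T" using \<iota>(2) by (auto simp: bij_betw_def)

lemma \<iota>_inj: "\<iota> x = \<iota> y \<longleftrightarrow> x = y"
  using \<iota>(2) by (auto simp: bij_betw_def inj_on_def)

lemma \<iota>_surj: "v \<in> T \<Longrightarrow> \<iota> (inv_into UNIV \<iota> v) = v"
  using \<iota>(2) by (metis bij_betw_def f_inv_into_f)

definition \<Lambda> :: "'e \<Rightarrow> 'g \<Rightarrow> 'g tvec" where "\<Lambda> x = LI (\<iota> x)"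

definition br :: "'e \<Rightarrow> 'e \<Rightarrow> 'e" where "br x y = inv_into UNIV \<iota> (lie_bracket G A (\<iota> x) (\<iota> y))"

lemma \<iota>_br: "\<iota> (br x y) = lie_bracket G A (\<iota> x) (\<iota> y)"
  unfolding br_def by (intro \<iota>_surj lie_bracket_in \<iota>_in)

sublocale framed A g \<Lambda> br
proof (rule framed.intro)
  show "linear (\<lambda>x. \<Lambda> x q)" for q
    using linear_compose[OF \<iota>(1) LI_linear[of q]] by (simp add: \<Lambda>_def o_def)
  show "range (\<lambda>x. \<Lambda> x q) = tangent_space A q" for q
  proof (intro equalityI subsetI)
    fix v assume "v \<in> tangent_space A q"
    then show "v \<in> range (\<lambda>x. \<Lambda> x q)"
      using LI_translate(2)[of v q] \<iota>_surj[OF LI_translate(1), of v q] unfolding \<Lambda>_def by (metis rangeI)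
  qed (auto simp: \<Lambda>_def LI_in \<iota>_in)
  show "\<Lambda> x \<in> vector_fields A" for x by (simp add: \<Lambda>_def LI_field \<iota>_in)
  show "g q (\<Lambda> x q) (\<Lambda> y q) = x \<bullet> y" for q x y by (simp add: \<Lambda>_def LI_inner \<iota>_in \<iota>(3))
  show "bracket (\<Lambda> x) (\<Lambda> y) = \<Lambda> (br x y)" for x y
    by (simp add: \<Lambda>_def bracket_LI \<iota>_in \<iota>_br)
qed (rule open_mfd metric)+

text \<open>A smooth function with prescribed differential at the identity. Left translates of it
  read off the frame coefficients of a vector at any point.\<close>

lemma dual_function:
  obtains f where "f \<in> smooth_functions A" "\<And>x. \<iota> x f = x \<bullet> k"
proof -
  obtain U c where Uc: "(U, c) \<in> A" "e \<in> U" using charted_at[OF cA] by blast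
  obtain \<xi> W where \<xi>: "e \<in> W" "\<And>b. \<xi> b \<in> smooth_functions A"
    "\<And>p b a. p \<in> W \<Longrightarrow> b \<in> Basis \<Longrightarrow> chart_deriv U c (\<xi> b) p a = a \<bullet> b"
    using chart_coordinates[OF open_mfd Uc] by metis
  let ?k = "chart_vector A U c e"
  have k: "linear ?k" "bij_betw ?k UNIV T"
    using linear_chart_vector[OF cA Uc] chart_vector_bij[OF open_mfd Uc] by auto
  define \<sigma> where "\<sigma> b = inv_into UNIV \<iota> (?k b)" for b
  have k\<sigma>: "?k b = \<iota> (\<sigma> b)" for b
    unfolding \<sigma>_def using \<iota>_surj chart_vector_in[OF cA Uc] by simp
  have "\<iota> (\<sigma> (a + b)) = \<iota> (\<sigma> a + \<sigma> b)" "\<iota> (\<sigma> (r *\<^sub>R a)) = \<iota> (r *\<^sub>R \<sigma> a)" for a b r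
    by (simp_all add: linear_add[OF \<iota>(1)] linear_scale[OF \<iota>(1)] linear_add[OF k(1)] linear_scale[OF k(1)] flip: k\<sigma>)
  then have l\<sigma>: "linear \<sigma>" by (intro linearI) (simp_all add: \<iota>_inj)
  \<comment> \<open>The chart vector of \<open>b\<close> is \<open>\<iota> (\<sigma> b)\<close>, so
    the covector \<open>k\<close> becomes \<open>adjoint \<sigma> k\<close> in chart
    coordinates.\<close>
  let ?f = "\<lambda>p. \<Sum>i\<in>Basis. (adjoint \<sigma> k \<bullet> i) * \<xi> i p"
  have f: "?f \<in> smooth_functions A"
    by (intro smooth_functions_sum[OF cA] smooth_functions_mult[OF cA] smooth_functions_const[OF cA] \<xi>)
  have "\<iota> x ?f = x \<bullet> k" for x
  proof -
    obtain b where b: "?k b = \<iota> x" using k(2) \<iota>_in by (metis bij_betw_def imageE)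
    then have "\<sigma> b = x" by (simp add: k\<sigma> \<iota>_inj)
    have bi: "?k b (\<xi> i) = b \<bullet> i" if "i \<in> Basis" for i
      using \<xi> that by (simp add: chart_vector_def)
    have "\<iota> x ?f = (\<Sum>i\<in>Basis. (adjoint \<sigma> k \<bullet> i) * (b \<bullet> i))"
      using bi smooth_functions_mult[OF cA smooth_functions_const[OF cA] \<xi>(2)]
      unfolding b[symmetric]
      by (simp add: tangent_sum[OF cA chart_vector_in[OF cA Uc]] tangent_space_scale[OF chart_vector_in[OF cA Uc] \<xi>(2)])
    also have "\<dots> = b \<bullet> adjoint \<sigma> k" unfolding euclidean_inner[symmetric] by (rule inner_commute)
    also have "\<dots> = x \<bullet> k" using adjoint_works[OF l\<sigma>] \<open>\<sigma> b = x\<close> by metis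
    finally show ?thesis .
  qed
  then show thesis using f that by blast
qed

text \<open>The \<open>k\<close>-th coefficient of \<open>V p\<close> is its value on the dual
  function translated to \<open>\<phi> p\<close>. The translates form a smooth function of two
  variables, so \<open>smooth_partial\<close> applies.\<close>

lemma framed_map_lie:
  assumes C: "open_manifold C" and \<phi>: "smooth_map C A \<phi>"
  shows "framed_map A g \<Lambda> br C \<phi>"
proof
  note cC = open_manifold_charted[OF C]
  fix V k assume V: "V \<in> fields_along C A \<phi>"
  obtain f where f: "f \<in> smooth_functions A" "\<And>x. \<iota> x f = x \<bullet> k" using dual_function by blast
  note P = charted_prod[OF cC cA]
  have "(\<lambda>z. f (iv (\<phi> (fst z)) \<cdot> snd z)) \<in> smooth_functions (prod_atlas C A)"
    by (intro smooth_functions_compose[OF P cA _ f(1)] smooth_mul[OF P] smooth_map_snd[OF C open_mfd]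
        smooth_map_compose[OF P cA cA _ smooth_iv] smooth_map_compose[OF P cC cA smooth_map_fst[OF C open_mfd] \<phi>])
  from smooth_partial[OF C open_mfd \<phi> V this]
  have "(\<lambda>p. V p (\<lambda>y. f (iv (\<phi> p) \<cdot> y))) \<in> smooth_functions C" by simp
  moreover have "V p (\<lambda>y. f (iv (\<phi> p) \<cdot> y)) = g (\<phi> p) (V p) (\<Lambda> k (\<phi> p))" for p
  proof -
    have Vp: "V p \<in> tangent_space A (\<phi> p)" using V by (simp add: fields_along_def)
    define x where "x = coframe (\<phi> p) (V p)"
    have "V p = LI (\<iota> x) (\<phi> p)" using frame_coframe[OF Vp] by (simp add: \<Lambda>_def x_def)
    then have "V p (\<lambda>y. f (iv (\<phi> p) \<cdot> y)) = LI (\<iota> x) (\<phi> p) (\<lambda>y. f (iv (\<phi> p) \<cdot> y))" by simp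
    also have "\<dots> = x \<bullet> k" by (simp add: LI_apply[OF smooth_left_fun[OF f(1)]] f(2))
    finally show ?thesis by (simp add: x_def coframe_inner[OF Vp])
  qed
  ultimately show "(\<lambda>p. g (\<phi> p) (V p) (\<Lambda> k (\<phi> p))) \<in> smooth_functions C" by simp
qed (rule C \<phi>)+

section \<open>The adjoint representation\<close>

definition RI :: "'g tvec \<Rightarrow> 'g \<Rightarrow> 'g tvec" where "RI w p = pushforward A (\<lambda>q. q \<cdot> p) w"

lemma RI_apply: "f \<in> smooth_functions A \<Longrightarrow> RI w p f = w (\<lambda>q. f (q \<cdot> p))"
  by (simp add: RI_def pushforward_def o_def)

lemma RI_in: "w \<in> T \<Longrightarrow> RI w p \<in> tangent_space A p"
  using pushforward_in[OF cA cA smooth_right, of w e p] by (simp add: RI_def)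

lemma RI_field: "w \<in> T \<Longrightarrow> RI w \<in> vector_fields A"
  using smooth_partial_const[OF open_mfd open_mfd _ smooth_swap[OF open_mfd open_mfd smooth_mul_fun], of w e]
  by (auto simp: vector_fields_def fields_along_def RI_in RI_apply)

text \<open>The two fields differentiate \<open>f (y \<cdot> p \<cdot> x)\<close> in the independent
  variables \<open>x\<close> and \<open>y\<close>, and these derivatives commute.\<close>

lemma bracket_LI_RI:
  assumes "u \<in> T" "w \<in> T"
  shows "bracket (LI u) (RI w) p = 0"
proof
  fix f
  have t: "bracket (LI u) (RI w) p \<in> tangent_space A p"
    by (intro bracket_in_tangent_space cA LI_field RI_field assms)
  show "bracket (LI u) (RI w) p f = 0 f"
  proof (cases "f \<in> smooth_functions A")
    case True
    have K: "(\<lambda>z. f (snd z \<cdot> p \<cdot> fst z)) \<in> smooth_functions (prod_atlas A A)"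
      by (intro smooth_functions_compose[OF charted_prod[OF cA cA] cA _ True] smooth_mul charted_prod cA
          smooth_map_fst smooth_map_snd open_mfd smooth_map_const)
    have "LI u p (\<lambda>q. RI w q f) = u (\<lambda>x. w (\<lambda>y. f (y \<cdot> p \<cdot> x)))"
      using LI_apply[OF vector_fieldsD(2)[OF RI_field[OF assms(2)] True], of u p] True
      by (simp add: RI_apply assoc)
    moreover have "RI w p (\<lambda>q. LI u q f) = w (\<lambda>y. u (\<lambda>x. f (y \<cdot> p \<cdot> x)))"
      using RI_apply[OF vector_fieldsD(2)[OF LI_field[OF assms(1)] True], of w p] True
      by (simp add: LI_apply assoc)
    moreover have "u (\<lambda>x. w (\<lambda>y. f (y \<cdot> p \<cdot> x))) = w (\<lambda>y. u (\<lambda>x. f (y \<cdot> p \<cdot> x)))"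
      using tangent_commute[OF open_mfd open_mfd K assms] by simp
    ultimately show ?thesis by (simp add: bracket_def)
  next
    case False
    then show ?thesis using t tangent_space_not_smooth by fastforce
  qed
qed

text \<open>In the usual notation this is the adjoint action of the inverse of \<open>p\<close>, see
  \<open>\<iota>_Ad\<close>. As the coefficient vector of a right invariant field it is smooth in
  \<open>p\<close> at once.\<close>

definition Ad :: "'g \<Rightarrow> 'e \<Rightarrow> 'e" where "Ad p w = coef id (RI (\<iota> w)) p"

lemma frame_Ad: "\<Lambda> (Ad p w) p = RI (\<iota> w) p"
  using vector_eq_frame[OF RI_field[OF \<iota>_in], of w p] by (simp add: Ad_def)

lemma \<iota>_Ad: "\<iota> (Ad p w) = pushforward A (\<lambda>y. iv p \<cdot> (y \<cdot> p)) (\<iota> w)"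
proof -
  have "pushforward A (\<lambda>q. iv p \<cdot> q) (\<Lambda> (Ad p w) p) = \<iota> (Ad p w)"
    by (simp add: \<Lambda>_def left_invariant_field_def pushforward_compose[OF cA cA smooth_left] pushforward_ident[OF \<iota>_in])
  then show ?thesis
    unfolding frame_Ad RI_def by (simp add: pushforward_compose[OF cA cA smooth_left])
qed

lemma Ad_one: "Ad e w = w"
  using \<iota>_Ad[of e w] by (simp add: pushforward_ident[OF \<iota>_in] \<iota>_inj)

lemma linear_Ad: "linear (Ad p)"
proof (rule linearI)
  have "\<iota> (Ad p (x + y)) = \<iota> (Ad p x + Ad p y)" "\<iota> (Ad p (r *\<^sub>R x)) = \<iota> (r *\<^sub>R Ad p x)" for x y r
    by (simp_all add: linear_add[OF \<iota>(1)] linear_scale[OF \<iota>(1)] \<iota>_Ad pushforward_add pushforward_scale)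
  then show "Ad p (x + y) = Ad p x + Ad p y" "Ad p (r *\<^sub>R x) = r *\<^sub>R Ad p x" for x y r
    by (simp_all add: \<iota>_inj)
qed

lemma smooth_Ad: "smooth_vec A (\<lambda>p. Ad p w)"
  unfolding Ad_def by (rule smooth_coef_id[OF RI_field[OF \<iota>_in]])

text \<open>Left and right invariant fields commute; expanding the latter in the left invariant frame
  gives the derivative of \<open>Ad\<close>, which is taken at the inverse point here, whence the sign.\<close>

lemma derivative_Ad: "tangent_vec (\<Lambda> u p) (\<lambda>p. Ad p w) = - br u (Ad p w)"
proof -
  have "bracket (\<Lambda> u) (RI (\<iota> w)) p = \<Lambda> (tangent_vec (\<Lambda> u p) (coef id (RI (\<iota> w))) -
      tangent_vec (RI (\<iota> w) p) (coef id (\<Lambda> u)) + br (coef id (\<Lambda> u) p) (coef id (RI (\<iota> w)) p)) p"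
    by (rule bracket_frame[OF frame_field RI_field[OF \<iota>_in]])
  moreover have "coef id (\<Lambda> u) = (\<lambda>_. u)" by (rule ext) (simp add: coef_def)
  moreover have "bracket (\<Lambda> u) (RI (\<iota> w)) p = \<Lambda> 0 p"
    using bracket_LI_RI[OF \<iota>_in \<iota>_in] linear_0[OF linear_frame] by (simp add: \<Lambda>_def)
  ultimately have "tangent_vec (\<Lambda> u p) (coef id (RI (\<iota> w))) + br u (coef id (RI (\<iota> w)) p) = 0"
    by (simp add: frame_eq_iff tangent_vec_const[OF cA RI_in[OF \<iota>_in]])
  moreover have "coef id (RI (\<iota> w)) = (\<lambda>p. Ad p w)" by (simp add: Ad_def fun_eq_iff)
  ultimately show ?thesis by (simp add: eq_neg_iff_add_eq_0)
qed

text \<open>Since \<open>p \<cdot> q\<close> and \<open>q \<cdot> p\<close> differ by a central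
  factor, they induce the same conjugation, so the operators \<open>Ad p\<close> and
  \<open>Ad q\<close> commute. Differentiating in both variables makes the operators
  \<open>br u\<close> and \<open>br v\<close> commute, and the Jacobi identity gives the
  claim.\<close>

lemma br_two_step:
  assumes "two_step_nilpotent G"
  shows "br x (br y z) = 0"
proof -
  have comm: "iv q \<cdot> (iv p \<cdot> (y \<cdot> p) \<cdot> q) = iv p \<cdot> (iv q \<cdot> (y \<cdot> q) \<cdot> p)" for p q y
  proof -
    have "p \<cdot> q \<cdot> iv p \<cdot> iv q \<cdot> c = c \<cdot> (p \<cdot> q \<cdot> iv p \<cdot> iv q)" for c
      using assms by (simp add: two_step_nilpotent_def carrier Let_def)
    moreover have "p \<cdot> q = p \<cdot> q \<cdot> iv p \<cdot> iv q \<cdot> (q \<cdot> p)" by (simp add: assoc)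
    ultimately obtain k where pq: "p \<cdot> q = k \<cdot> (q \<cdot> p)" and k: "\<And>c. k \<cdot> c = c \<cdot> k" by metis
    have "iv q \<cdot> (iv p \<cdot> (y \<cdot> p) \<cdot> q) = iv (p \<cdot> q) \<cdot> (y \<cdot> (p \<cdot> q))" by (simp add: iv_mul assoc)
    also have "\<dots> = iv (q \<cdot> p) \<cdot> (iv k \<cdot> (k \<cdot> y)) \<cdot> (q \<cdot> p)"
      unfolding pq iv_mul[of k] k[of y] by (simp only: assoc)
    also have "\<dots> = iv p \<cdot> (iv q \<cdot> (y \<cdot> q) \<cdot> p)" by (simp add: iv_mul assoc)
    finally show ?thesis .
  qed
  have sm: "smooth_map A A (\<lambda>y. iv p \<cdot> (y \<cdot> p))" for p
    by (intro smooth_mul cA smooth_map_const smooth_map_id open_mfd)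
  have "\<iota> (Ad p (Ad q w)) = \<iota> (Ad q (Ad p w))" for p q w
    by (simp add: \<iota>_Ad pushforward_compose[OF cA cA sm] comm)
  then have Ad_comm: "Ad p (Ad q w) = Ad q (Ad p w)" for p q w by (simp add: \<iota>_inj)
  \<comment> \<open>First differentiation, in \<open>p\<close> at the identity; \<open>q\<close>
    stays fixed.\<close>
  have 1: "br u (Ad q w) = Ad q (br u w)" for u q w
  proof -
    have "- br u (Ad q w) = tangent_vec (\<Lambda> u e) (\<lambda>p. Ad p (Ad q w))"
      by (simp add: derivative_Ad Ad_one)
    also have "\<dots> = tangent_vec (\<Lambda> u e) (\<lambda>p. Ad q (Ad p w))" using Ad_comm by simp
    also have "\<dots> = Ad q (- br u w)"
      by (simp add: tangent_vec_linear[OF cA frame_in linear_Ad smooth_Ad] derivative_Ad Ad_one)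
    finally show ?thesis by (simp add: linear_neg[OF linear_Ad])
  qed
  \<comment> \<open>Second differentiation, in \<open>q\<close> at the identity.\<close>
  have 2: "br u (br v w) = br v (br u w)" for u v w
  proof -
    have lin: "linear (br u)" using bilinear_br by (simp add: bilinear_def)
    have "- br u (br v w) = tangent_vec (\<Lambda> v e) (\<lambda>q. br u (Ad q w))"
      by (simp add: tangent_vec_linear[OF cA frame_in lin smooth_Ad] derivative_Ad Ad_one linear_neg[OF lin])
    also have "\<dots> = tangent_vec (\<Lambda> v e) (\<lambda>q. Ad q (br u w))" by (simp add: 1)
    also have "\<dots> = - br v (br u w)" by (simp add: derivative_Ad Ad_one)
    finally show ?thesis by simp
  qed
  have "br (br y z) x = 0" using br_jacobi[of y z x] 2[of y z x] by simp
  then show ?thesis using br_skew[of x "br y z"] by simp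
qed

text \<open>With zero bracket \<open>Ad\<close> has zero derivative and is trivial on a connected
  group, so left and right invariant fields coincide. Then
  \<open>f (x \<cdot> a \<cdot> iv x)\<close> has zero derivative in \<open>x\<close> for every
  smooth \<open>f\<close>, and smooth functions separate points.\<close>

lemma comm_group_if_br_zero:
  assumes conn: "connected (UNIV :: 'g set)" and br0: "\<And>x y. br x y = 0"
  shows "comm_group G"
proof -
  have "Ad p w \<bullet> k = w \<bullet> k" for p w k
  proof -
    have "v (\<lambda>p. Ad p w \<bullet> k) = 0" if v: "v \<in> tangent_space A p" for v p
    proof -
      obtain u where u: "v = \<Lambda> u p" using v range_frame by blast
      show ?thesis
        using inner_tangent_vec[OF cA frame_in smooth_Ad, of u p w k] derivative_Ad[of u p w] br0 u by simp
    qed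
    then have "Ad p w \<bullet> k = Ad e w \<bullet> k"
      by (rule tangent_zero_imp_const[OF open_mfd conn smooth_vecD[OF smooth_Ad]])
    then show ?thesis by (simp add: Ad_one)
  qed
  then have "Ad p w = w" for p w by (metis inner_commute vector_eq_ldot)
  then have LR: "LI (\<iota> w) p = RI (\<iota> w) p" for w p using frame_Ad[of p w] by (simp add: \<Lambda>_def)
  note id = smooth_map_id[OF open_mfd] and P = charted_prod[OF cA cA]
  note fst = smooth_map_fst[OF open_mfd open_mfd] and snd = smooth_map_snd[OF open_mfd open_mfd]
  have conj: "f (x \<cdot> a \<cdot> iv x) = f a" if f: "f \<in> smooth_functions A" for f x a
  proof -
    let ?F = "\<lambda>x. f (x \<cdot> a \<cdot> iv x)"
    have F: "?F \<in> smooth_functions A"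
      by (intro smooth_functions_compose[OF cA cA _ f] smooth_mul cA smooth_map_const id smooth_iv)
    have "v ?F = 0" if v: "v \<in> tangent_space A p" for v p
    proof -
      obtain w where w: "v = LI (\<iota> w) p" using v range_frame[of p] by (auto simp: \<Lambda>_def)
      let ?f = "\<lambda>z. f (p \<cdot> z \<cdot> iv p)"
      have f': "?f \<in> smooth_functions A"
        by (intro smooth_functions_compose[OF cA cA _ f] smooth_mul cA smooth_map_const id)
      \<comment> \<open>\<open>K1\<close> separates the two occurrences of the variable in the
        conjugation; \<open>K2\<close> serves to differentiate the inverse.\<close>
      have K1: "(\<lambda>z. ?f (fst z \<cdot> a \<cdot> iv (snd z))) \<in> smooth_functions (prod_atlas A A)"
        by (intro smooth_functions_compose[OF P cA _ f'] smooth_mul P smooth_map_const cA fst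
            smooth_map_compose[OF P cA cA snd smooth_iv])
      have K2: "(\<lambda>z. ?f (a \<cdot> (fst z \<cdot> iv (snd z)))) \<in> smooth_functions (prod_atlas A A)"
        by (intro smooth_functions_compose[OF P cA _ f'] smooth_mul P smooth_map_const cA fst
            smooth_map_compose[OF P cA cA snd smooth_iv])
      have "v ?F = \<iota> w (\<lambda>y. ?f (y \<cdot> a \<cdot> iv y))"
        unfolding w LI_apply[OF F] by (simp add: iv_mul assoc)
      also have "\<dots> = \<iota> w (\<lambda>y. ?f (y \<cdot> a)) + \<iota> w (\<lambda>y. ?f (a \<cdot> iv y))"
        using tangent_diagonal[OF open_mfd \<iota>_in K1] by simp
      \<comment> \<open>\<open>K2\<close> is constant on the diagonal, so its two partial
        derivatives cancel; the differential of inversion is minus the identity.\<close>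
      also have "\<iota> w (\<lambda>y. ?f (a \<cdot> iv y)) = - \<iota> w (\<lambda>y. ?f (a \<cdot> y))"
        using tangent_diagonal[OF open_mfd \<iota>_in K2, of w] tangent_const[OF cA \<iota>_in] by simp
      also have "\<iota> w (\<lambda>y. ?f (y \<cdot> a)) + - \<iota> w (\<lambda>y. ?f (a \<cdot> y)) = RI (\<iota> w) a ?f - LI (\<iota> w) a ?f"
        by (simp add: RI_apply[OF f'] LI_apply[OF f'])
      finally show ?thesis by (simp add: LR)
    qed
    then have "?F x = ?F e" by (rule tangent_zero_imp_const[OF open_mfd conn F])
    then show ?thesis by simp
  qed
  have "x \<cdot> a = a \<cdot> x" for x a
  proof -
    have "x \<cdot> a \<cdot> iv x = a"
      using smooth_functions_separate[OF open_mfd, of "x \<cdot> a \<cdot> iv x" a] conj by metis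
    then show ?thesis by (metis assoc mul_one(1) mul_inv(2))
  qed
  then show ?thesis using group.group_comm_groupI[OF group] by simp
qed

end

section \<open>Traces\<close>

text \<open>Independence of the trace from the basis \<open>B\<close> picked by choice. Expanding
  \<open>F b\<close> over \<open>K\<close>, exchanging the sums and expanding each member of
  \<open>K\<close> back over \<open>B\<close> leaves the diagonal coefficients with respect to
  \<open>K\<close>.\<close>

lemma trace_on_image:
  fixes \<iota> :: "'e::euclidean_space \<Rightarrow> 'v::real_vector"
  assumes \<iota>: "linear \<iota>" "inj \<iota>" and S: "subspace S" and K: "finite K" "K \<subseteq> S"
    and rep: "\<And>x. x \<in> S \<Longrightarrow> x = (\<Sum>k\<in>K. (x \<bullet> k) *\<^sub>R k)"
    and t: "linear t" "\<And>x. x \<in> S \<Longrightarrow> t x \<in> S" "\<And>x. x \<in> S \<Longrightarrow> F (\<iota> x) = \<iota> (t x)"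
  shows "trace_on (\<iota> ` S) F = (\<Sum>k\<in>K. t k \<bullet> k)"
proof -
  have sub: "subspace (\<iota> ` S)" by (rule linear_subspace_image[OF \<iota>(1) S])
  define B where "B = (SOME B. independent B \<and> span B = \<iota> ` S)"
  have "\<exists>B. independent B \<and> span B = \<iota> ` S"
    using maximal_independent_subset[of "\<iota> ` S"] span_minimal[OF _ sub] by (metis subset_antisym)
  then have B: "independent B" "span B = \<iota> ` S" unfolding B_def by (metis (mono_tags, lifting) someI_ex)+
  have span: "\<iota> ` S \<subseteq> span (\<iota> ` K)"
  proof
    fix v assume "v \<in> \<iota> ` S"
    then obtain x where x: "x \<in> S" "v = \<iota> x" by blast
    have "v = (\<Sum>k\<in>K. (x \<bullet> k) *\<^sub>R \<iota> k)"
      using rep[OF x(1)] x(2) by (metis (no_types, lifting) \<iota>(1) linear_scale linear_sum sum.cong)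
    then show "v \<in> span (\<iota> ` K)" by (simp add: span_sum span_scale span_base)
  qed
  \<comment> \<open>\<open>trace_on\<close> sums over \<open>B\<close>, and a sum over an infinite
    set would be 0. Finiteness follows as \<open>B\<close> is independent and lies in the span of a
    finite set.\<close>
  have fin: "finite B"
    using independent_span_bound[of "\<iota> ` K" B] K(1) B span span_superset[of B] by auto
  define \<kappa> where "\<kappa> b = inv_into UNIV \<iota> b" for b
  have \<kappa>: "\<iota> (\<kappa> b) = b" "\<kappa> b \<in> S" if "b \<in> B" for b
  proof -
    have "b \<in> \<iota> ` S" using that B(2) span_base by blast
    then obtain x where "x \<in> S" "b = \<iota> x" by blast
    then show "\<iota> (\<kappa> b) = b" "\<kappa> b \<in> S" by (simp_all add: \<kappa>_def \<iota>(2))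
  qed
  have in_span: "\<iota> x \<in> span B" if "x \<in> S" for x using that B(2) by blast
  have "trace_on (\<iota> ` S) F = (\<Sum>b\<in>B. representation B (F b) b)"
    by (simp add: trace_on_def B_def[symmetric])
  also have "\<dots> = (\<Sum>b\<in>B. \<Sum>k\<in>K. (t (\<kappa> b) \<bullet> k) * representation B (\<iota> k) b)"
  proof (rule sum.cong[OF refl])
    fix b assume b: "b \<in> B"
    have "F b = \<iota> (t (\<kappa> b))" using t(3)[OF \<kappa>(2)[OF b]] \<kappa>(1)[OF b] by simp
    also have "\<dots> = \<iota> (\<Sum>k\<in>K. (t (\<kappa> b) \<bullet> k) *\<^sub>R k)" using rep[OF t(2)[OF \<kappa>(2)[OF b]]] by simp
    also have "\<dots> = (\<Sum>k\<in>K. (t (\<kappa> b) \<bullet> k) *\<^sub>R \<iota> k)" by (simp add: linear_sum[OF \<iota>(1)] linear_scale[OF \<iota>(1)])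
    finally have "F b = (\<Sum>k\<in>K. (t (\<kappa> b) \<bullet> k) *\<^sub>R \<iota> k)" .
    then show "representation B (F b) b = (\<Sum>k\<in>K. (t (\<kappa> b) \<bullet> k) * representation B (\<iota> k) b)"
      using K(2) in_span by (simp add: representation_sum[OF B(1)] span_scale representation_scale[OF B(1)] subset_eq)
  qed
  also have "\<dots> = (\<Sum>k\<in>K. \<Sum>b\<in>B. (t (\<kappa> b) \<bullet> k) * representation B (\<iota> k) b)" by (rule sum.swap)
  also have "\<dots> = (\<Sum>k\<in>K. t k \<bullet> k)"
  proof (rule sum.cong[OF refl])
    fix k assume k: "k \<in> K"
    then have kS: "\<iota> k \<in> span B" using K(2) in_span by blast
    have "\<iota> (\<Sum>b\<in>B. representation B (\<iota> k) b *\<^sub>R \<kappa> b) = (\<Sum>b\<in>B. representation B (\<iota> k) b *\<^sub>R b)"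
      using \<kappa>(1) by (simp add: linear_sum[OF \<iota>(1)] linear_scale[OF \<iota>(1)])
    also have "\<dots> = \<iota> k" by (rule sum_representation_eq[OF B(1) kS fin order_refl])
    finally have "(\<Sum>b\<in>B. representation B (\<iota> k) b *\<^sub>R \<kappa> b) = k" using \<iota>(2) by (simp add: inj_eq)
    from arg_cong[OF this, of t] have "t k = (\<Sum>b\<in>B. representation B (\<iota> k) b *\<^sub>R t (\<kappa> b))"
      by (simp add: linear_sum[OF t(1)] linear_scale[OF t(1)])
    then have "t k \<bullet> k = (\<Sum>b\<in>B. representation B (\<iota> k) b *\<^sub>R t (\<kappa> b)) \<bullet> k" by simp
    then show "(\<Sum>b\<in>B. (t (\<kappa> b) \<bullet> k) * representation B (\<iota> k) b) = t k \<bullet> k"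
      by (simp add: inner_sum_left mult.commute)
  qed
  finally show ?thesis .
qed

section \<open>Homomorphisms of Riemannian Lie groups\<close>

locale lie_hom = G: lie G A g + H: lie H B h
  for G :: "'g::{t2_space,second_countable_topology} monoid"
    and A :: "('g, 'e::euclidean_space) atlas" and g :: "'g metric"
    and H :: "'h::{t2_space,second_countable_topology} monoid"
    and B :: "('h, 'f::euclidean_space) atlas" and h :: "'h metric" +
  fixes \<phi> :: "'g \<Rightarrow> 'h"
  assumes smooth_hom: "smooth_map A B \<phi>" and hom: "\<phi> \<in> hom G H"
begin

lemma hom_mul: "\<phi> (x \<otimes>\<^bsub>G\<^esub> y) = \<phi> x \<otimes>\<^bsub>H\<^esub> \<phi> y"
  using hom by (simp add: hom_def G.carrier)

lemma hom_one: "\<phi> \<one>\<^bsub>G\<^esub> = \<one>\<^bsub>H\<^esub>"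
  by (rule hom_one[OF hom G.group H.group])

definition \<xi> :: "'e \<Rightarrow> 'f" where "\<xi> x = inv_into UNIV H.\<iota> (pushforward B \<phi> (G.\<iota> x))"

lemma push_in: "v \<in> tangent_space A \<one>\<^bsub>G\<^esub> \<Longrightarrow> pushforward B \<phi> v \<in> tangent_space B \<one>\<^bsub>H\<^esub>"
  using pushforward_in[OF G.cA H.cA smooth_hom, of v "\<one>\<^bsub>G\<^esub>"] by (simp add: hom_one)

lemma \<iota>_\<xi>: "H.\<iota> (\<xi> x) = pushforward B \<phi> (G.\<iota> x)"
  unfolding \<xi>_def by (intro H.\<iota>_surj push_in G.\<iota>_in)

text \<open>Both brackets are antisymmetrized second derivatives of a function of a product at the
  identity, and \<phi> turns products in \<open>G\<close> into products in \<open>H\<close>.\<close>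

lemma push_lie_bracket:
  assumes u: "u \<in> tangent_space A \<one>\<^bsub>G\<^esub>" and v: "v \<in> tangent_space A \<one>\<^bsub>G\<^esub>"
  shows "pushforward B \<phi> (lie_bracket G A u v) = lie_bracket H B (pushforward B \<phi> u) (pushforward B \<phi> v)"
proof
  fix f
  note t = H.lie_bracket_in[OF push_in[OF u] push_in[OF v]]
  show "pushforward B \<phi> (lie_bracket G A u v) f = lie_bracket H B (pushforward B \<phi> u) (pushforward B \<phi> v) f"
  proof (cases "f \<in> smooth_functions B")
    case True
    have f\<phi>: "(\<lambda>x. f (\<phi> x)) \<in> smooth_functions A"
      by (rule smooth_functions_compose[OF G.cA H.cA smooth_hom True])
    have *: "pushforward B \<phi> u (\<lambda>x. pushforward B \<phi> v (\<lambda>y. f (x \<otimes>\<^bsub>H\<^esub> y))) =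
        u (\<lambda>x. v (\<lambda>y. f (\<phi> (x \<otimes>\<^bsub>G\<^esub> y))))" if v: "v \<in> tangent_space A \<one>\<^bsub>G\<^esub>" for u v
    proof -
      have "(\<lambda>x. pushforward B \<phi> v (\<lambda>y. f (x \<otimes>\<^bsub>H\<^esub> y))) \<in> smooth_functions B"
        using smooth_partial_const[OF H.open_mfd H.open_mfd push_in[OF v] H.smooth_mul_fun[OF True]] by simp
      then show ?thesis
        by (simp add: pushforward_def o_def H.smooth_left_fun[OF True] hom_mul)
    qed
    show ?thesis
      unfolding H.lie_bracket_apply[OF push_in[OF u] push_in[OF v] True] *[OF v] *[OF u]
      using G.lie_bracket_apply[OF u v f\<phi>] True by (simp add: pushforward_def o_def)
  next
    case False
    then show ?thesis using tangent_space_not_smooth[OF t] by (simp add: pushforward_def)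
  qed
qed

sublocale framed_hom B h H.\<Lambda> H.br A \<phi> g G.\<Lambda> G.br \<xi>
proof (intro framed_hom.intro framed_hom_axioms.intro)
  show "framed_map B h H.\<Lambda> H.br A \<phi>" by (rule H.framed_map_lie[OF G.open_mfd smooth_hom])
  show "framed A g G.\<Lambda> G.br" by (rule G.framed_axioms)
  show "pushforward B \<phi> (G.\<Lambda> x p) = H.\<Lambda> (\<xi> x) (\<phi> p)" for x p
    by (simp add: G.\<Lambda>_def H.\<Lambda>_def left_invariant_field_def \<iota>_\<xi> pushforward_compose[OF G.cA H.cA smooth_hom]
        pushforward_compose[OF H.cA H.cA H.smooth_left] hom_mul)
  show "\<xi> (G.br x y) = H.br (\<xi> x) (\<xi> y)" for x y
    using push_lie_bracket[OF G.\<iota>_in G.\<iota>_in, of x y] by (simp add: \<iota>_\<xi> G.\<iota>_br H.\<iota>_br flip: H.\<iota>_inj)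
qed

lemma kernel_eq: "kernel_at A B \<phi> \<one>\<^bsub>G\<^esub> = G.\<iota> ` {x. \<xi> x = 0}"
proof -
  have "pushforward B \<phi> (G.\<iota> x) = 0 \<longleftrightarrow> \<xi> x = 0" for x
    using H.\<iota>_inj[of "\<xi> x" 0] linear_0[OF H.\<iota>(1)] by (simp add: \<iota>_\<xi>)
  moreover have "tangent_space A \<one>\<^bsub>G\<^esub> = range G.\<iota>" using G.\<iota>(2) by (simp add: bij_betw_def)
  ultimately show ?thesis unfolding kernel_at_def by auto
qed

lemma trace_unimodular:
  assumes uni: "unimodular G A (lie_algebra G A)"
  shows "(\<Sum>b\<in>Basis. G.br x b \<bullet> b) = 0"
proof -
  have T: "lie_algebra G A = G.\<iota> ` UNIV" using G.\<iota>(2) by (simp add: bij_betw_def lie_algebra_def)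
  have "trace_on (G.\<iota> ` UNIV) (lie_bracket G A (G.\<iota> x)) = (\<Sum>b\<in>Basis. G.br x b \<bullet> b)"
    using G.\<iota>(2) linear_brG(1)
    by (intro trace_on_image) (auto simp: G.\<iota> bij_betw_def euclidean_representation G.\<iota>_br)
  then show ?thesis using uni unfolding unimodular_def T by auto
qed

lemma kernel_basis:
  obtains K where "finite K" "\<And>k. k \<in> K \<Longrightarrow> \<xi> k = 0" "\<And>x. \<xi> x = 0 \<Longrightarrow> x = (\<Sum>k\<in>K. (x \<bullet> k) *\<^sub>R k)"
proof -
  let ?S = "{x. \<xi> x = 0}"
  have S: "subspace ?S" by (rule linear_subspace_kernel[OF linear_\<xi>])
  obtain K where K: "K \<subseteq> ?S" "pairwise orthogonal K" "\<And>x. x \<in> K \<Longrightarrow> norm x = 1" "independent K" "span K = ?S"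
    using orthonormal_basis_subspace[OF S] by metis
  have fin: "finite K" using K(4) independent_bound by blast
  have "x = (\<Sum>k\<in>K. (x \<bullet> k) *\<^sub>R k)" if x: "\<xi> x = 0" for x
  proof -
    let ?y = "x - (\<Sum>k\<in>K. (x \<bullet> k) *\<^sub>R k)"
    have "orthogonal ?y j" if j: "j \<in> K" for j
    proof -
      have "(\<Sum>k\<in>K. (x \<bullet> k) * (k \<bullet> j)) = (\<Sum>k\<in>K. if k = j then x \<bullet> k else 0)"
      proof (intro sum.cong refl)
        fix k assume k: "k \<in> K"
        show "(x \<bullet> k) * (k \<bullet> j) = (if k = j then x \<bullet> k else 0)"
          using K(2,3) k j by (auto simp: pairwise_def orthogonal_def norm_eq_1)
      qed
      then show ?thesis using fin j by (simp add: orthogonal_def inner_diff_left inner_sum_left)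
    qed
    moreover have "x \<in> span K" using x K(5) by blast
    then have "?y \<in> span K"
      by (rule span_diff[OF _ span_sum[OF span_scale[OF span_base]]])
    ultimately have "orthogonal ?y ?y" using orthogonal_to_span by blast
    then show ?thesis by (simp add: orthogonal_def)
  qed
  then show thesis using that fin K(1) by blast
qed

lemma trace_unimodular_kernel:
  assumes uni: "unimodular G A (kernel_at A B \<phi> \<one>\<^bsub>G\<^esub>)"
    and K: "finite K" "\<And>k. k \<in> K \<Longrightarrow> \<xi> k = 0" "\<And>x. \<xi> x = 0 \<Longrightarrow> x = (\<Sum>k\<in>K. (x \<bullet> k) *\<^sub>R k)"
    and x: "\<xi> x = 0"
  shows "(\<Sum>k\<in>K. G.br x k \<bullet> k) = 0"
proof -
  let ?S = "{x. \<xi> x = 0}"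
  have "trace_on (G.\<iota> ` ?S) (lie_bracket G A (G.\<iota> x)) = (\<Sum>k\<in>K. G.br x k \<bullet> k)"
  proof (rule trace_on_image)
    show "inj G.\<iota>" using G.\<iota>(2) by (simp add: bij_betw_def)
    show "subspace ?S" by (rule linear_subspace_kernel[OF linear_\<xi>])
    \<comment> \<open>\<xi> preserves brackets, so its kernel is invariant under the adjoint
      action.\<close>
    show "G.br x y \<in> ?S" if "y \<in> ?S" for y
      using that x by (simp add: \<xi>_br linear_0[OF linear_br(1)])
  qed (use K G.\<iota> linear_brG(1) G.\<iota>_br in auto)
  moreover have "G.\<iota> x \<in> kernel_at A B \<phi> \<one>\<^bsub>G\<^esub>" using x by (simp add: kernel_eq)
  then have "trace_on (kernel_at A B \<phi> \<one>\<^bsub>G\<^esub>) (lie_bracket G A (G.\<iota> x)) = 0"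
    using uni by (simp add: unimodular_def)
  ultimately show ?thesis by (simp add: kernel_eq)
qed

lemma submersion_section:
  assumes sub: "riemannian_submersion A g B h \<phi>"
  shows "\<xi> (adjoint \<xi> y) = y"
proof (rule adjoint_section)
  have rG: "tangent_space A \<one>\<^bsub>G\<^esub> = range G.\<iota>" using G.\<iota>(2) by (simp add: bij_betw_def)
  show "surj \<xi>"
  proof (rule surjI)
    fix y
    have "H.\<iota> y \<in> pushforward B \<phi> ` tangent_space A \<one>\<^bsub>G\<^esub>"
      using sub H.\<iota>_in[of y] unfolding riemannian_submersion_def by (simp add: hom_one)
    then have "\<exists>x. H.\<iota> y = H.\<iota> (\<xi> x)" unfolding rG by (auto simp: \<iota>_\<xi>)
    then have "\<exists>x. \<xi> x = y" by (metis H.\<iota>_inj)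
    then show "\<xi> (SOME x. \<xi> x = y) = y" by (rule someI_ex)
  qed
  fix x y assume "\<And>u. \<xi> u = 0 \<Longrightarrow> u \<bullet> x = 0" "\<And>u. \<xi> u = 0 \<Longrightarrow> u \<bullet> y = 0"
  then have "G.\<iota> x \<in> orthogonal_at A g \<one>\<^bsub>G\<^esub> (kernel_at A B \<phi> \<one>\<^bsub>G\<^esub>)"
    "G.\<iota> y \<in> orthogonal_at A g \<one>\<^bsub>G\<^esub> (kernel_at A B \<phi> \<one>\<^bsub>G\<^esub>)"
    unfolding orthogonal_at_def kernel_eq by (auto simp: G.\<iota>_in G.\<iota>(3))
  then have "h (\<phi> \<one>\<^bsub>G\<^esub>) (pushforward B \<phi> (G.\<iota> x)) (pushforward B \<phi> (G.\<iota> y)) = g \<one>\<^bsub>G\<^esub> (G.\<iota> x) (G.\<iota> y)"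
    using sub unfolding riemannian_submersion_def by blast
  then show "\<xi> x \<bullet> \<xi> y = x \<bullet> y"
    by (simp add: hom_one G.\<iota>(3) H.\<iota>(3) flip: \<iota>_\<xi>)
qed

lemma harmonic_iff_biharmonic:
  assumes conn: "connected (UNIV :: 'h set)"
    and cases: "two_step_nilpotent H \<and> unimodular G A (lie_algebra G A) \<or>
       riemannian_submersion A g B h \<phi> \<and> unimodular G A (lie_algebra G A) \<or>
       riemannian_submersion A g B h \<phi> \<and> unimodular G A (kernel_at A B \<phi> \<one>\<^bsub>G\<^esub>) \<and>
         manifold_dim B = 2 \<and> \<not> comm_group H"
  shows "harmonic A g B h \<phi> \<longleftrightarrow> biharmonic A g B h \<phi>"
proof -
  have "\<tau> = 0" if 0: "\<tau>2 = 0"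
    using cases
  proof (elim disjE conjE)
    assume "two_step_nilpotent H" "unimodular G A (lie_algebra G A)"
    then show ?thesis using trace_unimodular H.br_two_step 0 by (intro case_two_step) auto
  next
    assume "riemannian_submersion A g B h \<phi>" "unimodular G A (lie_algebra G A)"
    then show ?thesis using trace_unimodular submersion_section 0 by (intro case_submersion) auto
  next
    assume sub: "riemannian_submersion A g B h \<phi>" and uni: "unimodular G A (kernel_at A B \<phi> \<one>\<^bsub>G\<^esub>)"
      and dim: "manifold_dim B = 2" and nonab: "\<not> comm_group H"
    have d: "DIM('f) = 2" using dim H.open_mfd by (simp add: manifold_dim_def open_manifold_def)
    obtain x y where "H.br x y \<noteq> 0" using H.comm_group_if_br_zero[OF conn] nonab by blast
    moreover obtain K where "finite K" "\<And>k. k \<in> K \<Longrightarrow> \<xi> k = 0" "\<And>x. \<xi> x = 0 \<Longrightarrow> x = (\<Sum>k\<in>K. (x \<bullet> k) *\<^sub>R k)"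
      using kernel_basis by blast
    ultimately show ?thesis
      using case_dim_2[OF submersion_section[OF sub], of K x y] trace_unimodular_kernel[OF uni, of K] d 0 by blast
  qed
  then show ?thesis using \<tau>2_zero_if unfolding harmonic_iff biharmonic_iff by blast
qed

end

section \<open>Zero-dimensional targets and the final theorem\<close>

lemma zero_dim_singleton:
  fixes B :: "('h::{t2_space,second_countable_topology}, 'f::euclidean_space) atlas"
  assumes B: "smooth_manifold B" and not: "\<not> (\<forall>(U, c)\<in>B. open (c ` U))" and conn: "connected (UNIV :: 'h set)"
  shows "(p :: 'h) = q"
proof -
  note m = B[unfolded smooth_manifold_def]
  have im: "\<And>U c. (U, c) \<in> B \<Longrightarrow> c ` U = {0}" using m not by blast
  \<comment> \<open>A chart is injective with image {0}, so its open domain is one point. The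
    topology is discrete, and a connected discrete space is a point.\<close>
  have op: "open {p}" for p :: 'h
  proof -
    have "p \<in> (\<Union>(U, c)\<in>B. U)" using m by simp
    then obtain U c where U: "(U, c) \<in> B" "p \<in> U" by auto
    then have "homeomorphism U (c ` U) c (inv_into U c)" "open U" using m by auto
    then have "inj_on c U" by (metis homeomorphism_def inj_on_inverseI)
    then have "U = {p}" using im[OF U(1)] U(2)
      by (metis image_eqI inj_on_eq_iff singletonD subset_antisym subsetI empty_subsetI insert_subset)
    then show ?thesis using \<open>open U\<close> by simp
  qed
  have "p = q"
    by (rule connected_local_const[OF conn UNIV_I UNIV_I, where f = "\<lambda>x. x"])
      (use op in \<open>auto simp: eventually_at_topological\<close>)
  then show ?thesis .
qed

lemma tangent_space_point:
  assumes pt: "\<And>x. x = p" and v: "v \<in> tangent_space B p"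
  shows "v = 0"
proof
  fix f
  have const: "f = (\<lambda>_. f p)" for f :: "_ \<Rightarrow> real" using pt by (metis ext)
  show "v f = 0 f"
  proof (cases "f \<in> smooth_functions B")
    case True
    show ?thesis
    proof (cases "f p = 0")
      case True
      then have "f = (\<lambda>x. 0 * f x)" using const[of f] by simp
      then show ?thesis using tangent_space_scale[OF v \<open>f \<in> _\<close>, of 0] by simp
    next
      case False
      have 1: "(\<lambda>x. inverse (f p) * f x) = (\<lambda>_. 1)" using const[of f] False by (metis left_inverse)
      \<comment> \<open>On a point the square of \<open>f\<close> is \<open>f\<close> scaled by
        \<open>f p\<close>. Homogeneity gives \<open>f p * v f\<close> for its derivative, the
        Leibniz rule twice that.\<close>
      have "(\<lambda>x. f x * f x) = (\<lambda>x. f p * f x)" using const[of f] by metis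
      then have "v (\<lambda>x. f x * f x) = f p * v f" using tangent_space_scale[OF v True] by simp
      then have "f p * v f = 0" using tangent_spaceD(2)[OF v True True] by simp
      then show ?thesis using False by simp
    qed
  next
    case False
    then show ?thesis using tangent_space_not_smooth[OF v] by simp
  qed
qed

lemma fscale_zero: "fscale f 0 = 0"
  by (rule ext) (simp add: fscale_apply)

lemma fields_along_zero:
  assumes "\<And>q v. v \<in> tangent_space B q \<Longrightarrow> v = 0" "V \<in> fields_along A B \<phi>"
  shows "V = 0"
proof
  fix p
  have "V p \<in> tangent_space B (\<phi> p)" using assms(2) by (simp add: fields_along_def)
  then show "V p = 0 p" using assms(1) by simp
qed

lemma connection_along_zero:
  assumes V0: "\<And>q v. v \<in> tangent_space B q \<Longrightarrow> v = 0" and z: "0 \<in> fields_along A B \<phi>"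
  shows "connection_along A B \<phi> (\<lambda>_ _. 0)"
  unfolding connection_along_def
proof (intro ballI conjI)
  fix X V f assume "V \<in> fields_along A B \<phi>"
  then have "V = 0" using fields_along_zero[of B V A \<phi>] V0 by blast
  then show "0 = fscale (\<lambda>p. X p f) V + fscale f 0" by (simp add: fscale_zero)
qed (use z in \<open>simp_all add: fscale_zero\<close>)

text \<open>A target without open charts is a point, so all its tangent vectors vanish and both
  tension fields are zero.\<close>

lemma harmonic_to_point:
  fixes B :: "('h::{t2_space,second_countable_topology}, 'f::euclidean_space) atlas"
  assumes G: "lie G A g" and met: "riemannian_metric B h"
    and pt: "\<And>x y :: 'h. x = y" and all: "smooth_functions B = UNIV"
  shows "harmonic A g B h \<phi>" and "biharmonic A g B h \<phi>"
proof -
  interpret G: lie G A g by (rule G)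
  have T0: "v = 0" if "v \<in> tangent_space B q" for v q
    by (rule tangent_space_point[OF pt that])
  have T0': "0 \<in> tangent_space B q" for q by (rule subspace_0[OF subspace_tangent_space])
  have AF: "0 \<in> fields_along A B \<phi>"
    using T0' smooth_functions_const[OF G.cA, of 0] by (simp add: fields_along_def)
  have BF: "0 \<in> fields_along B B \<psi>" for \<psi>
    using T0' by (simp add: fields_along_def all)
  have V0: "X = 0" if "X \<in> vector_fields B" for X
    using fields_along_zero[OF T0] that by (auto simp: vector_fields_def)
  have vf0: "0 \<in> vector_fields B" using BF by (simp add: vector_fields_def)
  have extn: "extension B q 0 \<in> vector_fields B" for q
  proof -
    have "\<exists>X. X \<in> vector_fields B \<and> X q = 0" using vf0 by (intro exI[of _ 0]) simp
    from someI_ex[OF this] show ?thesis unfolding extension_def by blast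
  qed
  have h0: "h q 0 0 = 0" for q
  proof -
    have "h q (0 *\<^sub>R 0 + 0 *\<^sub>R 0) 0 = 0 * h q 0 0 + 0 * h q 0 0"
      using met T0' unfolding riemannian_metric_def by blast
    then show ?thesis by simp
  qed
  have br0: "bracket X Y = 0" if "X \<in> vector_fields B" "Y \<in> vector_fields B" for X Y
    unfolding V0[OF that(1)] V0[OF that(2)] by (simp add: bracket_def fun_eq_iff)
  \<comment> \<open>The zero operator shows that the choice in \<open>levi_civita\<close> is not
    vacuous, so the chosen connection has values in vector fields, which are all 0.\<close>
  have "is_levi_civita B h (\<lambda>_ _. 0)"
    unfolding is_levi_civita_def
  proof (intro conjI ballI allI)
    show "connection_along B B id (\<lambda>_ _. 0)" by (rule connection_along_zero[OF T0 BF])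
    fix X Y Z p assume "X \<in> vector_fields B" "Y \<in> vector_fields B" "Z \<in> vector_fields B"
    then show "0 - 0 = bracket X Y"
      "X p (\<lambda>q. h q (Y q) (Z q)) = h p ((0 :: 'h \<Rightarrow> 'h tvec) p) (Z p) + h p (Y p) ((0 :: 'h \<Rightarrow> 'h tvec) p)"
      using br0 V0[of X] V0[of Y] V0[of Z] by (simp_all add: h0)
  qed
  then have LC: "is_levi_civita B h (levi_civita B h)"
    unfolding levi_civita_def by (rule someI[of "is_levi_civita B h"])
  then have lc: "levi_civita B h X Y \<in> vector_fields B" if "X \<in> vector_fields B" "Y \<in> vector_fields B" for X Y
    using that by (simp add: is_levi_civita_def connection_along_def vector_fields_def)
  have push: "pushforward B \<phi> v = 0" if "v \<in> tangent_space A p" for v p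
  proof
    fix f :: "'h \<Rightarrow> real"
    have "f \<circ> \<phi> = (\<lambda>_. f (\<phi> p))" using pt by (metis comp_apply ext)
    then show "pushforward B \<phi> v f = 0 f"
      by (simp add: pushforward_def tangent_const[OF G.cA that])
  qed
  let ?P = "\<lambda>D. connection_along A B \<phi> D \<and>
     (\<forall>X\<in>vector_fields A. \<forall>Y\<in>vector_fields B. \<forall>p.
        D X (Y \<circ> \<phi>) p = levi_civita B h (extension B (\<phi> p) (pushforward B \<phi> (X p))) Y (\<phi> p))"
  have "connection_along A B \<phi> (\<lambda>_ _. 0)" by (rule connection_along_zero[OF T0 AF])
  moreover have "levi_civita B h (extension B (\<phi> p) (pushforward B \<phi> (X p))) Y (\<phi> p) = 0"
    if "X \<in> vector_fields A" "Y \<in> vector_fields B" for X Y p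
    using V0[OF lc[OF extn that(2)]] push[OF vector_fieldsD(1)[OF that(1)]] by simp
  ultimately have "?P (\<lambda>_ _. 0)" by simp
  then have "?P (pullback_connection A B h \<phi>)"
    unfolding pullback_connection_def by (rule someI[of ?P])
  then have pb: "pullback_connection A B h \<phi> X V = 0"
    if "X \<in> vector_fields A" "V \<in> fields_along A B \<phi>" for X V
    using that by (intro fields_along_zero[OF T0, where A = A and \<phi> = \<phi>]) (auto simp: connection_along_def)
  have lcG: "levi_civita A g X Y \<in> vector_fields A" if "X \<in> vector_fields A" "Y \<in> vector_fields A" for X Y
    by (simp add: G.levi_civita_eq[OF that] G.conn_id_field[OF that])
  have push_field: "(\<lambda>p. pushforward B \<phi> (X p)) = 0" if "X \<in> vector_fields A" for X
    by (rule ext) (simp add: push[OF vector_fieldsD(1)[OF that]])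
  have sff: "second_fundamental_form A g B h \<phi> X Y p = 0"
    if "X \<in> vector_fields A" "Y \<in> vector_fields A" for X Y p
    by (simp add: second_fundamental_form_def push_field that lcG pb AF)
  have E: "(SOME E. orthonormal_frame_at A g p E) i \<in> vector_fields A" if "i < manifold_dim A" for p i
    using someI_ex[OF G.orthonormal_frame_exists, of p] that by (simp add: orthonormal_frame_at_def)
  have ten: "tension_field A g B h \<phi> = 0"
    by (rule ext) (simp add: tension_field_def Let_def sff E)
  then show "harmonic A g B h \<phi>" by (simp add: harmonic_def)
  have "curvature B h q 0 0 0 = 0" for q
    by (simp add: curvature_def Let_def V0[OF lc] lc extn br0 vf0)
  then show "biharmonic A g B h \<phi>"
    by (simp add: biharmonic_def bitension_field_def Let_def ten second_covariant_derivative_def pb AF E lcG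
        push[OF vector_fieldsD(1)])
qed

theorem theorem6p5:
  fixes G :: "'g::{t2_space,second_countable_topology} monoid"
    and A :: "('g, 'e::euclidean_space) atlas"
    and g :: "'g metric"
    and H :: "'h::{t2_space,second_countable_topology} monoid"
    and B :: "('h, 'f::euclidean_space) atlas"
    and h :: "'h metric"
    and \<phi> :: "'g \<Rightarrow> 'h"
  assumes "riemannian_lie_group G A g" and "connected (UNIV :: 'g set)"
    and "riemannian_lie_group H B h" and "connected (UNIV :: 'h set)"
    and "smooth_map A B \<phi>" and "\<phi> \<in> hom G H"
    and cases:
      "two_step_nilpotent H \<and> unimodular G A (lie_algebra G A) \<or>
       riemannian_submersion A g B h \<phi> \<and> unimodular G A (lie_algebra G A) \<or>
       riemannian_submersion A g B h \<phi> \<and>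
         lie_subalgebra G A (orthogonal_at A g \<one>\<^bsub>G\<^esub> (kernel_at A B \<phi> \<one>\<^bsub>G\<^esub>)) \<and>
         unimodular G A (lie_algebra G A) \<or>
       riemannian_submersion A g B h \<phi> \<and> unimodular G A (kernel_at A B \<phi> \<one>\<^bsub>G\<^esub>) \<and>
         manifold_dim B = 2 \<and> \<not> comm_group H"
  shows "harmonic A g B h \<phi> \<longleftrightarrow> biharmonic A g B h \<phi>"
proof (cases "\<forall>(U, c)\<in>A. open (c ` U)")
  case False
  \<comment> \<open>Both tension fields are then empty sums, so harmonicity and biharmonicity hold
    trivially.\<close>
  then have "manifold_dim A = 0" unfolding manifold_dim_def by (rule if_not_P)
  then show ?thesis
    by (simp add: harmonic_def biharmonic_def tension_field_def bitension_field_def Let_def)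
next
  case True
  have mA: "smooth_manifold A" and mB: "smooth_manifold B" and met: "riemannian_metric B h"
    using assms(1,3) by (simp_all add: riemannian_lie_group_def lie_group_def)
  have G: "lie G A g"
    by (rule lie.intro) (use assms(1) True mA in \<open>simp_all add: open_manifold_def\<close>)
  show ?thesis
  proof (cases "\<forall>(U, c)\<in>B. open (c ` U)")
    case True
    have H: "lie H B h"
      by (rule lie.intro) (use assms(3) True mB in \<open>simp_all add: open_manifold_def\<close>)
    interpret lie_hom G A g H B h \<phi>
      by (rule lie_hom.intro[OF G H]) (rule lie_hom_axioms.intro[OF assms(5,6)])
    show ?thesis by (rule harmonic_iff_biharmonic[OF assms(4)]) (use cases in blast)
  next
    case False
    \<comment> \<open>One chart image that is not open leaves only the zero-dimensional alternative
      for all charts; on {0} every function counts as smooth.\<close>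
    have "c ` U = {0}" if "(U, c) \<in> B" for U c
      using mB False that unfolding smooth_manifold_def by blast
    then have "smooth_functions B = UNIV"
      using smooth_on_subset_singleton[of "{0}" 0] by (auto simp: smooth_functions_iff)
    then show ?thesis
      using harmonic_to_point[OF G met zero_dim_singleton[OF mB False assms(4)]] by blast
  qed
qed

end
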